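(* Let $G$ be a finite group, $p$ a prime, $H=G'O^{p'}(G)$, and let $l$ be the number of irreducible ($p$-)Brauer characters of $G$. Let $x\in G^0- H^0$. Then: (1) If $o(xH)$ does not divide $l$, then there exists $\varphi\in \mathrm{IBr}(G)$ such that $\varphi(x)=0$ and $\Phi_\varphi(x)=0$. (2) If $\gcd(o(xH),l)=1$, then there exists $\varphi\in \mathrm{IBr}(G)$ such that $\varphi(x)=0$ and $\Phi_\varphi(x)=0$.
   Context: $F$ is the residue field, of characteristic $p$, of a splitting $p$-modular system for $G$. $G^0$ is the set of $p$-regular elements of $G$ (elements of order prime to $p$), and $H^0$ is the set of $p$-regular elements of $H$. $G'$ is the derived subgroup of $G$ and $O^{p'}(G)$ is the subgroup generated by all $p$-elements of $G$. $o(xH)$ is the order of the element $xH$ in the quotient group $G/H$. $\mathrm{IBr}(G)$ is the set of irreducible Brauer characters of $G$. For $\varphi\in\mathrm{IBr}(G)$, $V_\varphi$ is the simple $F[G]$-module affording $\varphi$, $P_\varphi$ is the projective cover of $V_\varphi$, and $\Phi_\varphi$ is the Brauer character afforded by $P_\varphi$. *)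

theory Defs
  imports
    "HOL-Algebra.Generated_Groups"
    "HOL-Algebra.Multiplicative_Group"
    "HOL-Algebra.Algebraic_Closure_Type"
    "Jordan_Normal_Form.Char_Poly"
    "Jordan_Normal_Form.VS_Connect"
begin

section \<open>Subgroups and elements\<close>

definition p_regular :: "('g, 'b) monoid_scheme \<Rightarrow> nat \<Rightarrow> 'g set \<Rightarrow> 'g set" where
  "p_regular G p A = {g \<in> A. coprime (group.ord G g) p}"

definition O_upper_p' :: "('g, 'b) monoid_scheme \<Rightarrow> nat \<Rightarrow> 'g set" where
  "O_upper_p' G p = generate G {g \<in> carrier G. \<exists>k. group.ord G g = p ^ k}"


section \<open>Finite-dimensional modules over group algebras\<close>

text \<open>
  A finite-dimensional \<open>F[G]\<close>-module is, up to isomorphism, the space \<open>F\<^sup>n\<close> of column vectors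
  together with a homomorphism \<open>\<rho>\<close> from \<open>G\<close> to \<open>GL(n, F)\<close>; it is represented by the pair
  \<open>(n, \<rho>)\<close>, with \<open>g\<close> acting on \<open>F\<^sup>n\<close> by \<open>v \<mapsto> \<rho> g *\<^sub>v v\<close>. The zero module \<open>n = 0\<close> is included.
\<close>

type_synonym ('g, 'f) gmod = "nat \<times> ('g \<Rightarrow> 'f mat)"

abbreviation gdim :: "('g, 'f) gmod \<Rightarrow> nat" where "gdim M \<equiv> fst M"
abbreviation gact :: "('g, 'f) gmod \<Rightarrow> 'g \<Rightarrow> 'f mat" where "gact M \<equiv> snd M"

definition is_gmod :: "('g, 'b) monoid_scheme \<Rightarrow> ('g, 'f::field) gmod \<Rightarrow> bool" where
  "is_gmod G M \<longleftrightarrow> gact M \<in> hom G (units_of (ring_mat TYPE('f) (gdim M) ()))"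

definition gmod_sub :: "('g, 'b) monoid_scheme \<Rightarrow> ('g, 'f::field) gmod \<Rightarrow> 'f vec set \<Rightarrow> bool" where
  "gmod_sub G M W \<longleftrightarrow> subspace class_ring W (module_vec TYPE('f) (gdim M)) \<and>
     (\<forall>g\<in>carrier G. \<forall>w\<in>W. gact M g *\<^sub>v w \<in> W)"

definition simple_gmod :: "('g, 'b) monoid_scheme \<Rightarrow> ('g, 'f::field) gmod \<Rightarrow> bool" where
  "simple_gmod G M \<longleftrightarrow> is_gmod G M \<and> gdim M > 0 \<and>
     (\<forall>W. gmod_sub G M W \<longrightarrow> W = {0\<^sub>v (gdim M)} \<or> W = carrier_vec (gdim M))"

definition gmod_hom ::
  "('g, 'b) monoid_scheme \<Rightarrow> ('g, 'f::field) gmod \<Rightarrow> ('g, 'f) gmod \<Rightarrow> 'f mat set" where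
  "gmod_hom G M N = {T \<in> carrier_mat (gdim N) (gdim M).
     \<forall>g\<in>carrier G. T * gact M g = gact N g * T}"

abbreviation mat_image :: "'f::field mat \<Rightarrow> 'f vec set \<Rightarrow> 'f vec set" where
  "mat_image T W \<equiv> (\<lambda>w. T *\<^sub>v w) ` W"

definition gmod_epi ::
  "('g, 'b) monoid_scheme \<Rightarrow> ('g, 'f::field) gmod \<Rightarrow> ('g, 'f) gmod \<Rightarrow> 'f mat set" where
  "gmod_epi G M N = {T \<in> gmod_hom G M N.
     mat_image T (carrier_vec (gdim M)) = carrier_vec (gdim N)}"

text \<open>
  For a finite-dimensional module over a finite group it suffices to test projectivity against
  finite-dimensional modules.
\<close>

definition projective_gmod :: "('g, 'b) monoid_scheme \<Rightarrow> ('g, 'f::field) gmod \<Rightarrow> bool" where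
  "projective_gmod G P \<longleftrightarrow> is_gmod G P \<and>
     (\<forall>Y Z. is_gmod G Y \<longrightarrow> is_gmod G Z \<longrightarrow>
       (\<forall>S\<in>gmod_epi G Y Z. \<forall>T\<in>gmod_hom G P Z. \<exists>R\<in>gmod_hom G P Y. S * R = T))"

definition essential_epi ::
  "('g, 'b) monoid_scheme \<Rightarrow> ('g, 'f::field) gmod \<Rightarrow> ('g, 'f) gmod \<Rightarrow> 'f mat set" where
  "essential_epi G P V = {T \<in> gmod_epi G P V.
     \<forall>U. gmod_sub G P U \<longrightarrow> mat_image T U = carrier_vec (gdim V) \<longrightarrow> U = carrier_vec (gdim P)}"

definition is_projective_cover ::
  "('g, 'b) monoid_scheme \<Rightarrow> ('g, 'f::field) gmod \<Rightarrow> ('g, 'f) gmod \<Rightarrow> bool" where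
  "is_projective_cover G P V \<longleftrightarrow> projective_gmod G P \<and> essential_epi G P V \<noteq> {}"

text \<open>\<open>F\<close> is a splitting field for \<open>G\<close> if \<open>End\<^bsub>F[G]\<^esub>(V) = F\<close> for every simple \<open>F[G]\<close>-module \<open>V\<close>.\<close>

definition splitting_field :: "('g, 'b) monoid_scheme \<Rightarrow> 'f::field itself \<Rightarrow> bool" where
  "splitting_field G _ \<longleftrightarrow> (\<forall>V :: ('g, 'f) gmod. simple_gmod G V \<longrightarrow>
     gmod_hom G V V = {c \<cdot>\<^sub>m 1\<^sub>m (gdim V) | c. True})"


section \<open>Splitting modular systems\<close>

text \<open>
  A normalised discrete valuation \<open>v\<close> on \<open>K\<close>; the value \<open>v 0\<close> (mathematically infinite) is
  irrelevant.
\<close>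

locale discrete_valuation =
  fixes v :: "'k::field \<Rightarrow> int"
  assumes val_mult: "x \<noteq> 0 \<Longrightarrow> y \<noteq> 0 \<Longrightarrow> v (x * y) = v x + v y"
    and val_add: "x \<noteq> 0 \<Longrightarrow> y \<noteq> 0 \<Longrightarrow> x + y \<noteq> 0 \<Longrightarrow> v (x + y) \<ge> min (v x) (v y)"
    and val_uniformizer: "\<exists>x. x \<noteq> 0 \<and> v x = 1"

definition val_ge :: "('k::field \<Rightarrow> int) \<Rightarrow> int \<Rightarrow> 'k set" where
  "val_ge v N = {x. x = 0 \<or> v x \<ge> N}"

abbreviation val_ring :: "('k::field \<Rightarrow> int) \<Rightarrow> 'k set" where
  "val_ring v \<equiv> val_ge v 0"

definition val_complete :: "('k::field \<Rightarrow> int) \<Rightarrow> bool" where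
  "val_complete v \<longleftrightarrow> (\<forall>s :: nat \<Rightarrow> 'k.
     (\<forall>N. \<exists>m. \<forall>i\<ge>m. \<forall>j\<ge>m. s i - s j \<in> val_ge v N) \<longrightarrow>
     (\<exists>y. \<forall>N. \<exists>m. \<forall>i\<ge>m. s i - y \<in> val_ge v N))"

text \<open>
  A \<open>p\<close>-modular system \<open>(K, O, F)\<close>: \<open>O\<close> is the valuation ring of the complete discretely valued
  field \<open>K\<close> of characteristic \<open>0\<close>, and its residue field \<open>F\<close> has characteristic \<open>p\<close>. The residue
  field is given by the reduction map \<open>red\<close> of \<open>O\<close> onto \<open>F\<close>, whose kernel is the maximal ideal of
  \<open>O\<close>; \<open>red\<close> is unspecified outside \<open>O\<close>.
\<close>

locale p_modular_system = discrete_valuation v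
  for v :: "'k::field_char_0 \<Rightarrow> int" +
  fixes p :: nat and red :: "'k \<Rightarrow> 'f::field"
  assumes prime_p: "prime p"
    and complete: "val_complete v"
    and red_one: "red 1 = 1"
    and red_add: "x \<in> val_ring v \<Longrightarrow> y \<in> val_ring v \<Longrightarrow> red (x + y) = red x + red y"
    and red_mult: "x \<in> val_ring v \<Longrightarrow> y \<in> val_ring v \<Longrightarrow> red (x * y) = red x * red y"
    and red_surj: "red ` val_ring v = UNIV"
    and red_kernel: "x \<in> val_ring v \<Longrightarrow> red x = 0 \<longleftrightarrow> x \<in> val_ge v 1"
    and char_residue_field: "CHAR('f) = p"

locale splitting_p_modular_system = p_modular_system v p red
  for G :: "('g, 'b) monoid_scheme"
    and v :: "'k::field_char_0 \<Rightarrow> int" and p :: nat and red :: "'k \<Rightarrow> 'f::field" +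
  assumes splitting_K: "splitting_field G TYPE('k)"
    and splitting_F: "splitting_field G TYPE('f)"


section \<open>Brauer characters\<close>

text \<open>
  A splitting field for \<open>G\<close> need not contain the eigenvalues of the elements of \<open>G\<close> (for instance
  \<open>\<rat>\<close> and the field with two elements for the symmetric group of degree 3). Eigenvalues are
  therefore taken in the algebraic closure of \<open>F\<close> and lifted to the algebraic closure of \<open>K\<close> along an
  extension \<open>rbar\<close> of \<open>red\<close> to the integral closure of \<open>O\<close>. Such an extension always exists, and
  the values of Brauer characters do not depend on the choice of it. When \<open>K\<close> contains the relevant
  roots of unity, only the values of \<open>rbar\<close> on \<open>O\<close>, i.e. \<open>red\<close>, matter.
\<close>

definition integral_closure :: "('k::field \<Rightarrow> int) \<Rightarrow> 'k alg_closure set" where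
  "integral_closure v = {b. \<exists>q :: 'k poly. lead_coeff q = 1 \<and> (\<forall>i. coeff q i \<in> val_ring v) \<and>
     poly (map_poly to_ac q) b = 0}"

definition extends_reduction ::
  "('k::field \<Rightarrow> int) \<Rightarrow> ('k \<Rightarrow> 'f::field) \<Rightarrow> ('k alg_closure \<Rightarrow> 'f alg_closure) \<Rightarrow> bool" where
  "extends_reduction v red rbar \<longleftrightarrow>
     (\<forall>x\<in>val_ring v. rbar (to_ac x) = to_ac (red x)) \<and>
     (\<forall>a\<in>integral_closure v. \<forall>b\<in>integral_closure v.
        rbar (a + b) = rbar a + rbar b \<and> rbar (a * b) = rbar a * rbar b)"

definition root_lift ::
  "nat \<Rightarrow> ('k::field alg_closure \<Rightarrow> 'f::field alg_closure) \<Rightarrow> 'f alg_closure \<Rightarrow> 'k alg_closure" where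
  "root_lift p rbar a = (THE b. (\<exists>k>0. coprime k p \<and> b ^ k = 1) \<and> rbar b = a)"

text \<open>
  The sum runs over the eigenvalues with their multiplicities. Being a function on the
  \<open>p\<close>-regular elements only, a Brauer character is made extensional, so that distinct elements of
  \<open>IBr\<close> differ at a \<open>p\<close>-regular element.
\<close>

definition brauer_char ::
  "('g, 'b) monoid_scheme \<Rightarrow> nat \<Rightarrow> ('k::field alg_closure \<Rightarrow> 'f::field alg_closure) \<Rightarrow>
   ('g, 'f) gmod \<Rightarrow> 'g \<Rightarrow> 'k alg_closure" where
  "brauer_char G p rbar M = (\<lambda>g\<in>p_regular G p (carrier G).
     \<Sum>a\<in>#proots (char_poly (map_mat to_ac (gact M g))). root_lift p rbar a)"

definition IBr ::
  "('g, 'b) monoid_scheme \<Rightarrow> nat \<Rightarrow> ('k::field alg_closure \<Rightarrow> 'f::field alg_closure) \<Rightarrow>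
   ('g \<Rightarrow> 'k alg_closure) set" where
  "IBr G p rbar = {brauer_char G p rbar V | V. simple_gmod G V}"

definition V_of ::
  "('g, 'b) monoid_scheme \<Rightarrow> nat \<Rightarrow> ('k::field alg_closure \<Rightarrow> 'f::field alg_closure) \<Rightarrow>
   ('g \<Rightarrow> 'k alg_closure) \<Rightarrow> ('g, 'f) gmod" where
  "V_of G p rbar \<phi> = (SOME V. simple_gmod G V \<and> brauer_char G p rbar V = \<phi>)"

definition P_of ::
  "('g, 'b) monoid_scheme \<Rightarrow> nat \<Rightarrow> ('k::field alg_closure \<Rightarrow> 'f::field alg_closure) \<Rightarrow>
   ('g \<Rightarrow> 'k alg_closure) \<Rightarrow> ('g, 'f) gmod" where
  "P_of G p rbar \<phi> = (SOME P. is_projective_cover G P (V_of G p rbar \<phi>))"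

definition Phi_of ::
  "('g, 'b) monoid_scheme \<Rightarrow> nat \<Rightarrow> ('k::field alg_closure \<Rightarrow> 'f::field alg_closure) \<Rightarrow>
   ('g \<Rightarrow> 'k alg_closure) \<Rightarrow> 'g \<Rightarrow> 'k alg_closure" where
  "Phi_of G p rbar \<phi> = brauer_char G p rbar (P_of G p rbar \<phi>)"

end

theory Submission
  imports Defs "HOL-Algebra.Zassenhaus"
begin

text \<open>
  Write \<open>o\<close> for the order of \<open>xH\<close>. Let \<open>\<chi>\<close> be a homomorphism of \<open>G\<close> into the multiplicative group of
  \<open>F\<close>. Tensoring with \<open>\<chi>\<close> permutes the simple \<open>F[G]\<close>-modules and hence \<open>IBr(G)\<close>, and it multiplies
  the value of a Brauer character at \<open>x\<close> by the lift of \<open>\<chi>(x)\<close>. It also sends the projective cover of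
  \<open>V\<close> to the projective cover of \<open>\<chi> \<otimes> V\<close>. So if \<open>\<chi>\<^sup>k \<otimes> \<phi> = \<phi>\<close>, then both \<open>\<phi>(x)\<close> and
  \<open>\<Phi>\<^sub>\<phi>(x)\<close> are unchanged by multiplication with the lift of \<open>\<chi>(x)\<^sup>k\<close>, and if one of them is not zero,
  then \<open>\<chi>(x)\<^sup>k = 1\<close>.

  Suppose now that for no \<open>\<phi>\<close> both values vanish. Let \<open>q\<^sup>a\<close> be a prime power that exactly divides
  \<open>o\<close>. There is a \<open>\<chi>\<close>, trivial on \<open>H\<close>, such that \<open>q\<^sup>a\<close> divides the order of \<open>\<chi>(x)\<close>. By the above,
  every orbit of \<open>\<phi> \<mapsto> \<chi> \<otimes> \<phi>\<close> on \<open>IBr(G)\<close> has a length divisible by \<open>q\<^sup>a\<close>, so \<open>q\<^sup>a\<close> divides \<open>l\<close>.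
  Hence \<open>o\<close> divides \<open>l\<close>
  (lemmas \<open>dvd_card_IBr_of_nonvanishing\<close> and \<open>order_in_quotient_dvd_card_IBr\<close>). This is the
  contrapositive of the first claim. As \<open>o > 1\<close>, an \<open>o\<close> prime to \<open>l\<close> does not divide \<open>l\<close>, which gives
  the second claim.

  The argument rests on four facts.

  \<^item> The eigenvalues of \<open>p\<close>-regular elements are roots of unity of order prime to \<open>p\<close>, and these lift
    uniquely and multiplicatively (\<open>root_lift\<close>, \<open>root_lift_mult\<close>). A root of unity \<open>b \<noteq> 1\<close> of order
    dividing \<open>k\<close> satisfies \<open>1 + b + \<dots> + b\<^sup>k\<^sup>-\<^sup>1 = 0\<close>, so it cannot reduce to \<open>1\<close> when \<open>k\<close> is prime
    to \<open>p\<close>; existence of lifts follows by counting.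

  \<^item> The Brauer character of a simple module determines the module
    (\<open>simple_gmod_iso_of_equal_bchar\<close>): it determines all traces, and by a density argument some
    element of the group algebra acts with trace \<open>1\<close> on \<open>V\<close> and as \<open>0\<close> on any simple \<open>W\<close> that is not
    isomorphic to \<open>V\<close>. So \<open>\<chi>\<^sup>k \<otimes> \<phi> = \<phi>\<close> does imply \<open>\<chi>\<^sup>k \<otimes> V\<^sub>\<phi> \<cong> V\<^sub>\<phi>\<close>.

  \<^item> Projective covers exist and are unique (\<open>projective_cover_exists\<close>, \<open>projective_cover_unique\<close>).

  \<^item> If \<open>y\<close> is not in \<open>H\<close> and has order prime to \<open>p\<close> modulo \<open>H\<close>, then some \<open>\<chi>\<close> has \<open>\<chi>(y) \<noteq> 1\<close>
    (\<open>exists_linear_char_separating\<close>). It is found in a simple submodule of \<open>(1 - y) F[G/H]\<close>, which is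
    one-dimensional because \<open>G/H\<close> is abelian and \<open>F\<close> is a splitting field.
\<close>

section \<open>Injective and surjective matrices\<close>

lemma mult_mat_unit_vec:
  fixes A :: "'a::semiring_1 mat"
  assumes "A \<in> carrier_mat n k" "j < k"
  shows "A *\<^sub>v unit_vec k j = col A j"
  using assms by (intro eq_vecI) (auto simp: scalar_prod_right_unit)

lemma mat_eqI_mult_vec:
  fixes A B :: "'a::semiring_1 mat"
  assumes "A \<in> carrier_mat n k" "B \<in> carrier_mat n k"
    and "\<And>v. v \<in> carrier_vec k \<Longrightarrow> A *\<^sub>v v = B *\<^sub>v v"
  shows "A = B"
proof (rule mat_col_eqI)
  fix j assume "j < dim_col B"
  then show "col A j = col B j"
    using assms mult_mat_unit_vec[of A n k j] mult_mat_unit_vec[of B n k j] by auto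
qed (use assms in auto)

lemma mult_mat_vec_zero [simp]:
  fixes A :: "'a::semiring_1 mat"
  assumes "A \<in> carrier_mat n k"
  shows "A *\<^sub>v 0\<^sub>v k = 0\<^sub>v n"
  using assms by (intro eq_vecI) auto

lemma mult_mat_vec_diff:
  fixes A :: "'a::comm_ring_1 mat"
  assumes "A \<in> carrier_mat n k" "v \<in> carrier_vec k" "w \<in> carrier_vec k"
  shows "A *\<^sub>v (v - w) = A *\<^sub>v v - A *\<^sub>v w"
  using assms by (intro eq_vecI) (auto simp: scalar_prod_minus_distrib[of _ k])

lemma smult_mult_mat_vec:
  fixes A :: "'a::comm_ring_1 mat"
  assumes "A \<in> carrier_mat n k" "v \<in> carrier_vec k"
  shows "(c \<cdot>\<^sub>m A) *\<^sub>v v = c \<cdot>\<^sub>v (A *\<^sub>v v)"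
  using assms by (intro eq_vecI) auto

lemma mult_mat_vec_index:
  assumes "A \<in> carrier_mat n k" "v \<in> carrier_vec k" "i < n"
  shows "vec_index (A *\<^sub>v v) i = (\<Sum>j<k. A $$ (i, j) * vec_index v j)"
  using assms by (simp add: scalar_prod_def atLeast0LessThan)

lemma zero_mat_mult_vec:
  fixes v :: "'a::semiring_1 vec"
  assumes "v \<in> carrier_vec k"
  shows "0\<^sub>m n k *\<^sub>v v = 0\<^sub>v n"
  using assms by (intro eq_vecI) (auto simp: scalar_prod_def)

lemma smult_smult_mat: "a \<cdot>\<^sub>m (b \<cdot>\<^sub>m A) = (a * b :: 'a::comm_ring_1) \<cdot>\<^sub>m A"
  by (intro eq_matI) (auto simp: mult.assoc)

lemma one_smult_mat: "(1 :: 'a::comm_ring_1) \<cdot>\<^sub>m A = A"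
  by (intro eq_matI) auto

lemma mat_image_mult:
  assumes "A \<in> carrier_mat n k" "B \<in> carrier_mat k m" "W \<subseteq> carrier_vec m"
  shows "mat_image (A * B) W = mat_image A (mat_image B W)"
  unfolding image_image
  by (rule image_cong[OF refl]) (use assms assoc_mult_mat_vec[OF assms(1,2)] in blast)

definition injective_mat :: "'a::field mat \<Rightarrow> bool" where
  "injective_mat J \<longleftrightarrow>
     (\<forall>v\<in>carrier_vec (dim_col J). J *\<^sub>v v = 0\<^sub>v (dim_row J) \<longrightarrow> v = 0\<^sub>v (dim_col J))"

lemma injective_matD:
  assumes "injective_mat J" "J \<in> carrier_mat n k" "v \<in> carrier_vec k" "w \<in> carrier_vec k"
    and "J *\<^sub>v v = J *\<^sub>v w"
  shows "v = w"
proof -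
  have "J *\<^sub>v (v - w) = 0\<^sub>v n"
    using assms by (simp add: mult_mat_vec_diff[of _ n k])
  then have "v - w = 0\<^sub>v k"
    using assms unfolding injective_mat_def by auto
  moreover have "v = (v - w) + w"
    using assms by auto
  ultimately show ?thesis
    using assms by auto
qed

lemma injective_mat_mult:
  assumes "injective_mat A" "injective_mat B" "A \<in> carrier_mat n k" "B \<in> carrier_mat k m"
  shows "injective_mat (A * B)"
  unfolding injective_mat_def
proof (intro ballI impI)
  fix v assume v: "v \<in> carrier_vec (dim_col (A * B))"
    and z: "A * B *\<^sub>v v = 0\<^sub>v (dim_row (A * B))"
  then have "A *\<^sub>v (B *\<^sub>v v) = A *\<^sub>v 0\<^sub>v k"
    using assms by (auto simp: assoc_mult_mat_vec[of A n k B m])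
  then have "B *\<^sub>v v = B *\<^sub>v 0\<^sub>v m"
    using injective_matD[OF assms(1,3)] v assms by auto
  then show "v = 0\<^sub>v (dim_col (A * B))"
    using injective_matD[OF assms(2,4)] v assms by auto
qed

lemma injective_mat_cancel_left:
  assumes "injective_mat J" "J \<in> carrier_mat n k" "A \<in> carrier_mat k m" "B \<in> carrier_mat k m"
    and "J * A = J * B"
  shows "A = B"
proof (rule mat_eqI_mult_vec[OF assms(3,4)])
  fix v :: "'a vec" assume v: "v \<in> carrier_vec m"
  then have "J *\<^sub>v (A *\<^sub>v v) = J *\<^sub>v (B *\<^sub>v v)"
    using assms assoc_mult_mat_vec[of J n k] by metis
  then show "A *\<^sub>v v = B *\<^sub>v v"
    using injective_matD[OF assms(1,2)] v assms by auto
qed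

lemma injective_mat_dim_le:
  assumes inj: "injective_mat J" and J: "J \<in> carrier_mat n k"
  shows "k \<le> n"
proof (rule ccontr)
  assume "\<not> k \<le> n"
  then have nk: "n < k" by simp
  \<comment> \<open>Padding with zero rows gives a singular square matrix with the same kernel.\<close>
  define A where "A = mat k k (\<lambda>(i, j). if i < n then J $$ (i, j) else 0)"
  have A: "A \<in> carrier_mat k k"
    unfolding A_def by simp
  have At: "transpose_mat A \<in> carrier_mat k k"
    using A by simp
  have "transpose_mat A *\<^sub>v unit_vec k n = 0\<^sub>v k"
    unfolding mult_mat_unit_vec[OF At nk]
    using nk by (auto simp: A_def intro!: eq_vecI)
  moreover have "unit_vec k n \<noteq> 0\<^sub>v k"
    using nk by simp
  ultimately have "det (transpose_mat A) = 0"
    unfolding det_0_iff_vec_prod_zero[OF At]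
    by (intro exI[of _ "unit_vec k n"]) auto
  then have "det A = 0"
    using det_transpose[OF A] by simp
  then obtain v where v: "v \<in> carrier_vec k" "v \<noteq> 0\<^sub>v k" "A *\<^sub>v v = 0\<^sub>v k"
    unfolding det_0_iff_vec_prod_zero[OF A] by auto
  have "J *\<^sub>v v = 0\<^sub>v n"
  proof (rule eq_vecI)
    fix i assume i: "i < dim_vec (0\<^sub>v n :: 'a vec)"
    have "row J i = row A i"
      using i nk J by (auto simp: A_def intro!: eq_vecI)
    then have "(J *\<^sub>v v) $ i = (A *\<^sub>v v) $ i"
      using i nk J A by simp
    then show "(J *\<^sub>v v) $ i = 0\<^sub>v n $ i"
      using v i nk by simp
  qed (use J in auto)
  then show False
    using inj v J unfolding injective_mat_def by auto
qed

lemma injective_square_mat_inverse: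
  assumes inj: "injective_mat J" and J: "J \<in> carrier_mat n n"
  obtains K where "K \<in> carrier_mat n n" "J * K = 1\<^sub>m n" "K * J = 1\<^sub>m n"
proof -
  have "det J \<noteq> 0"
    using inj J det_0_iff_vec_prod_zero[OF J] unfolding injective_mat_def by auto
  from det_non_zero_imp_unit[OF J this, of "()"] show ?thesis
    using that unfolding Units_def by (auto simp: ring_mat_simps)
qed

lemma left_inverse_injective_mat:
  assumes "J \<in> carrier_mat n k" "K \<in> carrier_mat k n" "K * J = 1\<^sub>m k"
  shows "injective_mat J"
  unfolding injective_mat_def
proof (intro ballI impI)
  fix v assume v: "v \<in> carrier_vec (dim_col J)" and z: "J *\<^sub>v v = 0\<^sub>v (dim_row J)"
  have "v = (K * J) *\<^sub>v v"
    using v assms by simp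
  also have "\<dots> = K *\<^sub>v (J *\<^sub>v v)"
    using v assms by (intro assoc_mult_mat_vec) auto
  also have "\<dots> = 0\<^sub>v k"
    using z assms by simp
  finally show "v = 0\<^sub>v (dim_col J)"
    using assms by simp
qed

lemma surjective_mat_right_inverse:
  fixes T :: "'a::field mat"
  assumes T: "T \<in> carrier_mat m n" and surj: "mat_image T (carrier_vec n) = carrier_vec m"
  obtains S where "S \<in> carrier_mat n m" "T * S = 1\<^sub>m m"
proof -
  have "\<forall>j<m. \<exists>v\<in>carrier_vec n. T *\<^sub>v v = unit_vec m j"
    using surj by (metis imageE unit_vec_carrier)
  then obtain f where f: "\<And>j. j < m \<Longrightarrow> f j \<in> carrier_vec n"
    "\<And>j. j < m \<Longrightarrow> T *\<^sub>v f j = unit_vec m j"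
    by metis
  define S where "S = mat n m (\<lambda>(i, j). f j $ i)"
  have S: "S \<in> carrier_mat n m"
    unfolding S_def by simp
  have "T * S = 1\<^sub>m m"
  proof (rule mat_col_eqI)
    fix j assume "j < dim_col (1\<^sub>m m :: 'a mat)"
    then have j: "j < m" by simp
    have "col S j = f j"
      using j f(1)[OF j] by (auto simp: S_def intro!: eq_vecI)
    then show "col (T * S) j = col (1\<^sub>m m) j"
      using f(2)[OF j] j by (simp only: col_mult2[OF T S j] col_one)
  qed (use S T in auto)
  with S show ?thesis using that by blast
qed

lemma surjective_mat_dim_le:
  fixes T :: "'a::field mat"
  assumes "T \<in> carrier_mat m n" "mat_image T (carrier_vec n) = carrier_vec m"
  shows "m \<le> n"
  using surjective_mat_right_inverse[OF assms] left_inverse_injective_mat injective_mat_dim_le assms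
  by metis

lemma right_inverse_surjective_mat:
  fixes T :: "'a::field mat"
  assumes T: "T \<in> carrier_mat m n" and S: "S \<in> carrier_mat n m" and TS: "T * S = 1\<^sub>m m"
  shows "mat_image T (carrier_vec n) = carrier_vec m"
proof -
  have "w \<in> mat_image T (carrier_vec n)" if "w \<in> carrier_vec m" for w
  proof (rule image_eqI)
    show "w = T *\<^sub>v (S *\<^sub>v w)"
      using that assoc_mult_mat_vec[OF T S that] TS by simp
  qed (use S that in auto)
  then show ?thesis using T by auto
qed

lemma injective_square_mat_surjective:
  assumes "injective_mat J" "J \<in> carrier_mat n n"
  shows "mat_image J (carrier_vec n) = carrier_vec n"
  using injective_square_mat_inverse[OF assms] right_inverse_surjective_mat assms by metis

lemma surjective_square_mat_inverse:
  fixes A :: "'a::field mat"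
  assumes A: "A \<in> carrier_mat n n" and surj: "mat_image A (carrier_vec n) = carrier_vec n"
  obtains B where "B \<in> carrier_mat n n" "A * B = 1\<^sub>m n" "B * A = 1\<^sub>m n"
proof -
  obtain B where B: "B \<in> carrier_mat n n" "A * B = 1\<^sub>m n"
    by (rule surjective_mat_right_inverse[OF A surj])
  with mat_mult_left_right_inverse[OF A B] that show ?thesis by blast
qed

definition append_col :: "'a mat \<Rightarrow> 'a vec \<Rightarrow> 'a mat" where
  "append_col J w =
     mat (dim_row J) (Suc (dim_col J)) (\<lambda>(i, j). if j < dim_col J then J $$ (i, j) else w $ i)"

lemma append_col_mult_vec:
  fixes J :: "'a::comm_ring_1 mat"
  assumes J: "J \<in> carrier_mat n k" and w: "w \<in> carrier_vec n" and a: "a \<in> carrier_vec (Suc k)"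
  shows "append_col J w *\<^sub>v a = J *\<^sub>v vec k (\<lambda>i. a $ i) + (a $ k) \<cdot>\<^sub>v w"
proof (rule eq_vecI)
  fix i assume "i < dim_vec (J *\<^sub>v vec k (\<lambda>i. a $ i) + (a $ k) \<cdot>\<^sub>v w)"
  then have i: "i < n" using w by simp
  have "(append_col J w *\<^sub>v a) $ i = (\<Sum>j<Suc k. append_col J w $$ (i, j) * a $ j)"
    using i J a by (simp add: append_col_def scalar_prod_def atLeast0LessThan)
  also have "\<dots> = (\<Sum>j<k. J $$ (i, j) * a $ j) + w $ i * a $ k"
    using i J by (simp add: append_col_def)
  finally show "(append_col J w *\<^sub>v a) $ i = (J *\<^sub>v vec k (\<lambda>i. a $ i) + (a $ k) \<cdot>\<^sub>v w) $ i"
    using i J w by (simp add: scalar_prod_def atLeast0LessThan mult.commute)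
qed (use J w in \<open>auto simp: append_col_def\<close>)

lemma injective_append_col:
  fixes J :: "'a::field mat"
  assumes inj: "injective_mat J" and J: "J \<in> carrier_mat n k" and w: "w \<in> carrier_vec n"
    and notin: "w \<notin> mat_image J (carrier_vec k)"
  shows "injective_mat (append_col J w)"
  unfolding injective_mat_def
proof (intro ballI impI)
  have dims: "dim_col (append_col J w) = Suc k" "dim_row (append_col J w) = n"
    using J by (auto simp: append_col_def)
  fix a assume "a \<in> carrier_vec (dim_col (append_col J w))"
    and z: "append_col J w *\<^sub>v a = 0\<^sub>v (dim_row (append_col J w))"
  then have a: "a \<in> carrier_vec (Suc k)" using dims by simp
  let ?b = "vec k (\<lambda>i. a $ i)"
  have sum0: "J *\<^sub>v ?b + (a $ k) \<cdot>\<^sub>v w = 0\<^sub>v n"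
    using z append_col_mult_vec[OF J w a] dims by simp
  have ak: "a $ k = 0"
  proof (rule ccontr)
    assume ne: "a $ k \<noteq> 0"
    have "w = J *\<^sub>v ((- inverse (a $ k)) \<cdot>\<^sub>v ?b)"
    proof (rule eq_vecI)
      fix i assume "i < dim_vec (J *\<^sub>v ((- inverse (a $ k)) \<cdot>\<^sub>v ?b))"
      then have i: "i < n" using J by simp
      have "(J *\<^sub>v ?b + (a $ k) \<cdot>\<^sub>v w) $ i = 0" using sum0 i by simp
      then have "(J *\<^sub>v ?b) $ i = - (a $ k * w $ i)"
        using i w J by (simp add: eq_neg_iff_add_eq_0)
      moreover have "J *\<^sub>v ((- inverse (a $ k)) \<cdot>\<^sub>v ?b) = (- inverse (a $ k)) \<cdot>\<^sub>v (J *\<^sub>v ?b)"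
        by (rule mult_mat_vec[OF J]) simp
      ultimately show "w $ i = (J *\<^sub>v ((- inverse (a $ k)) \<cdot>\<^sub>v ?b)) $ i"
        using i J ne by (simp add: field_simps)
    qed (use J w in auto)
    then show False using notin by auto
  qed
  then have "(a $ k) \<cdot>\<^sub>v w = 0\<^sub>v n"
    using w by (intro eq_vecI) auto
  then have "J *\<^sub>v ?b = 0\<^sub>v n"
    using sum0 J by simp
  then have b0: "?b = 0\<^sub>v k"
    using inj J unfolding injective_mat_def by auto
  show "a = 0\<^sub>v (dim_col (append_col J w))"
  proof (rule eq_vecI)
    fix i assume "i < dim_vec (0\<^sub>v (dim_col (append_col J w)) :: 'a vec)"
    then have i: "i < Suc k" using dims by simp
    then show "a $ i = 0\<^sub>v (dim_col (append_col J w)) $ i"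
      using dims ak arg_cong[OF b0, of "\<lambda>b. vec_index b i"] by (cases "i = k") auto
  qed (use a dims in auto)
qed

text \<open>The columns of \<open>J\<close> are a basis of \<open>W\<close>. Vectors of \<open>W\<close> outside the image are appended as columns
  for as long as there are any; an injective matrix cannot have more columns than rows.\<close>

lemma subspace_eq_injective_mat_image:
  fixes W :: "'a::field vec set"
  assumes sub: "W \<subseteq> carrier_vec n" and zero: "0\<^sub>v n \<in> W"
    and add: "\<And>u w. u \<in> W \<Longrightarrow> w \<in> W \<Longrightarrow> u + w \<in> W"
    and smult: "\<And>c w. w \<in> W \<Longrightarrow> c \<cdot>\<^sub>v w \<in> W"
  obtains k J where "J \<in> carrier_mat n k" "injective_mat J" "mat_image J (carrier_vec k) = W"
proof -
  define P where "P k \<longleftrightarrow> (\<exists>J\<in>carrier_mat n k. injective_mat J \<and> mat_image J (carrier_vec k) \<subseteq> W)"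
    for k
  have P0: "P 0"
    unfolding P_def
  proof (intro bexI conjI)
    show "0\<^sub>m n 0 \<in> carrier_mat n 0" by simp
    show "injective_mat (0\<^sub>m n 0)" unfolding injective_mat_def by auto
    have "0\<^sub>m n 0 *\<^sub>v w = 0\<^sub>v n" if "w \<in> carrier_vec 0" for w :: "'a vec"
      using that by (intro eq_vecI) (auto simp: scalar_prod_def)
    then show "mat_image (0\<^sub>m n 0) (carrier_vec 0) \<subseteq> W" using zero by auto
  qed
  have bound: "P k \<Longrightarrow> k \<le> n" for k
    unfolding P_def using injective_mat_dim_le by blast
  define k where "k = (GREATEST k. P k)"
  have Pk: "P k"
    unfolding k_def by (rule GreatestI_nat[where P = P, OF P0 bound])
  have max: "\<not> P (Suc k)"
    using Greatest_le_nat[where P = P, OF _ bound, of "Suc k"] unfolding k_def by auto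
  from Pk obtain J where J: "J \<in> carrier_mat n k" "injective_mat J"
    and im: "mat_image J (carrier_vec k) \<subseteq> W"
    unfolding P_def by auto
  have "w \<in> mat_image J (carrier_vec k)" if w: "w \<in> W" for w
  proof (rule ccontr)
    assume notin: "w \<notin> mat_image J (carrier_vec k)"
    have wc: "w \<in> carrier_vec n" using w sub by auto
    have "append_col J w \<in> carrier_mat n (Suc k)"
      using J by (auto simp: append_col_def)
    moreover have "injective_mat (append_col J w)"
      by (rule injective_append_col[OF J(2,1) wc notin])
    moreover have "J *\<^sub>v vec k (\<lambda>i. vec_index a i) \<in> W" for a
      using im by (auto simp: image_subset_iff)
    then have "mat_image (append_col J w) (carrier_vec (Suc k)) \<subseteq> W"
      using append_col_mult_vec[OF J(1) wc] add smult w by auto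
    ultimately have "P (Suc k)" unfolding P_def by blast
    then show False using max by simp
  qed
  with im J that show ?thesis by blast
qed

section \<open>Eigenvalues over algebraically closed fields\<close>

text \<open>The same choice of columns, one after the other, started from the column \<open>v\<close>.\<close>

lemma nonzero_vec_extends_to_invertible_mat:
  fixes v :: "'a::field vec"
  assumes v: "v \<in> carrier_vec n" "v \<noteq> 0\<^sub>v n"
  obtains P Q where "P \<in> carrier_mat n n" "Q \<in> carrier_mat n n"
    "P * Q = 1\<^sub>m n" "Q * P = 1\<^sub>m n" "col P 0 = v"
proof -
  define good where "good k \<longleftrightarrow> 0 < k \<and> (\<exists>J\<in>carrier_mat n k. injective_mat J \<and> col J 0 = v)" for k
  have good1: "good 1"
    unfolding good_def
  proof (intro conjI bexI)
    define J where "J = mat n 1 (\<lambda>(i, j). v $ i)"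
    show J: "J \<in> carrier_mat n 1" unfolding J_def by simp
    show "col J 0 = v" using v by (auto simp: J_def intro!: eq_vecI)
    show "injective_mat J"
      unfolding injective_mat_def
    proof (intro ballI impI)
      fix u assume u: "u \<in> carrier_vec (dim_col J)" and z: "J *\<^sub>v u = 0\<^sub>v (dim_row J)"
      obtain i where i: "i < n" "v $ i \<noteq> 0"
        using v by (metis carrier_vecD eq_vecI index_zero_vec(1,2))
      have "(J *\<^sub>v u) $ i = v $ i * u $ 0"
        using i J u by (simp add: J_def scalar_prod_def)
      then have "u $ 0 = 0"
        using z i J by simp
      then show "u = 0\<^sub>v (dim_col J)"
        using u J by (intro eq_vecI) auto
    qed
  qed simp
  have bound: "good k \<Longrightarrow> k \<le> n" for k
    unfolding good_def using injective_mat_dim_le by blast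
  define k where "k = (GREATEST k. good k)"
  have gk: "good k"
    unfolding k_def by (rule GreatestI_nat[where P = good, OF good1 bound])
  have max: "\<not> good (Suc k)"
    using Greatest_le_nat[where P = good, OF _ bound, of "Suc k"] unfolding k_def by auto
  from gk obtain P where P: "P \<in> carrier_mat n k" "injective_mat P" "col P 0 = v" "0 < k"
    unfolding good_def by auto
  have "w \<in> mat_image P (carrier_vec k)" if w: "w \<in> carrier_vec n" for w
  proof (rule ccontr)
    assume notin: "w \<notin> mat_image P (carrier_vec k)"
    have "append_col P w \<in> carrier_mat n (Suc k)"
      using P by (auto simp: append_col_def)
    moreover have "col (append_col P w) 0 = v"
      using P by (auto simp: append_col_def intro!: eq_vecI)
    ultimately have "good (Suc k)"
      using injective_append_col[OF P(2,1) w notin] unfolding good_def by blast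
    then show False using max by simp
  qed
  then have "mat_image P (carrier_vec k) = carrier_vec n"
    using P by auto
  then have "n \<le> k"
    using surjective_mat_dim_le[OF P(1)] by simp
  with bound[OF gk] have "k = n" by simp
  with P that injective_square_mat_inverse[of P n] show ?thesis by metis
qed

text \<open>With an eigenvector as the first column of the base change, the first column of the
  transformed matrix is zero below the diagonal. The triangular form makes visible how the multiset of
  eigenvalues behaves under scalar multiples, powers and the trace.\<close>

lemma triangularizable:
  fixes A :: "'a::alg_closed_field mat"
  assumes "A \<in> carrier_mat n n"
  shows "\<exists>B\<in>carrier_mat n n. upper_triangular B \<and> similar_mat A B"
  using assms
proof (induction n arbitrary: A)
  case 0
  then show ?case
    by (intro bexI[of _ A]) (auto intro: similar_mat_refl)
next
  case (Suc n)
  note A = Suc.prems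
  have "degree (char_poly A) > 0"
    using degree_monic_char_poly[OF A] by simp
  then obtain a where "poly (char_poly A) a = 0"
    using alg_closed_imp_poly_has_root by blast
  then have "eigenvalue A a"
    using eigenvalue_root_char_poly[OF A] by simp
  then obtain v where v: "v \<in> carrier_vec (Suc n)" "v \<noteq> 0\<^sub>v (Suc n)" "A *\<^sub>v v = a \<cdot>\<^sub>v v"
    unfolding eigenvalue_def eigenvector_def using A by auto
  obtain P Q where P: "P \<in> carrier_mat (Suc n) (Suc n)" and Q: "Q \<in> carrier_mat (Suc n) (Suc n)"
    and PQ: "P * Q = 1\<^sub>m (Suc n)" "Q * P = 1\<^sub>m (Suc n)" and col0: "col P 0 = v"
    by (rule nonzero_vec_extends_to_invertible_mat[OF v(1,2)])
  define A' where "A' = Q * A * P"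
  have A': "A' \<in> carrier_mat (Suc n) (Suc n)"
    unfolding A'_def using P Q A by simp
  have sim: "similar_mat A A'"
  proof (rule similar_matI)
    have "P * A' * Q = P * (Q * A * P) * Q"
      unfolding A'_def ..
    also have "\<dots> = (P * Q) * A * (P * Q)"
      using P Q A by (simp add: assoc_mult_mat[of _ "Suc n" "Suc n" _ "Suc n" _ "Suc n"])
    finally show "A = P * A' * Q"
      using PQ A by simp
  qed (use P Q PQ A A' in auto)
  have "col A' 0 = Q *\<^sub>v (A *\<^sub>v v)"
    unfolding A'_def col_mult2[OF mult_carrier_mat[OF Q A] P zero_less_Suc] col0
    by (rule assoc_mult_mat_vec[OF Q A v(1)])
  also have "\<dots> = a \<cdot>\<^sub>v (Q *\<^sub>v v)"
    using v Q by (simp add: mult_mat_vec)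
  also have "Q *\<^sub>v v = col (Q * P) 0"
    unfolding col_mult2[OF Q P zero_less_Suc] col0 ..
  finally have colA': "col A' 0 = a \<cdot>\<^sub>v unit_vec (Suc n) 0"
    unfolding PQ by simp
  obtain A1 A2 A3 A4 where split: "split_block A' 1 1 = (A1, A2, A3, A4)"
    by (cases "split_block A' 1 1") auto
  note sb = split_block[OF split, of n n]
  have A1: "A1 \<in> carrier_mat 1 1" and A2: "A2 \<in> carrier_mat 1 n"
    and A3: "A3 \<in> carrier_mat n 1" and A4: "A4 \<in> carrier_mat n n"
    and A'eq: "A' = four_block_mat A1 A2 A3 A4"
    using sb A' by auto
  have A30: "A3 = 0\<^sub>m n 1"
  proof (rule eq_matI)
    fix i j assume ij: "i < dim_row (0\<^sub>m n 1 :: 'a mat)" "j < dim_col (0\<^sub>m n 1 :: 'a mat)"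
    have "A3 $$ (i, 0) = A' $$ (Suc i, 0)"
      unfolding A'eq using ij A1 A2 A3 A4 by simp
    also have "\<dots> = col A' 0 $ Suc i"
      using A' ij by simp
    also have "\<dots> = 0"
      unfolding colA' using ij by simp
    finally show "A3 $$ (i, j) = 0\<^sub>m n 1 $$ (i, j)"
      using ij by simp
  qed (use A3 in auto)
  from Suc.IH[OF A4] obtain B4 where B4: "B4 \<in> carrier_mat n n" "upper_triangular B4" "similar_mat A4 B4"
    by auto
  from similar_mat_four_block_0_ex[OF similar_mat_refl[OF A1] B4(3) A2 A1 A4]
  obtain B2 where B2: "B2 \<in> carrier_mat 1 n"
    "similar_mat A' (four_block_mat A1 B2 (0\<^sub>m n 1) B4)"
    unfolding A'eq A30 by auto
  have "upper_triangular A1"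
    using A1 by auto
  then have "upper_triangular (four_block_mat A1 B2 (0\<^sub>m n 1) B4)"
    by (rule upper_triangular_four_block[OF A1 B4(1) _ B4(2)])
  moreover have "four_block_mat A1 B2 (0\<^sub>m n 1) B4 \<in> carrier_mat (Suc n) (Suc n)"
    using A1 B4 by (metis four_block_carrier_mat plus_1_eq_Suc)
  ultimately show ?case
    using similar_mat_trans[OF sim B2(2)] by blast
qed

lemma finite_roots_of_unity:
  assumes "k > 0"
  shows "finite {b :: 'a::field. b ^ k = 1}" "card {b :: 'a. b ^ k = 1} \<le> k"
proof -
  define f :: "'a poly" where "f = monom 1 k - 1"
  have f0: "f \<noteq> 0" "degree f \<le> k"
    unfolding f_def using assms by (auto simp: monom_eq_1_iff intro: degree_diff_le degree_monom_le)
  have "{b :: 'a. b ^ k = 1} = {b. poly f b = 0}"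
    by (simp add: f_def poly_monom)
  then show "finite {b :: 'a. b ^ k = 1}" "card {b :: 'a. b ^ k = 1} \<le> k"
    using poly_roots_finite[OF f0(1)] card_poly_roots_bound[OF f0(1)] f0(2) by auto
qed

lemma size_proots_alg_closed:
  fixes f :: "'a::alg_closed_field poly"
  assumes "f \<noteq> 0"
  shows "size (proots f) = degree f"
proof -
  obtain A where A: "size A = degree f" "f = smult (lead_coeff f) (\<Prod>x\<in>#A. [:- x, 1:])"
    using alg_closed_imp_factorization[OF assms] by blast
  have "proots (\<Prod>x\<in>#B. [:- x, 1:]) = B" for B :: "'a multiset"
  proof (induction B)
    case (add b B)
    then show ?case
      unfolding image_mset_add_mset prod_mset.add_mset
      by (subst proots_mult) (auto simp: prod_mset_zero_iff)
  qed simp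
  then have "proots f = A"
    by (subst A(2)) (use assms in simp)
  with A show ?thesis by simp
qed

lemma card_roots_of_unity:
  assumes "k > 0"
  shows "card {b :: 'a::{alg_closed_field, field_char_0}. b ^ k = 1} = k"
proof -
  define f :: "'a poly" where "f = monom 1 k - 1"
  have deg: "degree f = k"
    unfolding f_def diff_conv_add_uminus using assms
    by (subst degree_add_eq_left) (auto simp: degree_monom_eq)
  then have f0: "f \<noteq> 0" using assms by auto
  have U: "{b :: 'a. b ^ k = 1} = {b. poly f b = 0}"
    by (simp add: f_def poly_monom)
  have "rsquarefree f"
    unfolding rsquarefree_roots
    using assms by (auto simp: f_def poly_monom pderiv_diff pderiv_monom power_0_left)
  then have "order b f = 1" if "poly f b = 0" for b
    using that rsquarefree_root_order f0 by blast
  then have "size (proots f) = card {b. poly f b = 0}"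
    using f0 by (simp add: size_multiset_overloaded_eq)
  then show ?thesis
    using deg U size_proots_alg_closed[OF f0] by simp
qed

lemma proots_char_poly_upper_triangular:
  fixes A B :: "'a::field mat"
  assumes "similar_mat A B" "upper_triangular B" "B \<in> carrier_mat n n"
  shows "proots (char_poly A) = mset (diag_mat B)"
proof -
  have "proots (\<Prod>a\<leftarrow>as. [:- a, 1:]) = mset as" for as :: "'a list"
  proof (induction as)
    case (Cons a as)
    have "proots (\<Prod>a\<leftarrow>a # as. [:- a, 1:]) = proots [:- a, 1:] + proots (\<Prod>a\<leftarrow>as. [:- a, 1:])"
      unfolding list.map prod_list.Cons by (rule proots_mult) (auto simp: prod_list_zero_iff)
    then show ?case
      using Cons by simp
  qed auto
  then show ?thesis
    using char_poly_similar[OF assms(1)] char_poly_upper_triangular[OF assms(3,2)] by simp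
qed

lemma proots_char_poly_smult:
  fixes A :: "'a::alg_closed_field mat"
  assumes "A \<in> carrier_mat n n"
  shows "proots (char_poly (c \<cdot>\<^sub>m A)) = image_mset ((*) c) (proots (char_poly A))"
proof -
  obtain B where B: "B \<in> carrier_mat n n" "upper_triangular B" "similar_mat A B"
    using triangularizable[OF assms] by auto
  have "upper_triangular (c \<cdot>\<^sub>m B)"
    using B by (auto simp: upper_triangular_def)
  then have "proots (char_poly (c \<cdot>\<^sub>m A)) = mset (diag_mat (c \<cdot>\<^sub>m B))"
    using B(1) by (intro proots_char_poly_upper_triangular[OF similar_mat_smult[OF B(3)]]) auto
  also have "diag_mat (c \<cdot>\<^sub>m B) = map ((*) c) (diag_mat B)"
    using B(1) by (auto simp: diag_mat_def)
  finally show ?thesis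
    using proots_char_poly_upper_triangular[OF B(3,2,1)] by simp
qed

lemma upper_triangular_pow_mat:
  fixes B :: "'a::comm_ring_1 mat"
  assumes B: "B \<in> carrier_mat n n" "upper_triangular B"
  shows "upper_triangular (B ^\<^sub>m k) \<and> (\<forall>i<n. (B ^\<^sub>m k) $$ (i, i) = (B $$ (i, i)) ^ k)"
proof (induction k)
  case 0
  then show ?case using B by auto
next
  case (Suc k)
  let ?C = "B ^\<^sub>m k"
  have C: "?C \<in> carrier_mat n n" using B by simp
  have entry: "(?C * B) $$ (i, j) = (\<Sum>l\<in>{i..j}. ?C $$ (i, l) * B $$ (l, j))" if "i < n" "j < n" for i j
  proof -
    have "(?C * B) $$ (i, j) = (\<Sum>l<n. ?C $$ (i, l) * B $$ (l, j))"
      using that B C by (simp add: scalar_prod_def atLeast0LessThan)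
    also have "\<dots> = (\<Sum>l\<in>{i..j}. ?C $$ (i, l) * B $$ (l, j))"
      using that B C Suc.IH by (intro sum.mono_neutral_right) (auto simp: not_le upper_triangularD)
    finally show ?thesis .
  qed
  show ?case
    using entry Suc.IH B C by (auto simp: upper_triangular_def)
qed

lemma proots_char_poly_pow_mat:
  fixes A :: "'a::alg_closed_field mat"
  assumes "A \<in> carrier_mat n n"
  shows "proots (char_poly (A ^\<^sub>m k)) = image_mset (\<lambda>a. a ^ k) (proots (char_poly A))"
proof -
  obtain B where B: "B \<in> carrier_mat n n" "upper_triangular B" "similar_mat A B"
    using triangularizable[OF assms] by auto
  then have sim: "similar_mat (A ^\<^sub>m k) (B ^\<^sub>m k)"
    using similar_mat_wit_pow unfolding similar_mat_def by blast
  note ut = upper_triangular_pow_mat[OF B(1,2), of k]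
  have "proots (char_poly (A ^\<^sub>m k)) = mset (diag_mat (B ^\<^sub>m k))"
    using ut B(1) by (intro proots_char_poly_upper_triangular[OF sim]) auto
  also have "diag_mat (B ^\<^sub>m k) = map (\<lambda>a. a ^ k) (diag_mat B)"
    using B(1) ut by (auto simp: diag_mat_def)
  finally show ?thesis
    using proots_char_poly_upper_triangular[OF B(3,2,1)] by simp
qed

lemma proots_char_poly_one_mat:
  "proots (char_poly (1\<^sub>m n :: 'a::field mat)) = replicate_mset n 1"
proof -
  have "diag_mat (1\<^sub>m n :: 'a mat) = replicate n 1"
    by (auto simp: diag_mat_def list_eq_iff_nth_eq)
  then show ?thesis
    using proots_char_poly_upper_triangular[OF similar_mat_refl[of "1\<^sub>m n :: 'a mat" n], of n] by simp
qed

lemma eigenvalue_root_of_unity: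
  fixes A :: "'a::alg_closed_field mat"
  assumes "A \<in> carrier_mat n n" "A ^\<^sub>m k = 1\<^sub>m n" "a \<in># proots (char_poly A)"
  shows "a ^ k = 1"
proof -
  have "a ^ k \<in># proots (char_poly (A ^\<^sub>m k))"
    unfolding proots_char_poly_pow_mat[OF assms(1)] using assms(3) by auto
  then show ?thesis
    unfolding assms(2) proots_char_poly_one_mat by (auto split: if_splits)
qed

definition mtrace :: "'a::comm_ring_1 mat \<Rightarrow> 'a" where
  "mtrace A = (\<Sum>i<dim_row A. A $$ (i, i))"

lemma mtrace_mult_commute:
  assumes "A \<in> carrier_mat n n" "B \<in> carrier_mat n n"
  shows "mtrace (A * B) = mtrace (B * A)"
proof -
  have "mtrace (A * B) = (\<Sum>i<n. \<Sum>j<n. A $$ (i, j) * B $$ (j, i))"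
    using assms by (simp add: mtrace_def scalar_prod_def atLeast0LessThan)
  also have "\<dots> = (\<Sum>j<n. \<Sum>i<n. B $$ (j, i) * A $$ (i, j))"
    by (subst sum.swap) (simp add: mult.commute)
  also have "\<dots> = mtrace (B * A)"
    using assms by (simp add: mtrace_def scalar_prod_def atLeast0LessThan)
  finally show ?thesis .
qed

lemma sum_proots_char_poly:
  fixes A :: "'a::alg_closed_field mat"
  assumes "A \<in> carrier_mat n n"
  shows "\<Sum>\<^sub># (proots (char_poly A)) = mtrace A"
proof -
  obtain B where B: "B \<in> carrier_mat n n" "upper_triangular B" "similar_mat A B"
    using triangularizable[OF assms] by auto
  then obtain P Q where PQ: "similar_mat_wit A B P Q"
    unfolding similar_mat_def by auto
  note w = similar_mat_witD2[OF assms PQ]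
  have "mtrace A = mtrace (P * (B * Q))"
    using w by (simp add: assoc_mult_mat[of P n n B n Q n])
  also have "\<dots> = mtrace (B * Q * P)"
    using w by (intro mtrace_mult_commute) auto
  also have "B * Q * P = B"
    using w by (simp add: assoc_mult_mat[of B n n Q n P n])
  also have "mtrace B = sum_list (diag_mat B)"
    by (simp add: mtrace_def diag_mat_def sum_list_sum_nth atLeast0LessThan)
  finally show ?thesis
    using proots_char_poly_upper_triangular[OF B(3,2,1)] by (simp add: sum_mset_sum_list)
qed

section \<open>Lifting roots of unity\<close>

context p_modular_system
begin

lemma val_one [simp]: "v 1 = 0"
  using val_mult[of 1 1] by simp

lemma val_neg_one [simp]: "v (- 1) = 0"
  using val_mult[of "- 1" "- 1"] by simp

lemma val_ring_add: "x \<in> val_ring v \<Longrightarrow> y \<in> val_ring v \<Longrightarrow> x + y \<in> val_ring v"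
  using val_add[of x y] unfolding val_ge_def by fastforce

lemma val_ring_minus: "x \<in> val_ring v \<Longrightarrow> - x \<in> val_ring v"
  using val_mult[of "- 1" x] unfolding val_ge_def by fastforce

lemma of_nat_in_val_ring: "of_nat n \<in> val_ring v"
proof (induction n)
  case (Suc n)
  have "1 \<in> val_ring v" by (simp add: val_ge_def)
  from val_ring_add[OF this Suc.IH] show ?case by simp
qed (simp add: val_ge_def)

lemma of_int_in_val_ring: "of_int n \<in> val_ring v"
proof (cases n rule: int_cases2)
  case (nonneg m)
  then show ?thesis using of_nat_in_val_ring[of m] by simp
next
  case (nonpos m)
  then show ?thesis
    using val_ring_minus[OF of_nat_in_val_ring[of m]] by simp
qed

text \<open>An extension of the reduction map is known to be additive on integral elements only, and this
  lemma supplies enough of them. Multiplication by \<open>s = (\<Sum>c. n c * c)\<close> sends every \<open>k\<close>-th root of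
  unity to an integer combination of \<open>k\<close>-th roots of unity. So the vector of all \<open>k\<close>-th roots of unity
  is an eigenvector, with eigenvalue \<open>s\<close>, of an integer matrix, and \<open>s\<close> is a root of the
  characteristic polynomial of that matrix.\<close>

lemma sum_roots_of_unity_integral:
  assumes k: "k > 0"
  shows "(\<Sum>c | c ^ k = 1. of_int (n c) * c) \<in> integral_closure v"
proof -
  define U where "U = {c :: 'k alg_closure. c ^ k = 1}"
  define s where "s = (\<Sum>c\<in>U. of_int (n c) * c)"
  obtain bs where bs: "set bs = U" "distinct bs"
    using finite_distinct_list finite_roots_of_unity(1)[OF k] unfolding U_def by blast
  define m where "m = length bs"
  have bsU: "bs ! j \<in> U" if "j < m" for j
    using that bs nth_mem unfolding m_def by blast
  have U0: "c \<noteq> 0" if "c \<in> U" for c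
    using that k by (auto simp: U_def power_0_left)
  define A :: "int mat" where "A = mat m m (\<lambda>(j, l). n (bs ! l / bs ! j))"
  have A: "A \<in> carrier_mat m m" unfolding A_def by simp
  let ?A = "map_mat of_int A :: 'k alg_closure mat"
  have A': "?A \<in> carrier_mat m m" using A by simp
  define u where "u = vec m ((!) bs)"
  have "?A *\<^sub>v u = s \<cdot>\<^sub>v u"
  proof (rule eq_vecI)
    fix j assume "j < dim_vec (s \<cdot>\<^sub>v u)"
    then have j: "j < m" by (simp add: u_def)
    have "(?A *\<^sub>v u) $ j = (\<Sum>l<m. of_int (n (bs ! l / bs ! j)) * bs ! l)"
      using j by (simp add: A_def u_def scalar_prod_def atLeast0LessThan)
    also have "\<dots> = (\<Sum>b\<in>U. of_int (n (b / bs ! j)) * b)"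
      using bs by (subst sum.reindex_bij_betw[symmetric, of "(!) bs" "{..<m}"])
        (auto simp: m_def bij_betw_nth)
    also have "\<dots> = (\<Sum>c\<in>U. of_int (n c) * (c * bs ! j))"
      by (rule sum.reindex_bij_witness[of _ "\<lambda>c. c * bs ! j" "\<lambda>b. b / bs ! j"])
        (use bsU[OF j] U0 in \<open>auto simp: U_def power_mult_distrib power_divide\<close>)
    also have "\<dots> = s * bs ! j"
      by (simp add: s_def sum_distrib_right mult.assoc)
    finally show "vec_index (?A *\<^sub>v u) j = vec_index (s \<cdot>\<^sub>v u) j"
      using j by (simp add: u_def)
  qed (simp add: A_def u_def)
  moreover have "u \<noteq> 0\<^sub>v m"
  proof
    assume "u = 0\<^sub>v m"
    moreover have "1 \<in> U" by (simp add: U_def)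
    then obtain j where "j < m" "bs ! j = 1"
      using bs unfolding m_def by (metis in_set_conv_nth)
    ultimately show False
      by (metis index_vec index_zero_vec(1) u_def zero_neq_one)
  qed
  ultimately have "eigenvalue ?A s"
    unfolding eigenvalue_def eigenvector_def using A by (intro exI[of _ u]) (auto simp: u_def)
  then have root: "poly (char_poly ?A) s = 0"
    using eigenvalue_root_char_poly[OF A'] by simp
  define q :: "'k poly" where "q = map_poly of_int (char_poly A)"
  have "char_poly ?A = map_poly to_ac q"
    unfolding of_int_hom.char_poly_hom[OF A] q_def
    by (subst map_poly_map_poly) (auto simp: o_def)
  moreover have "lead_coeff q = 1"
    unfolding q_def using degree_monic_char_poly[OF A] by simp
  moreover have "coeff q i \<in> val_ring v" for i
    unfolding q_def using of_int_in_val_ring by (simp add: coeff_map_poly)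
  ultimately have "s \<in> integral_closure v"
    unfolding integral_closure_def using root by auto
  then show ?thesis
    by (simp add: s_def U_def)
qed

end

locale reduction_extension = p_modular_system v p red
  for v :: "'k::field_char_0 \<Rightarrow> int" and p :: nat and red :: "'k \<Rightarrow> 'f::field" +
  fixes rbar :: "'k alg_closure \<Rightarrow> 'f alg_closure"
  assumes extends: "extends_reduction v red rbar"
begin

lemma rbar_add: "a \<in> integral_closure v \<Longrightarrow> b \<in> integral_closure v \<Longrightarrow> rbar (a + b) = rbar a + rbar b"
  and rbar_mult: "a \<in> integral_closure v \<Longrightarrow> b \<in> integral_closure v \<Longrightarrow> rbar (a * b) = rbar a * rbar b"
  and rbar_to_ac: "x \<in> val_ring v \<Longrightarrow> rbar (to_ac x) = to_ac (red x)"
  using extends unfolding extends_reduction_def by auto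

lemma rbar_0 [simp]: "rbar 0 = 0" and rbar_1 [simp]: "rbar 1 = 1"
proof -
  have "red 0 = 0" by (subst red_kernel) (auto simp: val_ge_def)
  then show "rbar 0 = 0" using rbar_to_ac[of 0] by (simp add: val_ge_def)
  show "rbar 1 = 1" using rbar_to_ac[of 1] red_one by (simp add: val_ge_def)
qed

lemma CHAR_residue_closure: "of_nat n = (0 :: 'f alg_closure) \<longleftrightarrow> p dvd n"
  using of_nat_eq_0_iff_char_dvd[where 'a = "'f alg_closure"] char_residue_field by simp

lemma sum_mset_roots_of_unity:
  fixes M :: "'k alg_closure multiset"
  assumes k: "k > 0" and "\<And>b. b \<in># M \<Longrightarrow> b ^ k = 1"
  shows "\<Sum>\<^sub># M = (\<Sum>c | c ^ k = 1. of_int (int (count M c)) * c)"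
  using assms(2)
proof (induction M)
  case (add b M)
  have "(\<Sum>c | c ^ k = 1. of_int (int (count (add_mset b M) c)) * c)
      = (\<Sum>c | c ^ k = 1. (if c = b then b else 0) + of_int (int (count M c)) * c)"
    by (rule sum.cong) (auto simp: algebra_simps)
  also have "\<dots> = b + (\<Sum>c | c ^ k = 1. of_int (int (count M c)) * c)"
    using finite_roots_of_unity(1)[OF k, where 'a = "'k alg_closure"] add.prems
    by (simp add: sum.distrib)
  finally show ?case using add by simp
qed simp

lemma root_of_unity_integral:
  assumes "k > 0" "b ^ k = 1"
  shows "b \<in> integral_closure v"
  using sum_mset_roots_of_unity[OF assms(1), of "{#b#}"] assms(2)
    sum_roots_of_unity_integral[OF assms(1), of "\<lambda>c. int (count {#b#} c)"] by simp

lemma rbar_sum_mset: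
  assumes k: "k > 0" and "\<And>b. b \<in># M \<Longrightarrow> b ^ k = 1"
  shows "rbar (\<Sum>\<^sub># M) = (\<Sum>b\<in>#M. rbar b)"
  using assms(2)
proof (induction M)
  case (add b M)
  have "\<Sum>\<^sub># M \<in> integral_closure v"
    using sum_mset_roots_of_unity[OF k, of M] add.prems
      sum_roots_of_unity_integral[OF k, of "\<lambda>c. int (count M c)"] by simp
  moreover have "b \<in> integral_closure v"
    using root_of_unity_integral[OF k] add.prems by simp
  ultimately show ?case
    using add by (simp add: rbar_add)
qed simp

lemma rbar_power:
  assumes "k > 0" "b ^ k = 1"
  shows "rbar (b ^ i) = rbar b ^ i"
proof (induction i)
  case (Suc i)
  have "(b ^ i) ^ k = 1"
    using assms by (metis power_mult mult.commute power_one)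
  then show ?case
    using Suc assms root_of_unity_integral[OF assms(1)] by (simp add: rbar_mult)
qed simp

text \<open>If \<open>b \<noteq> 1\<close> then \<open>1 + b + \<dots> + b\<^sup>k\<^sup>-\<^sup>1 = 0\<close>, whereas this sum reduces to \<open>k \<noteq> 0\<close> if \<open>b\<close> reduces to \<open>1\<close>.\<close>

lemma root_of_unity_eq_1:
  assumes k: "k > 0" "coprime k p" and b: "b ^ k = 1" "rbar b = 1"
  shows "b = 1"
proof (rule ccontr)
  assume "b \<noteq> 1"
  moreover have "(1 - b) * (\<Sum>i<k. b ^ i) = 0"
    using b by (simp add: one_diff_power_eq[symmetric])
  ultimately have "(\<Sum>i<k. b ^ i) = 0" by simp
  then have "rbar (\<Sum>i\<in>#mset_set {..<k}. b ^ i) = 0"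
    by (simp add: sum_unfold_sum_mset)
  moreover have "(b ^ i) ^ k = 1" for i
    using b by (metis power_mult mult.commute power_one)
  then have "rbar (\<Sum>\<^sub># (image_mset ((^) b) (mset_set {..<k}))) = (\<Sum>i\<in>#mset_set {..<k}. rbar (b ^ i))"
    by (subst rbar_sum_mset[OF k(1)]) (auto simp: image_mset.compositionality o_def)
  moreover have "\<dots> = of_nat k"
    using rbar_power[OF k(1) b(1)] b(2) by (simp add: sum_mset_constant)
  ultimately have "of_nat k = (0 :: 'f alg_closure)" by simp
  then have "p dvd k" by (simp add: CHAR_residue_closure)
  then show False
    using k prime_p by (metis coprime_absorb_right coprime_commute not_prime_unit)
qed

lemma rbar_inj_on_roots_of_unity:
  assumes k: "k > 0" "coprime k p"
  shows "inj_on rbar {b. b ^ k = 1}"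
proof (rule inj_onI, clarify)
  fix b c assume b: "b ^ k = 1" and c: "c ^ k = 1" and eq: "rbar b = rbar c"
  define d where "d = b / c"
  have c0: "c \<noteq> 0" using c k by (auto simp: power_0_left)
  have d: "d ^ k = 1" "b = d * c"
    using b c c0 by (auto simp: d_def power_divide)
  have "rbar b = rbar d * rbar c"
    unfolding d(2) using d(1) c root_of_unity_integral[OF k(1)] by (simp add: rbar_mult)
  moreover have "rbar c \<noteq> 0"
    using rbar_power[OF k(1) c, of k] c k by (auto simp: power_0_left)
  ultimately have "rbar d = 1" using eq by simp
  then show "b = c"
    using root_of_unity_eq_1[OF k d(1)] d(2) by simp
qed

text \<open>By injectivity, the \<open>k\<close> roots of \<open>X\<^sup>k - 1\<close> in characteristic \<open>0\<close> have \<open>k\<close> different images, and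
  \<open>X\<^sup>k - 1\<close> cannot have more than \<open>k\<close> roots.\<close>

lemma rbar_image_roots_of_unity:
  assumes k: "k > 0" "coprime k p"
  shows "rbar ` {b. b ^ k = 1} = {a. a ^ k = 1}"
proof (rule card_seteq)
  show "finite {a :: 'f alg_closure. a ^ k = 1}"
    by (rule finite_roots_of_unity(1)[OF k(1)])
  show "rbar ` {b. b ^ k = 1} \<subseteq> {a. a ^ k = 1}"
    using rbar_power[OF k(1), of _ k] by auto
  show "card {a :: 'f alg_closure. a ^ k = 1} \<le> card (rbar ` {b. b ^ k = 1})"
    using finite_roots_of_unity(2)[OF k(1), where 'a = "'f alg_closure"]
    by (simp add: card_image[OF rbar_inj_on_roots_of_unity[OF k]] card_roots_of_unity[OF k(1)])
qed

text \<open>A competing lift has an order \<open>l\<close> of its own; injectivity is applied to the roots of unity of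
  order dividing \<open>k * l\<close>.\<close>

lemma root_lift_eqI:
  assumes "k > 0" "coprime k p" "b ^ k = 1" "rbar b = a"
  shows "root_lift p rbar a = b"
  unfolding root_lift_def
proof (rule the_equality)
  fix c assume c: "(\<exists>k>0. coprime k p \<and> c ^ k = 1) \<and> rbar c = a"
  then obtain l where l: "l > 0" "coprime l p" "c ^ l = 1" by auto
  have kl: "k * l > 0" "coprime (k * l) p"
    using assms(1,2) l(1,2) by simp_all
  have "b ^ (k * l) = 1" "c ^ (l * k) = 1"
    using assms(3) l(3) by (simp_all only: power_mult power_one)
  then show "c = b"
    using inj_onD[OF rbar_inj_on_roots_of_unity[OF kl], of c b] assms(4) c
    by (simp add: mult.commute)
qed (use assms in auto)

lemma root_lift:
  assumes "k > 0" "coprime k p" "a ^ k = 1"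
  shows "root_lift p rbar a ^ k = 1" "rbar (root_lift p rbar a) = a"
proof -
  have "a \<in> rbar ` {b. b ^ k = 1}"
    unfolding rbar_image_roots_of_unity[OF assms(1,2)] using assms(3) by simp
  then obtain b where b: "b ^ k = 1" "rbar b = a"
    by (elim imageE) simp
  from root_lift_eqI[OF assms(1,2) b]
  show "root_lift p rbar a ^ k = 1" "rbar (root_lift p rbar a) = a"
    using b by (simp_all only:)
qed

lemma root_lift_mult:
  assumes k: "k > 0" "coprime k p" and a: "a ^ k = 1" and c: "c ^ k = 1"
  shows "root_lift p rbar (a * c) = root_lift p rbar a * root_lift p rbar c"
proof (rule root_lift_eqI[OF k])
  note la = root_lift[OF k a] and lc = root_lift[OF k c]
  show "(root_lift p rbar a * root_lift p rbar c) ^ k = 1"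
    using la lc by (simp add: power_mult_distrib)
  show "rbar (root_lift p rbar a * root_lift p rbar c) = a * c"
    using la lc rbar_mult[OF root_of_unity_integral[OF k(1) la(1)] root_of_unity_integral[OF k(1) lc(1)]]
    by simp
qed

lemma rbar_sum_root_lift:
  assumes k: "k > 0" "coprime k p" and M: "\<And>a. a \<in># M \<Longrightarrow> a ^ k = 1"
  shows "rbar (\<Sum>a\<in>#M. root_lift p rbar a) = \<Sum>\<^sub># M"
proof -
  have "rbar (\<Sum>a\<in>#M. root_lift p rbar a) = (\<Sum>a\<in>#M. rbar (root_lift p rbar a))"
    using rbar_sum_mset[OF k(1), of "image_mset (root_lift p rbar) M"] root_lift(1)[OF k] M
    by (auto simp: image_mset.compositionality o_def)
  also have "\<dots> = (\<Sum>a\<in>#M. a)"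
    using root_lift(2)[OF k] M by (intro arg_cong[where f = sum_mset] image_mset_cong) auto
  finally show ?thesis by simp
qed

end

section \<open>Modules over group algebras\<close>

locale finite_group_modules = group G for G (structure) +
  assumes finite_carrier: "finite (carrier G)"
begin

lemma is_gmod_iff:
  fixes M :: "('a, 'f::field) gmod"
  shows "is_gmod G M \<longleftrightarrow> (\<forall>g\<in>carrier G. gact M g \<in> carrier_mat (gdim M) (gdim M)) \<and>
    (\<forall>g\<in>carrier G. \<forall>h\<in>carrier G. gact M (g \<otimes> h) = gact M g * gact M h) \<and>
    gact M \<one> = 1\<^sub>m (gdim M)"
proof
  let ?R = "ring_mat TYPE('f) (gdim M) ()"
  interpret R: ring ?R by (rule ring_mat)
  assume M: "is_gmod G M"
  then have h: "gact M \<in> hom G (units_of ?R)" by (simp add: is_gmod_def)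
  interpret U: group "units_of ?R" by (rule R.units_group)
  have "gact M \<one> = \<one>\<^bsub>units_of ?R\<^esub>"
    using h hom_one U.is_group is_group by blast
  moreover have "gact M g \<in> Units ?R" if "g \<in> carrier G" for g
    using hom_in_carrier[OF h that] by (simp add: units_of_carrier)
  then have "gact M g \<in> carrier_mat (gdim M) (gdim M)" if "g \<in> carrier G" for g
    using that unfolding Units_def by (simp add: ring_mat_simps)
  moreover have "gact M (g \<otimes> h') = gact M g * gact M h'" if "g \<in> carrier G" "h' \<in> carrier G" for g h'
    using hom_mult[OF h that] by (simp add: units_of_mult ring_mat_simps)
  ultimately show "(\<forall>g\<in>carrier G. gact M g \<in> carrier_mat (gdim M) (gdim M)) \<and>
    (\<forall>g\<in>carrier G. \<forall>h\<in>carrier G. gact M (g \<otimes> h) = gact M g * gact M h) \<and>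
    gact M \<one> = 1\<^sub>m (gdim M)"
    by (simp add: units_of_one ring_mat_simps)
next
  let ?R = "ring_mat TYPE('f) (gdim M) ()"
  assume *: "(\<forall>g\<in>carrier G. gact M g \<in> carrier_mat (gdim M) (gdim M)) \<and>
    (\<forall>g\<in>carrier G. \<forall>h\<in>carrier G. gact M (g \<otimes> h) = gact M g * gact M h) \<and>
    gact M \<one> = 1\<^sub>m (gdim M)"
  have "gact M g \<in> Units ?R" if g: "g \<in> carrier G" for g
  proof -
    have "gact M g * gact M (inv g) = 1\<^sub>m (gdim M)" "gact M (inv g) * gact M g = 1\<^sub>m (gdim M)"
      using * g by (metis inv_closed r_inv, metis inv_closed l_inv)
    then show ?thesis
      using * g unfolding Units_def by (auto simp: ring_mat_simps intro!: bexI[of _ "gact M (inv g)"])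
  qed
  then show "is_gmod G M"
    unfolding is_gmod_def using * by (auto intro!: homI simp: units_of_carrier units_of_mult ring_mat_simps)
qed

lemma gactD:
  assumes "is_gmod G M"
  shows "g \<in> carrier G \<Longrightarrow> gact M g \<in> carrier_mat (gdim M) (gdim M)"
    and "g \<in> carrier G \<Longrightarrow> h \<in> carrier G \<Longrightarrow> gact M (g \<otimes> h) = gact M g * gact M h"
    and "gact M \<one> = 1\<^sub>m (gdim M)"
  using assms unfolding is_gmod_iff by auto

lemma gact_pow:
  assumes "is_gmod G M" "g \<in> carrier G"
  shows "gact M (g [^] (k::nat)) = gact M g ^\<^sub>m k"
proof (induction k)
  case 0
  then show ?case using gactD(1)[OF assms] gactD(3)[OF assms(1)] by simp
next
  case (Suc k)
  then show ?case using gactD[OF assms(1)] assms(2) by simp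
qed

lemma gact_mult_vec:
  assumes "is_gmod G M" "g \<in> carrier G" "h \<in> carrier G" "v \<in> carrier_vec (gdim M)"
  shows "gact M (g \<otimes> h) *\<^sub>v v = gact M g *\<^sub>v (gact M h *\<^sub>v v)"
  using gactD[OF assms(1)] assms(2-4) by (metis assoc_mult_mat_vec)

lemma gmod_sub_iff:
  "gmod_sub G M W \<longleftrightarrow> W \<subseteq> carrier_vec (gdim M) \<and> 0\<^sub>v (gdim M) \<in> W \<and>
     (\<forall>u\<in>W. \<forall>w\<in>W. u + w \<in> W) \<and> (\<forall>c. \<forall>w\<in>W. c \<cdot>\<^sub>v w \<in> W) \<and>
     (\<forall>g\<in>carrier G. \<forall>w\<in>W. gact M g *\<^sub>v w \<in> W)"
  unfolding gmod_sub_def subspace_def submodule_def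
  using vec_vs[of "gdim M"] vec_module[of "gdim M"] 
  by (auto simp: module_vec_simps)

lemma gmod_homD:
  assumes "T \<in> gmod_hom G M N"
  shows "T \<in> carrier_mat (gdim N) (gdim M)"
    and "g \<in> carrier G \<Longrightarrow> T * gact M g = gact N g * T"
  using assms unfolding gmod_hom_def by auto

lemma gmod_hom_mult_vec:
  assumes "is_gmod G M" "is_gmod G N" "T \<in> gmod_hom G M N" "g \<in> carrier G" "v \<in> carrier_vec (gdim M)"
  shows "T *\<^sub>v (gact M g *\<^sub>v v) = gact N g *\<^sub>v (T *\<^sub>v v)"
  using gmod_homD[OF assms(3)] gactD(1)[OF assms(1,4)] gactD(1)[OF assms(2,4)] assms(4,5)
  by (metis assoc_mult_mat_vec)

lemma gmod_hom_mult:
  assumes "is_gmod G L" "is_gmod G M" "is_gmod G N" "S \<in> gmod_hom G M N" "T \<in> gmod_hom G L M"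
  shows "S * T \<in> gmod_hom G L N"
proof -
  note S = gmod_homD[OF assms(4)] and T = gmod_homD[OF assms(5)]
  have "S * T * gact L g = gact N g * (S * T)" if g: "g \<in> carrier G" for g
  proof -
    note c = gactD(1)[OF assms(1) g] gactD(1)[OF assms(2) g] gactD(1)[OF assms(3) g]
    have "S * T * gact L g = S * (T * gact L g)"
      using S(1) T(1) c by (intro assoc_mult_mat) auto
    also have "\<dots> = S * gact M g * T"
      unfolding T(2)[OF g] using S(1) T(1) c by (intro assoc_mult_mat[symmetric]) auto
    also have "\<dots> = gact N g * (S * T)"
      unfolding S(2)[OF g] using S(1) T(1) c by (intro assoc_mult_mat) auto
    finally show ?thesis .
  qed
  then show ?thesis
    using S(1) T(1) unfolding gmod_hom_def by auto
qed

lemma gmod_hom_inverse: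
  assumes "is_gmod G M" "is_gmod G N" "T \<in> gmod_hom G M N" "S \<in> carrier_mat (gdim M) (gdim N)"
    and ST: "S * T = 1\<^sub>m (gdim M)" "T * S = 1\<^sub>m (gdim N)"
  shows "S \<in> gmod_hom G N M"
proof -
  note T = gmod_homD[OF assms(3)]
  have "S * gact N g = gact M g * S" if g: "g \<in> carrier G" for g
  proof -
    note c = gactD(1)[OF assms(1) g] gactD(1)[OF assms(2) g]
    have "S * gact N g = S * gact N g * (T * S)"
      using ST c assms(4) by simp
    also have "\<dots> = S * (gact N g * T) * S"
      using assoc_mult_mat[OF assms(4) c(2) T(1)]
        assoc_mult_mat[OF mult_carrier_mat[OF assms(4) c(2)] T(1) assms(4)] by simp
    also have "\<dots> = (S * T) * gact M g * S"
      unfolding T(2)[OF g, symmetric] assoc_mult_mat[OF assms(4) T(1) c(1)] ..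
    also have "\<dots> = gact M g * S"
      using ST c by simp
    finally show ?thesis .
  qed
  then show ?thesis using assms(4) unfolding gmod_hom_def by auto
qed

lemma gmod_hom_one: "is_gmod G M \<Longrightarrow> 1\<^sub>m (gdim M) \<in> gmod_hom G M M"
  unfolding gmod_hom_def using gactD(1) by fastforce

lemma gmod_sub_carrier: "is_gmod G M \<Longrightarrow> gmod_sub G M (carrier_vec (gdim M))"
  unfolding gmod_sub_iff using gactD(1) by fastforce

lemma gmod_sub_image:
  assumes "is_gmod G M" "is_gmod G N" "T \<in> gmod_hom G M N" "gmod_sub G M U"
  shows "gmod_sub G N (mat_image T U)"
proof -
  note T = gmod_homD[OF assms(3)]
  note U = assms(4)[unfolded gmod_sub_iff]
  show ?thesis
    unfolding gmod_sub_iff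
  proof (intro conjI ballI allI)
    show "mat_image T U \<subseteq> carrier_vec (gdim N)"
      using U T(1) by auto
    show "0\<^sub>v (gdim N) \<in> mat_image T U"
      using U mult_mat_vec_zero[OF T(1)] by (metis image_eqI)
    fix u w assume "u \<in> mat_image T U" "w \<in> mat_image T U"
    then obtain a b where ab: "a \<in> U" "b \<in> U" "u = T *\<^sub>v a" "w = T *\<^sub>v b" by auto
    then have "a \<in> carrier_vec (gdim M)" "b \<in> carrier_vec (gdim M)" using U by auto
    with ab show "u + w \<in> mat_image T U"
      using U mult_add_distrib_mat_vec[OF T(1), of a b] by (intro image_eqI[of _ _ "a + b"]) auto
  next
    fix c w assume "w \<in> mat_image T U"
    then obtain b where b: "b \<in> U" "w = T *\<^sub>v b" by auto
    then have "b \<in> carrier_vec (gdim M)" using U by auto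
    with b show "c \<cdot>\<^sub>v w \<in> mat_image T U"
      using U mult_mat_vec[OF T(1), of b c] by (intro image_eqI[of _ _ "c \<cdot>\<^sub>v b"]) auto
  next
    fix g w assume g: "g \<in> carrier G" and "w \<in> mat_image T U"
    then obtain b where b: "b \<in> U" "w = T *\<^sub>v b" by auto
    then have "b \<in> carrier_vec (gdim M)" using U by auto
    with b show "gact N g *\<^sub>v w \<in> mat_image T U"
      using U g gmod_hom_mult_vec[OF assms(1-3) g, of b]
      by (intro image_eqI[of _ _ "gact M g *\<^sub>v b"]) auto
  qed
qed

lemma gmod_sub_kernel:
  assumes "is_gmod G M" "is_gmod G N" "T \<in> gmod_hom G M N"
  shows "gmod_sub G M {v \<in> carrier_vec (gdim M). T *\<^sub>v v = 0\<^sub>v (gdim N)}"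
proof -
  note T = gmod_homD[OF assms(3)]
  have "T *\<^sub>v (gact M g *\<^sub>v v) = 0\<^sub>v (gdim N)"
    if "g \<in> carrier G" "v \<in> carrier_vec (gdim M)" "T *\<^sub>v v = 0\<^sub>v (gdim N)" for g v
    using gmod_hom_mult_vec[OF assms that(1,2)] that(3) mult_mat_vec_zero[OF gactD(1)[OF assms(2) that(1)]]
    by simp
  then show ?thesis
    unfolding gmod_sub_iff using T(1) gactD(1)[OF assms(1)]
    by (auto simp: mult_add_distrib_mat_vec[OF T(1)] mult_mat_vec[OF T(1)] intro!: mult_mat_vec_carrier)
qed

text \<open>In the basis of \<open>W\<close> formed by the columns of \<open>J\<close>, an element \<open>g\<close> acts by the unique matrix
  \<open>B\<close> with \<open>J * B = gact M g * J\<close>.\<close>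

lemma gmod_sub_as_gmod:
  assumes M: "is_gmod G M" and W: "gmod_sub G M W"
  obtains N J where "is_gmod G N" "J \<in> gmod_hom G N M" "injective_mat J"
    "mat_image J (carrier_vec (gdim N)) = W"
proof -
  note W' = W[unfolded gmod_sub_iff]
  obtain k J where J: "J \<in> carrier_mat (gdim M) k" "injective_mat J"
    and im: "mat_image J (carrier_vec k) = W"
    by (rule subspace_eq_injective_mat_image[of W "gdim M"]) (use W' in auto)
  have "\<exists>B\<in>carrier_mat k k. J * B = gact M g * J" if g: "g \<in> carrier G" for g
  proof -
    note c = gactD(1)[OF M g]
    have "\<exists>x\<in>carrier_vec k. J *\<^sub>v x = gact M g *\<^sub>v col J j" if "j < k" for j
    proof -
      have "col J j \<in> W"
        unfolding im[symmetric] using that mult_mat_unit_vec[OF J(1) that]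
        by (metis image_eqI unit_vec_carrier)
      then have "gact M g *\<^sub>v col J j \<in> mat_image J (carrier_vec k)"
        unfolding im using W' g by auto
      then show ?thesis by (metis imageE)
    qed
    then obtain f where f: "\<And>j. j < k \<Longrightarrow> f j \<in> carrier_vec k"
      "\<And>j. j < k \<Longrightarrow> J *\<^sub>v f j = gact M g *\<^sub>v col J j" by metis
    define B where "B = mat k k (\<lambda>(i, j). f j $ i)"
    have B: "B \<in> carrier_mat k k" unfolding B_def by simp
    have "J * B = gact M g * J"
    proof (rule mat_col_eqI)
      fix j assume "j < dim_col (gact M g * J)"
      then have j: "j < k" using J by simp
      have "col B j = f j"
        using j f(1)[OF j] by (auto simp: B_def intro!: eq_vecI)
      then show "col (J * B) j = col (gact M g * J) j"
        using f(2)[OF j] by (simp only: col_mult2[OF J(1) B j] col_mult2[OF c J(1) j])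
    qed (use J B c in auto)
    with B show ?thesis by blast
  qed
  then obtain \<rho> where \<rho>: "\<And>g. g \<in> carrier G \<Longrightarrow> \<rho> g \<in> carrier_mat k k"
    "\<And>g. g \<in> carrier G \<Longrightarrow> J * \<rho> g = gact M g * J"
    by metis
  have "\<rho> (g \<otimes> h) = \<rho> g * \<rho> h" if g: "g \<in> carrier G" and h: "h \<in> carrier G" for g h
  proof (rule injective_mat_cancel_left[OF J(2,1)])
    note c = gactD(1)[OF M g] gactD(1)[OF M h]
    have "J * (\<rho> g * \<rho> h) = J * \<rho> g * \<rho> h"
      using J \<rho>(1) g h by (intro assoc_mult_mat[symmetric]) auto
    also have "\<dots> = gact M g * (J * \<rho> h)"
      unfolding \<rho>(2)[OF g] using J \<rho>(1) g h c by (intro assoc_mult_mat) auto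
    also have "\<dots> = gact M g * gact M h * J"
      unfolding \<rho>(2)[OF h] using J c by (intro assoc_mult_mat[symmetric]) auto
    finally show "J * \<rho> (g \<otimes> h) = J * (\<rho> g * \<rho> h)"
      using \<rho>(2) gactD(2)[OF M] g h by simp
  qed (use \<rho>(1) g h in \<open>auto intro!: mult_carrier_mat\<close>)
  moreover have "\<rho> \<one> = 1\<^sub>m k"
    by (rule injective_mat_cancel_left[OF J(2,1)]) (use \<rho> J gactD(3)[OF M] in auto)
  ultimately have "is_gmod G (k, \<rho>)"
    unfolding is_gmod_iff using \<rho> by simp
  moreover have "J \<in> gmod_hom G (k, \<rho>) M"
    unfolding gmod_hom_def using J \<rho> by simp
  ultimately show ?thesis using that J im by fastforce
qed

lemma simple_gmodD:
  assumes "simple_gmod G V"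
  shows "is_gmod G V" "gdim V > 0"
    "gmod_sub G V W \<Longrightarrow> W \<noteq> {0\<^sub>v (gdim V)} \<Longrightarrow> W = carrier_vec (gdim V)"
  using assms unfolding simple_gmod_def by auto

text \<open>A nonzero submodule of least dimension is simple.\<close>

lemma nonzero_gmod_sub_contains_simple:
  fixes M :: "('a, 'd::field) gmod"
  assumes M: "is_gmod G M" and W: "gmod_sub G M W" "W \<noteq> {0\<^sub>v (gdim M)}"
  obtains N J where "simple_gmod G N" "J \<in> gmod_hom G N M" "injective_mat J"
    "mat_image J (carrier_vec (gdim N)) \<subseteq> W"
proof -
  define P where "P k \<longleftrightarrow> k > 0 \<and> (\<exists>N J. gdim N = k \<and> is_gmod G N \<and> J \<in> gmod_hom G N M \<and>
    injective_mat J \<and> mat_image J (carrier_vec (gdim N)) \<subseteq> W)" for k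
  obtain N0 J0 where N0: "is_gmod G N0" "J0 \<in> gmod_hom G N0 M" "injective_mat J0"
    "mat_image J0 (carrier_vec (gdim N0)) = W"
    by (rule gmod_sub_as_gmod[OF M W(1)])
  have "gdim N0 > 0"
  proof (rule ccontr)
    assume "\<not> gdim N0 > 0"
    then have c: "carrier_vec (gdim N0) = {0\<^sub>v (gdim N0)}" by auto
    show False
      using W(2) mult_mat_vec_zero[OF gmod_homD(1)[OF N0(2)]] unfolding N0(4)[symmetric] c by simp
  qed
  with N0 have P0: "P (gdim N0)" unfolding P_def by blast
  define k where "k = (LEAST k. P k)"
  have "P k" unfolding k_def by (rule LeastI[of P, OF P0])
  then obtain N J where k: "k > 0" and N: "gdim N = k" "is_gmod G N" "J \<in> gmod_hom G N M"
    "injective_mat J" "mat_image J (carrier_vec (gdim N)) \<subseteq> W"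
    unfolding P_def by auto
  note Jc = gmod_homD(1)[OF N(3)]
  have "U = {0\<^sub>v (gdim N)} \<or> U = carrier_vec (gdim N)" if U: "gmod_sub G N U" for U
  proof (cases "U = {0\<^sub>v (gdim N)}")
    case False
    obtain L I where L: "is_gmod G L" "I \<in> gmod_hom G L N" "injective_mat I"
      "mat_image I (carrier_vec (gdim L)) = U"
      by (rule gmod_sub_as_gmod[OF N(2) U])
    note Ic = gmod_homD(1)[OF L(2)]
    have "gdim L > 0"
    proof (rule ccontr)
      assume "\<not> gdim L > 0"
      then have c: "carrier_vec (gdim L) = {0\<^sub>v (gdim L)}" by auto
      show False
        using False mult_mat_vec_zero[OF Ic] unfolding L(4)[symmetric] c by simp
    qed
    moreover have "mat_image (J * I) (carrier_vec (gdim L)) \<subseteq> W"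
    proof clarify
      fix w :: "'d vec" assume "w \<in> carrier_vec (gdim L)"
      then show "J * I *\<^sub>v w \<in> W"
        using N(5) Jc Ic by (auto simp: assoc_mult_mat_vec[OF Jc Ic])
    qed
    ultimately have "P (gdim L)"
      unfolding P_def using gmod_hom_mult[OF L(1) N(2) M N(3) L(2)] L(1)
        injective_mat_mult[OF N(4) L(3) Jc Ic] by blast
    then have "k \<le> gdim L" unfolding k_def by (rule Least_le)
    moreover have "gdim L \<le> gdim N" by (rule injective_mat_dim_le[OF L(3) Ic])
    ultimately have "gdim L = gdim N" using N(1) by simp
    then have "U = carrier_vec (gdim N)"
      using injective_square_mat_surjective[of I "gdim N"] L Ic by auto
    then show ?thesis ..
  qed simp
  then have "simple_gmod G N"
    unfolding simple_gmod_def using N k by auto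
  with N that show ?thesis by blast
qed

definition gmod_iso :: "('a, 'f::field) gmod \<Rightarrow> ('a, 'f) gmod \<Rightarrow> bool" where
  "gmod_iso M N \<longleftrightarrow> (\<exists>T\<in>gmod_hom G M N. \<exists>S\<in>gmod_hom G N M.
     S * T = 1\<^sub>m (gdim M) \<and> T * S = 1\<^sub>m (gdim N))"

lemma bijective_hom_gmod_iso:
  assumes M: "is_gmod G M" "is_gmod G N" "T \<in> gmod_hom G M N"
    and inj: "injective_mat T" and dims: "gdim M = gdim N"
  shows "gmod_iso M N"
proof -
  note T = gmod_homD[OF M(3)]
  obtain S where S: "S \<in> carrier_mat (gdim N) (gdim N)" "T * S = 1\<^sub>m (gdim N)" "S * T = 1\<^sub>m (gdim N)"
    by (rule injective_square_mat_inverse[OF inj, of "gdim N"]) (use T(1) dims in auto)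
  then have "S \<in> gmod_hom G N M"
    using gmod_hom_inverse[OF M, of S] dims by simp
  then show ?thesis
    unfolding gmod_iso_def using M(3) S dims by auto
qed

text \<open>This is Schur's lemma: the kernel and the image are submodules.\<close>

lemma nonzero_hom_of_simple:
  assumes V: "simple_gmod G V" and W: "simple_gmod G W" and T: "T \<in> gmod_hom G V W"
    and nz: "T \<noteq> 0\<^sub>m (gdim W) (gdim V)"
  shows "gmod_iso V W"
proof -
  note V' = simple_gmodD[OF V] and W' = simple_gmodD[OF W]
  note T' = gmod_homD[OF T]
  have nzv: "\<exists>v\<in>carrier_vec (gdim V). T *\<^sub>v v \<noteq> 0\<^sub>v (gdim W)"
  proof (rule ccontr)
    assume "\<not> ?thesis"
    then have "T = 0\<^sub>m (gdim W) (gdim V)"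
      by (intro mat_eqI_mult_vec[OF T'(1)]) auto
    then show False using nz by simp
  qed
  have "{v \<in> carrier_vec (gdim V). T *\<^sub>v v = 0\<^sub>v (gdim W)} = {0\<^sub>v (gdim V)}"
    using V'(3)[OF gmod_sub_kernel[OF V'(1) W'(1) T]] nzv by blast
  then have inj: "injective_mat T"
    unfolding injective_mat_def using T'(1) by auto
  have "mat_image T (carrier_vec (gdim V)) \<noteq> {0\<^sub>v (gdim W)}"
    using nzv by auto
  from W'(3)[OF gmod_sub_image[OF V'(1) W'(1) T gmod_sub_carrier[OF V'(1)]] this]
  have "gdim W \<le> gdim V"
    using surjective_mat_dim_le[OF T'(1)] by simp
  with injective_mat_dim_le[OF inj T'(1)] have "gdim V = gdim W" by simp
  then show ?thesis
    using bijective_hom_gmod_iso[OF V'(1) W'(1) T inj] by simp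
qed

section \<open>Twisting by linear characters\<close>

text \<open>The condition at \<open>\<one>\<close> excludes the zero function, so that all values on \<open>G\<close> are units of \<open>F\<close>.\<close>

definition linear_char :: "('a \<Rightarrow> 'f::field) \<Rightarrow> bool" where
  "linear_char \<chi> \<longleftrightarrow> \<chi> \<one> = 1 \<and> (\<forall>g\<in>carrier G. \<forall>h\<in>carrier G. \<chi> (g \<otimes> h) = \<chi> g * \<chi> h)"

text \<open>This is \<open>M\<close> tensored with the one-dimensional module of \<open>\<chi>\<close>.\<close>

definition twist :: "('a \<Rightarrow> 'f::field) \<Rightarrow> ('a, 'f) gmod \<Rightarrow> ('a, 'f) gmod" where
  "twist \<chi> M = (gdim M, \<lambda>g. \<chi> g \<cdot>\<^sub>m gact M g)"

lemma twist_simps [simp]: "gdim (twist \<chi> M) = gdim M" "gact (twist \<chi> M) g = \<chi> g \<cdot>\<^sub>m gact M g"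
  by (simp_all add: twist_def)

lemma linear_char_inv_mult:
  assumes "linear_char \<chi>" "g \<in> carrier G"
  shows "\<chi> g * \<chi> (inv g) = 1"
  using assms unfolding linear_char_def by (metis inv_closed r_inv)

lemma linear_char_nonzero:
  assumes "linear_char \<chi>" "g \<in> carrier G"
  shows "\<chi> g \<noteq> 0"
  using linear_char_inv_mult[OF assms] by auto

lemma linear_char_power: "linear_char \<chi> \<Longrightarrow> linear_char (\<lambda>g. \<chi> g ^ k)"
  unfolding linear_char_def by (auto simp: power_mult_distrib)

lemma linear_char_inverse: "linear_char \<chi> \<Longrightarrow> linear_char (\<lambda>g. inverse (\<chi> g))"
  unfolding linear_char_def by auto

lemma linear_char_pow:
  assumes "linear_char \<chi>" "g \<in> carrier G"
  shows "\<chi> (g [^] (k::nat)) = \<chi> g ^ k"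
  using assms unfolding linear_char_def by (induction k) auto

lemma is_gmod_twist:
  assumes "linear_char \<chi>" "is_gmod G M"
  shows "is_gmod G (twist \<chi> M)"
proof -
  have "\<chi> (g \<otimes> h) \<cdot>\<^sub>m gact M (g \<otimes> h) = (\<chi> g \<cdot>\<^sub>m gact M g) * (\<chi> h \<cdot>\<^sub>m gact M h)"
    if g: "g \<in> carrier G" and h: "h \<in> carrier G" for g h
  proof -
    note c = gactD(1)[OF assms(2) g] gactD(1)[OF assms(2) h]
    have "(\<chi> g \<cdot>\<^sub>m gact M g) * (\<chi> h \<cdot>\<^sub>m gact M h) = \<chi> h \<cdot>\<^sub>m ((\<chi> g \<cdot>\<^sub>m gact M g) * gact M h)"
      by (rule mult_smult_distrib[OF smult_carrier_mat[OF c(1)] c(2)])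
    also have "\<dots> = \<chi> h \<cdot>\<^sub>m (\<chi> g \<cdot>\<^sub>m (gact M g * gact M h))"
      by (simp add: mult_smult_assoc_mat[OF c])
    finally show ?thesis
      using assms(1) gactD(2)[OF assms(2) g h] g h
      by (simp add: smult_smult_mat linear_char_def mult.commute)
  qed
  then show ?thesis
    using assms(1) gactD[OF assms(2)] unfolding is_gmod_iff linear_char_def
    by (simp add: one_smult_mat)
qed

lemma gmod_sub_twist:
  assumes "linear_char \<chi>" "is_gmod G M"
  shows "gmod_sub G (twist \<chi> M) W \<longleftrightarrow> gmod_sub G M W"
proof -
  have eq: "(\<chi> g \<cdot>\<^sub>m gact M g) *\<^sub>v w = \<chi> g \<cdot>\<^sub>v (gact M g *\<^sub>v w)"
    if "g \<in> carrier G" "w \<in> carrier_vec (gdim M)" for g w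
    using smult_mult_mat_vec[OF gactD(1)[OF assms(2) that(1)] that(2)] .
  have "(\<chi> g \<cdot>\<^sub>m gact M g) *\<^sub>v w \<in> W \<longleftrightarrow> gact M g *\<^sub>v w \<in> W"
    if "W \<subseteq> carrier_vec (gdim M)" "\<forall>c. \<forall>w\<in>W. c \<cdot>\<^sub>v w \<in> W" "g \<in> carrier G" "w \<in> W" for g w
  proof -
    have "gact M g *\<^sub>v w = inverse (\<chi> g) \<cdot>\<^sub>v (\<chi> g \<cdot>\<^sub>v (gact M g *\<^sub>v w))"
      using linear_char_nonzero[OF assms(1) that(3)] by (simp add: smult_smult_assoc)
    then show ?thesis
      using that eq[of g w] by (metis subsetD)
  qed
  then show ?thesis
    unfolding gmod_sub_iff by auto
qed

lemma simple_gmod_twist: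
  assumes "linear_char \<chi>" "simple_gmod G M"
  shows "simple_gmod G (twist \<chi> M)"
  using is_gmod_twist[OF assms(1), of M] gmod_sub_twist[OF assms(1), of M] assms(2)
  unfolding simple_gmod_def twist_simps by simp

text \<open>Twisting both modules changes neither side of \<open>T * gact M g = gact N g * T\<close> by more than the unit
  \<open>\<chi> g\<close>. With equal matrices as homomorphisms, all notions that are defined by homomorphisms transfer to
  the twisted modules.\<close>

lemma gmod_hom_twist:
  assumes "linear_char \<chi>" "is_gmod G M" "is_gmod G N"
  shows "gmod_hom G (twist \<chi> M) (twist \<chi> N) = gmod_hom G M N"
proof -
  have "T * (\<chi> g \<cdot>\<^sub>m gact M g) = (\<chi> g \<cdot>\<^sub>m gact N g) * T \<longleftrightarrow> T * gact M g = gact N g * T"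
    if T: "T \<in> carrier_mat (gdim N) (gdim M)" and g: "g \<in> carrier G" for T g
  proof -
    have "T * (\<chi> g \<cdot>\<^sub>m gact M g) = \<chi> g \<cdot>\<^sub>m (T * gact M g)"
      "(\<chi> g \<cdot>\<^sub>m gact N g) * T = \<chi> g \<cdot>\<^sub>m (gact N g * T)"
      using mult_smult_distrib[OF T gactD(1)[OF assms(2) g]]
        mult_smult_assoc_mat[OF gactD(1)[OF assms(3) g] T] by auto
    moreover have "A = B" if "\<chi> g \<cdot>\<^sub>m A = \<chi> g \<cdot>\<^sub>m B" for A B
    proof -
      have "inverse (\<chi> g) \<cdot>\<^sub>m (\<chi> g \<cdot>\<^sub>m A) = inverse (\<chi> g) \<cdot>\<^sub>m (\<chi> g \<cdot>\<^sub>m B)"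
        using that by simp
      then show ?thesis
        using linear_char_nonzero[OF assms(1) g] by (simp add: smult_smult_mat one_smult_mat)
    qed
    ultimately show ?thesis by metis
  qed
  then show ?thesis
    unfolding gmod_hom_def by auto
qed


section \<open>Permutation modules\<close>

text \<open>An action of \<open>G\<close> on \<open>{..<n}\<close> gives a module by permutation of the standard basis. It is
  needed for the action of \<open>G\<close> on itself and on the cosets of a normal subgroup.\<close>

lemma permutation_gmod:
  fixes \<pi> :: "'a \<Rightarrow> nat \<Rightarrow> nat"
  assumes maps: "\<And>g i. g \<in> carrier G \<Longrightarrow> i < n \<Longrightarrow> \<pi> g i < n"
    and one: "\<And>i. i < n \<Longrightarrow> \<pi> \<one> i = i"
    and mult: "\<And>g h i. g \<in> carrier G \<Longrightarrow> h \<in> carrier G \<Longrightarrow> i < n \<Longrightarrow> \<pi> (g \<otimes> h) i = \<pi> g (\<pi> h i)"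
  obtains M :: "('a, 'f::field) gmod" where "is_gmod G M" "gdim M = n"
    "\<And>g i. g \<in> carrier G \<Longrightarrow> i < n \<Longrightarrow> gact M g *\<^sub>v unit_vec n i = unit_vec n (\<pi> g i)"
proof -
  define \<rho> :: "'a \<Rightarrow> 'f mat" where "\<rho> g = mat n n (\<lambda>(i, j). if i = \<pi> g j then 1 else 0)" for g
  have \<rho>: "\<rho> g \<in> carrier_mat n n" for g unfolding \<rho>_def by simp
  have unit: "col (\<rho> g) j = unit_vec n (\<pi> g j)" if "j < n" for g j
    using that by (auto simp: \<rho>_def unit_vec_def intro!: eq_vecI)
  have act: "\<rho> g *\<^sub>v unit_vec n j = unit_vec n (\<pi> g j)" if "j < n" for g j
    using mult_mat_unit_vec[OF \<rho> that] unit[OF that] by simp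
  have "\<rho> (g \<otimes> h) = \<rho> g * \<rho> h" if g: "g \<in> carrier G" and h: "h \<in> carrier G" for g h
  proof (rule mat_col_eqI)
    fix j assume "j < dim_col (\<rho> g * \<rho> h)"
    then have j: "j < n" using \<rho>[of h] by simp
    show "col (\<rho> (g \<otimes> h)) j = col (\<rho> g * \<rho> h) j"
      unfolding col_mult2[OF \<rho> \<rho> j] unit[OF j]
      using act[OF maps[OF h j]] mult[OF g h j] by simp
  qed (use \<rho>[of g] \<rho>[of h] \<rho>[of "g \<otimes> h"] in auto)
  moreover have "\<rho> \<one> = 1\<^sub>m n"
    using one by (auto simp: \<rho>_def intro!: eq_matI)
  ultimately have "is_gmod G (n, \<rho>)"
    unfolding is_gmod_iff using \<rho> by simp
  with act that show ?thesis by fastforce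
qed

end

context finite_group_modules
begin

section \<open>A simple module is determined by its traces\<close>

text \<open>A function \<open>a\<close> stands for the element \<open>\<Sum>g. a g \<cdot> g\<close> of the group algebra. Its values outside
  \<open>G\<close> are irrelevant.\<close>

definition ga_act :: "('a, 'f::field) gmod \<Rightarrow> ('a \<Rightarrow> 'f) \<Rightarrow> 'f mat" where
  "ga_act M a = mat (gdim M) (gdim M) (\<lambda>(i, j). \<Sum>g\<in>carrier G. a g * gact M g $$ (i, j))"

lemma ga_act_carrier [simp]: "ga_act M a \<in> carrier_mat (gdim M) (gdim M)"
  unfolding ga_act_def by simp

lemma ga_act_dim [simp]: "dim_row (ga_act M a) = gdim M" "dim_col (ga_act M a) = gdim M"
  unfolding ga_act_def by simp_all

lemma ga_act_vec_index:
  assumes M: "is_gmod G M" and u: "u \<in> carrier_vec (gdim M)" and i: "i < gdim M"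
  shows "vec_index (ga_act M a *\<^sub>v u) i = (\<Sum>g\<in>carrier G. a g * vec_index (gact M g *\<^sub>v u) i)"
proof -
  have "vec_index (ga_act M a *\<^sub>v u) i
      = (\<Sum>j<gdim M. \<Sum>g\<in>carrier G. a g * (gact M g $$ (i, j) * vec_index u j))"
    using i u by (simp add: ga_act_def scalar_prod_def atLeast0LessThan sum_distrib_right mult.assoc)
  also have "\<dots> = (\<Sum>g\<in>carrier G. a g * (\<Sum>j<gdim M. gact M g $$ (i, j) * vec_index u j))"
    by (subst sum.swap) (simp add: sum_distrib_left)
  also have "\<dots> = (\<Sum>g\<in>carrier G. a g * vec_index (gact M g *\<^sub>v u) i)"
  proof (rule sum.cong[OF refl])
    fix g assume "g \<in> carrier G"
    from gactD(1)[OF M this]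
    show "a g * (\<Sum>j<gdim M. gact M g $$ (i, j) * vec_index u j) = a g * vec_index (gact M g *\<^sub>v u) i"
      using i u by (simp add: scalar_prod_def atLeast0LessThan)
  qed
  finally show ?thesis .
qed

lemma ga_act_add:
  assumes "is_gmod G M" "u \<in> carrier_vec (gdim M)"
  shows "ga_act M (\<lambda>g. a g + b g) *\<^sub>v u = ga_act M a *\<^sub>v u + ga_act M b *\<^sub>v u"
  using ga_act_vec_index[OF assms] by (intro eq_vecI) (auto simp: algebra_simps sum.distrib simp del: index_mult_mat_vec)

lemma ga_act_smult:
  assumes "is_gmod G M" "u \<in> carrier_vec (gdim M)"
  shows "ga_act M (\<lambda>g. c * a g) *\<^sub>v u = c \<cdot>\<^sub>v (ga_act M a *\<^sub>v u)"
  using ga_act_vec_index[OF assms] by (intro eq_vecI) (auto simp: sum_distrib_left mult.assoc simp del: index_mult_mat_vec)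

lemma ga_act_zero:
  assumes "is_gmod G M" "u \<in> carrier_vec (gdim M)"
  shows "ga_act M (\<lambda>g. 0) *\<^sub>v u = 0\<^sub>v (gdim M)"
  using ga_act_vec_index[OF assms] by (intro eq_vecI) (auto simp del: index_mult_mat_vec)

lemma ga_act_delta:
  assumes "is_gmod G M" "u \<in> carrier_vec (gdim M)" "h \<in> carrier G"
  shows "ga_act M (\<lambda>g. if g = h then 1 else 0) *\<^sub>v u = gact M h *\<^sub>v u"
proof (rule eq_vecI)
  fix i assume "i < dim_vec (gact M h *\<^sub>v u)"
  then have i: "i < gdim M" using gactD(1)[OF assms(1,3)] by simp
  have "vec_index (ga_act M (\<lambda>g. if g = h then 1 else 0) *\<^sub>v u) i
      = (\<Sum>g\<in>carrier G. if g = h then vec_index (gact M g *\<^sub>v u) i else 0)"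
    unfolding ga_act_vec_index[OF assms(1,2) i] by (rule sum.cong) auto
  also have "\<dots> = vec_index (gact M h *\<^sub>v u) i"
    using finite_carrier assms(3) by (simp del: index_mult_mat_vec)
  finally show "vec_index (ga_act M (\<lambda>g. if g = h then 1 else 0) *\<^sub>v u) i = vec_index (gact M h *\<^sub>v u) i" .
qed (use gactD(1)[OF assms(1,3)] in auto)

lemma ga_act_translate:
  assumes M: "is_gmod G M" and u: "u \<in> carrier_vec (gdim M)" and h: "h \<in> carrier G"
  shows "ga_act M (\<lambda>g. a (inv h \<otimes> g)) *\<^sub>v u = gact M h *\<^sub>v (ga_act M a *\<^sub>v u)"
proof (rule eq_vecI)
  note c = gactD(1)[OF M h]
  fix i assume "i < dim_vec (gact M h *\<^sub>v (ga_act M a *\<^sub>v u))"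
  then have i: "i < gdim M" using c by simp
  have "vec_index (ga_act M (\<lambda>g. a (inv h \<otimes> g)) *\<^sub>v u) i
      = (\<Sum>g\<in>carrier G. a (inv h \<otimes> g) * vec_index (gact M g *\<^sub>v u) i)"
    by (rule ga_act_vec_index[OF M u i])
  also have "\<dots> = (\<Sum>g\<in>carrier G. a g * vec_index (gact M (h \<otimes> g) *\<^sub>v u) i)"
    by (rule sum.reindex_bij_witness[of _ "\<lambda>g. h \<otimes> g" "\<lambda>g. inv h \<otimes> g"])
      (use h in \<open>auto simp: m_assoc[symmetric]\<close>)
  also have "\<dots> = (\<Sum>g\<in>carrier G. \<Sum>j<gdim M. gact M h $$ (i, j) * (a g * vec_index (gact M g *\<^sub>v u) j))"
  proof (rule sum.cong[OF refl])
    fix g assume g: "g \<in> carrier G"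
    have "vec_index (gact M (h \<otimes> g) *\<^sub>v u) i = vec_index (gact M h *\<^sub>v (gact M g *\<^sub>v u)) i"
      using gact_mult_vec[OF M h g u] by simp
    also have "\<dots> = (\<Sum>j<gdim M. gact M h $$ (i, j) * vec_index (gact M g *\<^sub>v u) j)"
      by (rule mult_mat_vec_index[OF c mult_mat_vec_carrier[OF gactD(1)[OF M g] u] i])
    finally show "a g * vec_index (gact M (h \<otimes> g) *\<^sub>v u) i
        = (\<Sum>j<gdim M. gact M h $$ (i, j) * (a g * vec_index (gact M g *\<^sub>v u) j))"
      by (simp add: sum_distrib_left mult.left_commute)
  qed
  also have "\<dots> = (\<Sum>j<gdim M. gact M h $$ (i, j) * (\<Sum>g\<in>carrier G. a g * vec_index (gact M g *\<^sub>v u) j))"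
    by (subst sum.swap) (simp add: sum_distrib_left)
  also have "\<dots> = (\<Sum>j<gdim M. gact M h $$ (i, j) * vec_index (ga_act M a *\<^sub>v u) j)"
    using ga_act_vec_index[OF M u] by (simp del: index_mult_mat_vec)
  also have "\<dots> = vec_index (gact M h *\<^sub>v (ga_act M a *\<^sub>v u)) i"
    by (rule mult_mat_vec_index[OF c mult_mat_vec_carrier[OF ga_act_carrier u] i, symmetric])
  finally show "vec_index (ga_act M (\<lambda>g. a (inv h \<otimes> g)) *\<^sub>v u) i
      = vec_index (gact M h *\<^sub>v (ga_act M a *\<^sub>v u)) i" .
qed (use gactD(1)[OF M h] in auto)

lemma mtrace_ga_act:
  assumes "is_gmod G M"
  shows "mtrace (ga_act M a) = (\<Sum>g\<in>carrier G. a g * mtrace (gact M g))"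
proof -
  have "mtrace (ga_act M a) = (\<Sum>g\<in>carrier G. a g * (\<Sum>i<gdim M. gact M g $$ (i, i)))"
    unfolding mtrace_def by (simp add: ga_act_def sum_distrib_left) (rule sum.swap)
  then show ?thesis
    using gactD(1)[OF assms] unfolding mtrace_def by (metis (no_types, lifting) carrier_matD(1) sum.cong)
qed

text \<open>Closure under left multiplication is required for group elements, which span the group algebra:
  the product of \<open>h\<close> and \<open>a\<close> has the coefficient function \<open>g \<mapsto> a (h\<^sup>-\<^sup>1g)\<close>.\<close>

definition left_ideal :: "('a \<Rightarrow> 'f::field) set \<Rightarrow> bool" where
  "left_ideal J \<longleftrightarrow> (\<lambda>g. 0) \<in> J \<and> (\<forall>a\<in>J. \<forall>b\<in>J. (\<lambda>g. a g + b g) \<in> J) \<and>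
     (\<forall>c. \<forall>a\<in>J. (\<lambda>g. c * a g) \<in> J) \<and> (\<forall>h\<in>carrier G. \<forall>a\<in>J. (\<lambda>g. a (inv h \<otimes> g)) \<in> J)"

definition annihilator :: "('a, 'f::field) gmod \<Rightarrow> 'f vec \<Rightarrow> ('a \<Rightarrow> 'f) set" where
  "annihilator M v = {a. ga_act M a *\<^sub>v v = 0\<^sub>v (gdim M)}"

lemma left_ideal_UNIV: "left_ideal UNIV"
  unfolding left_ideal_def by simp

lemma left_ideal_Int_annihilator:
  assumes "left_ideal J" "is_gmod G M" "v \<in> carrier_vec (gdim M)"
  shows "left_ideal (J \<inter> annihilator M v)"
  unfolding left_ideal_def
proof (intro conjI ballI allI)
  note J = assms(1)[unfolded left_ideal_def] and [simp] = annihilator_def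
  show "(\<lambda>g. 0) \<in> J \<inter> annihilator M v"
    using J ga_act_zero[OF assms(2,3)] by simp
  show "(\<lambda>g. a g + b g) \<in> J \<inter> annihilator M v"
    if "a \<in> J \<inter> annihilator M v" "b \<in> J \<inter> annihilator M v" for a b
    using J that ga_act_add[OF assms(2,3), of a b] by simp
  show "(\<lambda>g. c * a g) \<in> J \<inter> annihilator M v" if "a \<in> J \<inter> annihilator M v" for c a
    using J that ga_act_smult[OF assms(2,3), of c a] by (auto intro!: eq_vecI)
  show "(\<lambda>g. a (inv h \<otimes> g)) \<in> J \<inter> annihilator M v"
    if h: "h \<in> carrier G" and "a \<in> J \<inter> annihilator M v" for h a
    using J that ga_act_translate[OF assms(2,3) h, of a] mult_mat_vec_zero[OF gactD(1)[OF assms(2) h]]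
    by simp
qed

lemma gmod_sub_left_ideal_mult_vec:
  assumes "left_ideal J" "is_gmod G M" "v \<in> carrier_vec (gdim M)"
  shows "gmod_sub G M ((\<lambda>a. ga_act M a *\<^sub>v v) ` J)"
  unfolding gmod_sub_iff
proof (intro conjI ballI allI)
  note J = assms(1)[unfolded left_ideal_def]
  show "(\<lambda>a. ga_act M a *\<^sub>v v) ` J \<subseteq> carrier_vec (gdim M)"
    using assms(3) by (auto intro!: mult_mat_vec_carrier[OF ga_act_carrier])
  show "0\<^sub>v (gdim M) \<in> (\<lambda>a. ga_act M a *\<^sub>v v) ` J"
    using J ga_act_zero[OF assms(2,3)] by (intro image_eqI[of _ _ "\<lambda>g. 0"]) simp_all
  show "u + w \<in> (\<lambda>a. ga_act M a *\<^sub>v v) ` J"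
    if uw: "u \<in> (\<lambda>a. ga_act M a *\<^sub>v v) ` J" "w \<in> (\<lambda>a. ga_act M a *\<^sub>v v) ` J" for u w
  proof -
    obtain a b where "a \<in> J" "u = ga_act M a *\<^sub>v v" "b \<in> J" "w = ga_act M b *\<^sub>v v"
      using uw by (elim imageE)
    then show ?thesis
      using J ga_act_add[OF assms(2,3), of a b] by (intro image_eqI[of _ _ "\<lambda>g. a g + b g"]) simp_all
  qed
  show "c \<cdot>\<^sub>v w \<in> (\<lambda>a. ga_act M a *\<^sub>v v) ` J" if w: "w \<in> (\<lambda>a. ga_act M a *\<^sub>v v) ` J" for c w
  proof -
    obtain a where "a \<in> J" "w = ga_act M a *\<^sub>v v"
      using w by (elim imageE)
    then show ?thesis
      using J ga_act_smult[OF assms(2,3), of c a] by (intro image_eqI[of _ _ "\<lambda>g. c * a g"]) simp_all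
  qed
  show "gact M h *\<^sub>v w \<in> (\<lambda>a. ga_act M a *\<^sub>v v) ` J"
    if h: "h \<in> carrier G" and w: "w \<in> (\<lambda>a. ga_act M a *\<^sub>v v) ` J" for h w
  proof -
    obtain a where "a \<in> J" "w = ga_act M a *\<^sub>v v"
      using w by (elim imageE)
    then show ?thesis
      using J h ga_act_translate[OF assms(2,3) h, of a]
      by (intro image_eqI[of _ _ "\<lambda>g. a (inv h \<otimes> g)"]) simp_all
  qed
qed

lemma left_ideal_sum:
  fixes k :: nat
  assumes "left_ideal J" "\<And>i. i < k \<Longrightarrow> a i \<in> J"
  shows "(\<lambda>g. \<Sum>i<k. c i * a i g) \<in> J"
  using assms(2)
proof (induction k)
  case 0
  then show ?case using assms(1) by (simp add: left_ideal_def)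
next
  case (Suc k)
  then have "(\<lambda>g. \<Sum>i<k. c i * a i g) \<in> J" "(\<lambda>g. c k * a k g) \<in> J"
    using assms(1) by (auto simp: left_ideal_def)
  moreover have "\<forall>a\<in>J. \<forall>b\<in>J. (\<lambda>g. a g + b g) \<in> J"
    using assms(1) by (simp add: left_ideal_def)
  ultimately show ?case by simp
qed

lemma ga_act_sum_vec_index:
  fixes k :: nat
  assumes "is_gmod G M" "u \<in> carrier_vec (gdim M)" "r < gdim M"
  shows "vec_index (ga_act M (\<lambda>g. \<Sum>i<k. c i * a i g) *\<^sub>v u) r
    = (\<Sum>i<k. c i * vec_index (ga_act M (a i) *\<^sub>v u) r)"
proof -
  have "vec_index (ga_act M (\<lambda>g. \<Sum>i<k. c i * a i g) *\<^sub>v u) r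
      = (\<Sum>g\<in>carrier G. \<Sum>i<k. c i * (a i g * vec_index (gact M g *\<^sub>v u) r))"
    unfolding ga_act_vec_index[OF assms] by (simp add: sum_distrib_right mult.assoc)
  also have "\<dots> = (\<Sum>i<k. c i * vec_index (ga_act M (a i) *\<^sub>v u) r)"
    unfolding ga_act_vec_index[OF assms] by (subst sum.swap) (simp add: sum_distrib_left)
  finally show ?thesis .
qed

text \<open>This is the induction step of the density theorem. As the elements of \<open>J\<close> that annihilate \<open>m\<close>
  also annihilate \<open>u\<close>, the map \<open>a m \<mapsto> a u\<close> with \<open>a \<in> J\<close> is well defined. Its domain \<open>J m\<close> is a
  submodule of the simple module \<open>M\<close>, so it is zero or all of \<open>M\<close>.\<close>

lemma left_ideal_annihilator_hom:
  fixes M V :: "('a, 'f::field) gmod"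
  assumes J: "left_ideal J" and M: "simple_gmod G M" and m: "m \<in> carrier_vec (gdim M)"
    and V: "is_gmod G V" and u: "u \<in> carrier_vec (gdim V)"
    and ann: "J \<inter> annihilator M m \<subseteq> annihilator V u"
  obtains T where "T \<in> gmod_hom G M V" "\<And>a. a \<in> J \<Longrightarrow> ga_act V a *\<^sub>v u = T *\<^sub>v (ga_act M a *\<^sub>v m)"
proof (cases "\<forall>a\<in>J. a \<in> annihilator M m")
  case True
  have "0\<^sub>m (gdim V) (gdim M) \<in> gmod_hom G M V"
    unfolding gmod_hom_def
    using left_mult_zero_mat[OF gactD(1)[OF simple_gmodD(1)[OF M]]] right_mult_zero_mat[OF gactD(1)[OF V]]
    by simp
  moreover have "ga_act V a *\<^sub>v u = 0\<^sub>m (gdim V) (gdim M) *\<^sub>v (ga_act M a *\<^sub>v m)" if "a \<in> J" for a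
  proof -
    have "ga_act V a *\<^sub>v u = 0\<^sub>v (gdim V)" "ga_act M a *\<^sub>v m = 0\<^sub>v (gdim M)"
      using True ann that by (auto simp: annihilator_def)
    then show ?thesis by (simp add: zero_mat_mult_vec)
  qed
  ultimately show ?thesis using that by blast
next
  case False
  note M' = simple_gmodD[OF M]
  let ?n = "gdim M"
  have surj: "(\<lambda>a. ga_act M a *\<^sub>v m) ` J = carrier_vec ?n"
    using False by (intro M'(3)[OF gmod_sub_left_ideal_mult_vec[OF J M'(1) m]]) (auto simp: annihilator_def)
  then have "\<forall>i<?n. \<exists>a\<in>J. ga_act M a *\<^sub>v m = unit_vec ?n i"
    by (metis (no_types, lifting) imageE unit_vec_carrier)
  then obtain e where e: "\<And>i. i < ?n \<Longrightarrow> e i \<in> J" "\<And>i. i < ?n \<Longrightarrow> ga_act M (e i) *\<^sub>v m = unit_vec ?n i"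
    by metis
  \<comment> \<open>The matrix of \<open>a m \<mapsto> a u\<close>: the unit vectors are \<open>e i\<close> applied to \<open>m\<close>.\<close>
  define T where "T = mat (gdim V) ?n (\<lambda>(r, i). vec_index (ga_act V (e i) *\<^sub>v u) r)"
  have Tc: "T \<in> carrier_mat (gdim V) ?n" unfolding T_def by simp
  have T: "ga_act V a *\<^sub>v u = T *\<^sub>v (ga_act M a *\<^sub>v m)" if a: "a \<in> J" for a
  proof -
    define c where "c = ga_act M a *\<^sub>v m"
    have cc: "c \<in> carrier_vec ?n" unfolding c_def using m by (rule mult_mat_vec_carrier[OF ga_act_carrier])
    \<comment> \<open>\<open>b\<close> is in the span of the \<open>e i\<close>, where \<open>T\<close> has the right values by construction, and
      \<open>a - b\<close> annihilates \<open>m\<close>, hence also \<open>u\<close>.\<close>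
    define b where "b = (\<lambda>g. \<Sum>i<?n. vec_index c i * e i g)"
    have b: "b \<in> J" unfolding b_def using left_ideal_sum[OF J, of ?n e] e(1) by blast
    have bm: "ga_act M b *\<^sub>v m = c"
    proof (rule eq_vecI)
      fix r assume "r < dim_vec c"
      then have r: "r < ?n" using cc by simp
      have "vec_index (ga_act M b *\<^sub>v m) r = (\<Sum>i<?n. vec_index c i * vec_index (unit_vec ?n i) r)"
        unfolding b_def ga_act_sum_vec_index[OF M'(1) m r] using e(2) by (intro sum.cong) auto
      also have "\<dots> = (\<Sum>i<?n. if i = r then vec_index c i else 0)"
        using r by (intro sum.cong) auto
      finally show "vec_index (ga_act M b *\<^sub>v m) r = vec_index c r" using r by simp
    qed (use cc in auto)
    have bu: "ga_act V b *\<^sub>v u = T *\<^sub>v c"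
    proof (rule eq_vecI)
      fix r assume "r < dim_vec (T *\<^sub>v c)"
      then have r: "r < gdim V" using Tc by simp
      have "vec_index (ga_act V b *\<^sub>v u) r = (\<Sum>i<?n. vec_index c i * vec_index (ga_act V (e i) *\<^sub>v u) r)"
        unfolding b_def by (rule ga_act_sum_vec_index[OF V u r])
      also have "\<dots> = (\<Sum>i<?n. T $$ (r, i) * vec_index c i)"
        using r by (intro sum.cong) (auto simp: T_def mult.commute simp del: index_mult_mat_vec)
      also have "\<dots> = vec_index (T *\<^sub>v c) r"
        using r Tc cc by (simp add: scalar_prod_def atLeast0LessThan)
      finally show "vec_index (ga_act V b *\<^sub>v u) r = vec_index (T *\<^sub>v c) r" .
    qed (use Tc in auto)
    define d where "d = (\<lambda>g. a g + (\<lambda>g. - 1 * b g) g)"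
    have neg: "(\<lambda>g. - 1 * b g) \<in> J" and add: "\<forall>a\<in>J. \<forall>b\<in>J. (\<lambda>g. a g + b g) \<in> J"
      using J b unfolding left_ideal_def by blast+
    have dJ: "d \<in> J"
      unfolding d_def using bspec[OF bspec[OF add a] neg] .
    have diff: "ga_act L d *\<^sub>v w = ga_act L a *\<^sub>v w - ga_act L b *\<^sub>v w"
      if "is_gmod G L" "w \<in> carrier_vec (gdim L)" for L :: "('a, 'f) gmod" and w
      unfolding d_def ga_act_add[OF that] ga_act_smult[OF that]
      by (intro eq_vecI) (auto simp del: index_mult_mat_vec)
    have "ga_act M d *\<^sub>v m = 0\<^sub>v ?n"
      unfolding diff[OF M'(1) m] bm using cc by (simp add: c_def)
    then have "ga_act V d *\<^sub>v u = 0\<^sub>v (gdim V)"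
      using ann dJ unfolding annihilator_def by blast
    then have "ga_act V a *\<^sub>v u - T *\<^sub>v c = 0\<^sub>v (gdim V)"
      unfolding diff[OF V u] bu .
    then show ?thesis
      unfolding c_def[symmetric]
      by (intro eq_vecI) (use Tc in \<open>auto simp: vec_eq_iff simp del: index_mult_mat_vec\<close>)
  qed
  have "T * gact M h = gact V h * T" if h: "h \<in> carrier G" for h
  proof (rule mat_eqI_mult_vec)
    note c = gactD(1)[OF M'(1) h] gactD(1)[OF V h]
    show "T * gact M h \<in> carrier_mat (gdim V) ?n" "gact V h * T \<in> carrier_mat (gdim V) ?n"
      using Tc c by auto
    fix w :: "'f vec" assume w: "w \<in> carrier_vec ?n"
    then obtain a where a: "a \<in> J" "w = ga_act M a *\<^sub>v m"
      using surj by (metis (no_types, lifting) imageE)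
    let ?ha = "\<lambda>g. a (inv h \<otimes> g)"
    have ha: "?ha \<in> J" using J a h by (simp add: left_ideal_def)
    have "T * gact M h *\<^sub>v w = T *\<^sub>v (gact M h *\<^sub>v w)"
      by (rule assoc_mult_mat_vec[OF Tc c(1) w])
    also have "gact M h *\<^sub>v w = ga_act M ?ha *\<^sub>v m"
      unfolding a(2) by (rule ga_act_translate[OF M'(1) m h, symmetric])
    also have "T *\<^sub>v \<dots> = ga_act V ?ha *\<^sub>v u"
      by (rule T[OF ha, symmetric])
    also have "\<dots> = gact V h *\<^sub>v (T *\<^sub>v w)"
      unfolding ga_act_translate[OF V u h] T[OF a(1)] a(2) ..
    also have "\<dots> = gact V h * T *\<^sub>v w"
      by (rule assoc_mult_mat_vec[OF c(2) Tc w, symmetric])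
    finally show "T * gact M h *\<^sub>v w = gact V h * T *\<^sub>v w" .
  qed
  then have "T \<in> gmod_hom G M V"
    unfolding gmod_hom_def using Tc by auto
  then show ?thesis using T that by blast
qed

fun common_annihilator :: "('a, 'f::field) gmod \<Rightarrow> 'f vec list \<Rightarrow> ('a \<Rightarrow> 'f) set \<Rightarrow> ('a \<Rightarrow> 'f) set" where
  "common_annihilator M [] J = J"
| "common_annihilator M (v # vs) J = common_annihilator M vs J \<inter> annihilator M v"

lemma left_ideal_common_annihilator:
  assumes "left_ideal J" "is_gmod G M" "set vs \<subseteq> carrier_vec (gdim M)"
  shows "left_ideal (common_annihilator M vs J)"
  using assms(3) by (induction vs) (auto simp: assms left_ideal_Int_annihilator)

lemma common_annihilatorD:
  "a \<in> common_annihilator M vs J \<Longrightarrow> a \<in> J \<and> (\<forall>v\<in>set vs. ga_act M a *\<^sub>v v = 0\<^sub>v (gdim M))"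
  by (induction vs) (auto simp: annihilator_def)

text \<open>Each vector of \<open>W\<close> gives a homomorphism from \<open>W\<close> to \<open>V\<close>, which vanishes by Schur's lemma. So
  the annihilator of finitely many vectors of \<open>W\<close> annihilates no more of \<open>V\<close> than the whole group
  algebra does.\<close>

lemma annihilator_of_non_isomorphic_faithful:
  assumes V: "simple_gmod G V" and W: "simple_gmod G W" and niso: "\<not> gmod_iso W V"
    and ws: "set ws \<subseteq> carrier_vec (gdim W)"
    and u: "u \<in> carrier_vec (gdim V)" and ann: "common_annihilator W ws UNIV \<subseteq> annihilator V u"
  shows "u = 0\<^sub>v (gdim V)"
  using ws ann
proof (induction ws)
  case Nil
  then have "(\<lambda>g. if g = \<one> then 1 else 0) \<in> annihilator V u" by auto
  then show ?case
    using ga_act_delta[OF simple_gmodD(1)[OF V] u one_closed] u gactD(3)[OF simple_gmodD(1)[OF V]]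
    by (simp add: annihilator_def)
next
  case (Cons w ws)
  let ?J = "common_annihilator W ws UNIV"
  have J: "left_ideal ?J"
    using left_ideal_common_annihilator[OF left_ideal_UNIV simple_gmodD(1)[OF W], of ws] Cons.prems by simp
  have w: "w \<in> carrier_vec (gdim W)" using Cons.prems by simp
  obtain T where T: "T \<in> gmod_hom G W V" "\<And>a. a \<in> ?J \<Longrightarrow> ga_act V a *\<^sub>v u = T *\<^sub>v (ga_act W a *\<^sub>v w)"
    by (rule left_ideal_annihilator_hom[OF J W w simple_gmodD(1)[OF V] u]) (use Cons.prems in auto)
  have "T = 0\<^sub>m (gdim V) (gdim W)"
    using nonzero_hom_of_simple[OF W V T(1)] niso by blast
  then have "ga_act V a *\<^sub>v u = 0\<^sub>v (gdim V)" if "a \<in> ?J" for a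
    using T(2)[OF that] mult_mat_vec_carrier[OF ga_act_carrier w] by (metis zero_mat_mult_vec)
  then have "?J \<subseteq> annihilator V u" by (auto simp: annihilator_def)
  with Cons show ?case by simp
qed

text \<open>Over a splitting field the homomorphism that belongs to a vector \<open>v\<close> of \<open>V\<close> is a scalar \<open>c\<close>, and
  the induction continues with \<open>u - c v\<close>. It would show that \<open>u\<close> is in the span of \<open>vs\<close>. The
  coordinate \<open>0\<close>, a linear form that vanishes on \<open>vs\<close>, is the part of this that is used below.\<close>

lemma annihilator_separates_coordinate:
  fixes V W :: "('a, 'f::field) gmod"
  assumes split: "splitting_field G TYPE('f)"
    and V: "simple_gmod G V" and W: "simple_gmod G W" and niso: "\<not> gmod_iso W V"
    and ws: "set ws \<subseteq> carrier_vec (gdim W)"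
    and vs: "set vs \<subseteq> {v \<in> carrier_vec (gdim V). vec_index v 0 = 0}"
    and u: "u \<in> carrier_vec (gdim V)"
    and ann: "common_annihilator V vs (common_annihilator W ws UNIV) \<subseteq> annihilator V u"
  shows "vec_index u 0 = 0"
  using vs u ann
proof (induction vs arbitrary: u)
  case Nil
  then show ?case
    using annihilator_of_non_isomorphic_faithful[OF V W niso ws, of u] simple_gmodD(2)[OF V] by simp
next
  case (Cons v vs)
  let ?J = "common_annihilator V vs (common_annihilator W ws UNIV)"
  note V' = simple_gmodD[OF V]
  have J: "left_ideal ?J"
    using left_ideal_common_annihilator[OF left_ideal_UNIV simple_gmodD(1)[OF W] ws]
      left_ideal_common_annihilator[OF _ V'(1), of _ vs] Cons.prems by auto
  have v: "v \<in> carrier_vec (gdim V)" "vec_index v 0 = 0" using Cons.prems by auto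
  obtain T where T: "T \<in> gmod_hom G V V" "\<And>a. a \<in> ?J \<Longrightarrow> ga_act V a *\<^sub>v u = T *\<^sub>v (ga_act V a *\<^sub>v v)"
    by (rule left_ideal_annihilator_hom[OF J V v(1) V'(1) Cons.prems(2)]) (use Cons.prems in auto)
  obtain c where c: "T = c \<cdot>\<^sub>m 1\<^sub>m (gdim V)"
    using T(1) split V unfolding splitting_field_def by blast
  have "u - c \<cdot>\<^sub>v v \<in> carrier_vec (gdim V)" using Cons.prems v by auto
  moreover have "ga_act V a *\<^sub>v (u - c \<cdot>\<^sub>v v) = 0\<^sub>v (gdim V)" if a: "a \<in> ?J" for a
  proof -
    have av: "ga_act V a *\<^sub>v v \<in> carrier_vec (gdim V)"
      by (rule mult_mat_vec_carrier[OF ga_act_carrier v(1)])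
    have "ga_act V a *\<^sub>v u = c \<cdot>\<^sub>v (ga_act V a *\<^sub>v v)"
      unfolding T(2)[OF a] c using smult_mult_mat_vec[OF one_carrier_mat av] av by simp
    also have "\<dots> = ga_act V a *\<^sub>v (c \<cdot>\<^sub>v v)"
      using mult_mat_vec[OF ga_act_carrier v(1)] by simp
    finally show ?thesis
      using mult_mat_vec_diff[OF ga_act_carrier Cons.prems(2), of "c \<cdot>\<^sub>v v"] v
        minus_cancel_vec[OF mult_mat_vec_carrier[OF ga_act_carrier smult_carrier_vec[THEN iffD2, OF v(1)]]]
      by simp
  qed
  ultimately have "vec_index (u - c \<cdot>\<^sub>v v) 0 = 0"
    using Cons.IH[of "u - c \<cdot>\<^sub>v v"] Cons.prems(1) by (auto simp: annihilator_def)
  then show ?case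
    using v Cons.prems(2) V'(2) by simp
qed

text \<open>If \<open>V\<close> and \<open>W\<close> are not isomorphic, then some element of the group algebra acts as \<open>0\<close> on \<open>W\<close>, and on
  \<open>V\<close> it fixes the first basis vector and annihilates the other ones. Its traces on \<open>V\<close> and \<open>W\<close> are
  \<open>1\<close> and \<open>0\<close>, but they are the same linear combination of traces of group elements.\<close>

theorem simple_gmod_iso_of_equal_traces:
  fixes V W :: "('a, 'f::field) gmod"
  assumes split: "splitting_field G TYPE('f)"
    and V: "simple_gmod G V" and W: "simple_gmod G W"
    and tr: "\<And>g. g \<in> carrier G \<Longrightarrow> mtrace (gact V g) = mtrace (gact W g)"
  shows "gmod_iso W V"
proof (rule ccontr)
  assume niso: "\<not> gmod_iso W V"
  note V' = simple_gmodD[OF V] and W' = simple_gmodD[OF W]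
  let ?n = "gdim V"
  define ws :: "'f vec list" where "ws = map (unit_vec (gdim W)) [0..<gdim W]"
  define vs :: "'f vec list" where "vs = map (unit_vec ?n) [1..<?n]"
  have ws: "set ws \<subseteq> carrier_vec (gdim W)" unfolding ws_def by auto
  have vs: "set vs \<subseteq> {v \<in> carrier_vec ?n. vec_index v 0 = 0}" unfolding vs_def by auto
  define J where "J = common_annihilator V vs (common_annihilator W ws UNIV)"
  have "set vs \<subseteq> carrier_vec ?n" using vs by blast
  then have J: "left_ideal J"
    unfolding J_def
    by (intro left_ideal_common_annihilator[OF left_ideal_common_annihilator[OF left_ideal_UNIV W'(1) ws] V'(1)])
  let ?e = "unit_vec ?n 0 :: 'f vec"
  have e: "?e \<in> carrier_vec ?n" by simp
  have "\<not> J \<subseteq> annihilator V ?e"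
  proof
    assume "J \<subseteq> annihilator V ?e"
    from annihilator_separates_coordinate[OF split V W niso ws vs e this[unfolded J_def]]
    show False using V'(2) by simp
  qed
  then obtain b where "b \<in> J" "ga_act V b *\<^sub>v ?e \<noteq> 0\<^sub>v ?n"
    unfolding annihilator_def by blast
  then have "(\<lambda>a. ga_act V a *\<^sub>v ?e) ` J \<noteq> {0\<^sub>v ?n}" by blast
  from V'(3)[OF gmod_sub_left_ideal_mult_vec[OF J V'(1) e] this]
  have "?e \<in> (\<lambda>a. ga_act V a *\<^sub>v ?e) ` J" using e by (simp only:)
  then obtain a where a: "a \<in> J" and e_a: "?e = ga_act V a *\<^sub>v ?e" by (elim imageE) (rule that)
  have diag: "ga_act M a $$ (j, j) = vec_index (ga_act M a *\<^sub>v unit_vec (gdim M) j) j"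
    if "j < gdim M" for M :: "('a, 'f) gmod" and j
    unfolding mult_mat_unit_vec[OF ga_act_carrier that] using that by (simp del: index_mult_mat_vec)
  have aW: "a \<in> common_annihilator W ws UNIV"
    using common_annihilatorD[OF a[unfolded J_def]] by blast
  have "ga_act W a *\<^sub>v unit_vec (gdim W) j = 0\<^sub>v (gdim W)" if "j < gdim W" for j
  proof -
    have "unit_vec (gdim W) j \<in> set ws" using that unfolding ws_def by simp
    then show ?thesis using common_annihilatorD[OF aW] by blast
  qed
  then have "ga_act W a $$ (j, j) = 0" if "j < gdim W" for j
    using that diag[OF that] by simp
  then have trW: "mtrace (ga_act W a) = 0" unfolding mtrace_def by simp
  have "ga_act V a *\<^sub>v unit_vec ?n j = 0\<^sub>v ?n" if "j < ?n" "j \<noteq> 0" for j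
  proof -
    have "unit_vec ?n j \<in> set vs" using that unfolding vs_def by simp
    then show ?thesis using common_annihilatorD[OF a[unfolded J_def]] by blast
  qed
  then have "ga_act V a $$ (j, j) = (if j = 0 then 1 else 0)" if "j < ?n" for j
    using that e_a[symmetric] diag[OF that] by (cases "j = 0") simp_all
  then have "mtrace (ga_act V a) = (\<Sum>j<?n. if j = 0 then 1 else 0)"
    unfolding mtrace_def by simp
  then have "mtrace (ga_act V a) = 1" using V'(2) by simp
  moreover have "mtrace (ga_act V a) = mtrace (ga_act W a)"
    unfolding mtrace_ga_act[OF V'(1)] mtrace_ga_act[OF W'(1)] using tr by simp
  ultimately show False using trW by simp
qed

end

section \<open>Brauer characters\<close>

locale brauer_setup = finite_group_modules G + reduction_extension v p red rbar
  for G :: "('a, 'b) monoid_scheme" (structure)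
    and v :: "'k::field_char_0 \<Rightarrow> int" and p :: nat and red :: "'k \<Rightarrow> 'f::field"
    and rbar :: "'k alg_closure \<Rightarrow> 'f alg_closure" +
  assumes splitting: "splitting_field G TYPE('f)"
begin

abbreviation bchar :: "('a, 'f) gmod \<Rightarrow> 'a \<Rightarrow> 'k alg_closure" where
  "bchar \<equiv> brauer_char G p rbar"

abbreviation eigenvalues :: "('a, 'f) gmod \<Rightarrow> 'a \<Rightarrow> 'f alg_closure multiset" where
  "eigenvalues M g \<equiv> proots (char_poly (map_mat to_ac (gact M g)))"

lemma to_ac_field_hom: "field_hom (to_ac :: 'f \<Rightarrow> 'f alg_closure)"
  by unfold_locales auto

lemma p_regularD:
  assumes "g \<in> p_regular G p (carrier G)"
  shows "g \<in> carrier G" "ord g > 0" "coprime (ord g) p"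
  using assms ord_ge_1[OF finite_carrier] unfolding p_regular_def by (auto simp: Suc_le_eq)

lemma ac_mat_carrier:
  assumes "is_gmod G M" "g \<in> carrier G"
  shows "map_mat to_ac (gact M g) \<in> carrier_mat (gdim M) (gdim M)"
  using gactD(1)[OF assms] by simp

lemma ac_mat_pow:
  fixes M :: "('a, 'f) gmod"
  assumes "is_gmod G M" "g \<in> carrier G"
  shows "map_mat to_ac (gact M (g [^] (k::nat))) = map_mat to_ac (gact M g) ^\<^sub>m k"
proof -
  interpret h: field_hom "to_ac :: 'f \<Rightarrow> 'f alg_closure" by (rule to_ac_field_hom)
  show ?thesis
    unfolding gact_pow[OF assms] by (rule h.mat_hom_pow[OF gactD(1)[OF assms]])
qed

lemma eigenvalue_power_ord:
  assumes "is_gmod G M" "g \<in> carrier G" "a \<in># eigenvalues M g" "g [^] (k::nat) = \<one>"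
  shows "a ^ k = 1"
proof (rule eigenvalue_root_of_unity[OF ac_mat_carrier[OF assms(1,2)] _ assms(3)])
  interpret h: field_hom "to_ac :: 'f \<Rightarrow> 'f alg_closure" by (rule to_ac_field_hom)
  show "map_mat to_ac (gact M g) ^\<^sub>m k = 1\<^sub>m (gdim M)"
    unfolding ac_mat_pow[OF assms(1,2), symmetric] assms(4) gactD(3)[OF assms(1)]
    by (rule h.mat_hom_one)
qed

lemma bchar_eq:
  assumes "g \<in> p_regular G p (carrier G)"
  shows "bchar M g = (\<Sum>a\<in>#eigenvalues M g. root_lift p rbar a)"
  using assms unfolding brauer_char_def by simp

lemma sum_eigenvalues:
  assumes "is_gmod G M" "g \<in> carrier G"
  shows "\<Sum>\<^sub># (eigenvalues M g) = to_ac (mtrace (gact M g))"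
  unfolding sum_proots_char_poly[OF ac_mat_carrier[OF assms]]
  using gactD(1)[OF assms] by (simp add: mtrace_def to_ac_sum)

lemma rbar_bchar:
  assumes "is_gmod G M" "g \<in> p_regular G p (carrier G)"
  shows "rbar (bchar M g) = to_ac (mtrace (gact M g))"
proof -
  note g = p_regularD[OF assms(2)]
  show ?thesis
    unfolding bchar_eq[OF assms(2)] sum_eigenvalues[OF assms(1) g(1), symmetric]
    by (rule rbar_sum_root_lift[OF g(2,3)]) (rule eigenvalue_power_ord[OF assms(1) g(1)], use g in auto)
qed

lemma bchar_twist:
  assumes \<chi>: "linear_char \<chi>" and M: "is_gmod G M" and g: "g \<in> p_regular G p (carrier G)"
  shows "bchar (twist \<chi> M) g = root_lift p rbar (to_ac (\<chi> g)) * bchar M g"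
proof -
  interpret h: field_hom "to_ac :: 'f \<Rightarrow> 'f alg_closure" by (rule to_ac_field_hom)
  note g' = p_regularD[OF g]
  have "map_mat to_ac (gact (twist \<chi> M) g) = to_ac (\<chi> g) \<cdot>\<^sub>m map_mat to_ac (gact M g)"
    by (intro eq_matI) auto
  then have ev: "eigenvalues (twist \<chi> M) g = image_mset ((*) (to_ac (\<chi> g))) (eigenvalues M g)"
    using proots_char_poly_smult[OF ac_mat_carrier[OF M g'(1)]] by simp
  have "\<chi> g ^ ord g = 1"
    using linear_char_pow[OF \<chi> g'(1), of "ord g"] g' \<chi> by (simp add: linear_char_def)
  then have c: "to_ac (\<chi> g) ^ ord g = 1" by (metis to_ac_1 to_ac_power)
  have "bchar (twist \<chi> M) g = (\<Sum>a\<in>#eigenvalues M g. root_lift p rbar (to_ac (\<chi> g) * a))"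
    unfolding bchar_eq[OF g] ev by (simp add: image_mset.compositionality o_def)
  also have "\<dots> = (\<Sum>a\<in>#eigenvalues M g. root_lift p rbar (to_ac (\<chi> g)) * root_lift p rbar a)"
    by (intro arg_cong[where f = sum_mset] image_mset_cong root_lift_mult[OF g'(2,3) c]
        eigenvalue_power_ord[OF M g'(1)]) (use g' in auto)
  also have "\<dots> = root_lift p rbar (to_ac (\<chi> g)) * bchar M g"
    unfolding bchar_eq[OF g] by (simp add: sum_mset_distrib_left image_mset.compositionality o_def)
  finally show ?thesis .
qed

lemma bchar_iso:
  assumes M: "is_gmod G M" and N: "is_gmod G N" and iso: "gmod_iso M N"
  shows "bchar M = bchar N"
proof -
  interpret h: field_hom "to_ac :: 'f \<Rightarrow> 'f alg_closure" by (rule to_ac_field_hom)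
  obtain T S where T: "T \<in> gmod_hom G M N" and S: "S \<in> gmod_hom G N M"
    and ST: "S * T = 1\<^sub>m (gdim M)" "T * S = 1\<^sub>m (gdim N)"
    using iso unfolding gmod_iso_def by auto
  note T' = gmod_homD[OF T] and S' = gmod_homD[OF S]
  have "gdim M \<le> gdim N" "gdim N \<le> gdim M"
    using injective_mat_dim_le left_inverse_injective_mat T' S' ST by metis+
  then have n: "gdim N = gdim M" by simp
  have "char_poly (map_mat to_ac (gact M g)) = char_poly (map_mat to_ac (gact N g))"
    if g: "g \<in> carrier G" for g
  proof -
    note c = gactD(1)[OF M g] gactD(1)[OF N g]
    have "S * gact N g * T = S * (gact N g * T)"
      by (rule assoc_mult_mat[OF S'(1) c(2) T'(1)])
    also have "\<dots> = S * T * gact M g"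
      unfolding T'(2)[OF g, symmetric] by (rule assoc_mult_mat[OF S'(1) T'(1) c(1), symmetric])
    finally have "gact M g = S * gact N g * T"
      using ST c by simp
    then have "similar_mat (gact M g) (gact N g)"
      by (intro similar_matI[where n = "gdim M" and P = S and Q = T]) (use c S' T' ST n in auto)
    then have "char_poly (gact M g) = char_poly (gact N g)"
      by (rule char_poly_similar)
    then show ?thesis
      using h.char_poly_hom[OF c(1)] h.char_poly_hom[OF c(2)] by simp
  qed
  then show ?thesis
    unfolding brauer_char_def by (auto simp: p_regular_def restrict_def)
qed

text \<open>Let the order of \<open>g\<close> be \<open>q * m\<close> with \<open>q\<close> a power of \<open>p\<close> and \<open>m\<close> prime to \<open>p\<close>. In characteristic
  \<open>p\<close> there are no nontrivial \<open>q\<close>-th roots of unity, so every eigenvalue \<open>a\<close> of \<open>g\<close> satisfies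
  \<open>a\<^sup>m = 1\<close>. The exponent \<open>s\<close> is chosen divisible by \<open>q\<close>, which makes \<open>g\<^sup>s\<close> regular, and congruent to
  \<open>1\<close> modulo \<open>m\<close>, which gives \<open>a\<^sup>s = a\<close>.\<close>

lemma mtrace_p_regular_part:
  assumes g: "g \<in> carrier G"
  obtains s :: nat where "g [^] s \<in> p_regular G p (carrier G)"
    "\<And>M :: ('a, 'f) gmod. is_gmod G M \<Longrightarrow> mtrace (gact M (g [^] s)) = mtrace (gact M g)"
proof -
  have N0: "ord g \<noteq> 0" using ord_ge_1[OF finite_carrier g] by simp
  obtain m where m: "ord g = p ^ multiplicity p (ord g) * m" "\<not> p dvd m"
    using multiplicity_decompose'[OF N0, of p] prime_p by (metis not_prime_unit)
  define q where "q = p ^ multiplicity p (ord g)"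
  have q0: "q \<noteq> 0" using prime_p unfolding q_def by (auto simp: prime_gt_0_nat)
  have "coprime m p" using m(2) prime_p by (metis coprime_commute prime_imp_coprime)
  then have "gcd q m = 1" unfolding q_def by (simp add: coprime_commute)
  then obtain x y where xy: "q * x = m * y + 1"
    using bezout_nat[OF q0, of m] by auto
  define s where "s = q * x"
  have "(g [^] s) [^] m = \<one>"
  proof -
    have "s * m = ord g * x" unfolding s_def m(1)[folded q_def] by simp
    then have "ord g dvd s * m" by simp
    then show ?thesis using g pow_eq_id[OF g, of "s * m"] by (simp add: nat_pow_pow)
  qed
  then have "ord (g [^] s) dvd m" using pow_eq_id[of "g [^] s" m] g by simp
  then have reg: "g [^] s \<in> p_regular G p (carrier G)"
    using coprime_divisors[OF _ dvd_refl \<open>coprime m p\<close>] g unfolding p_regular_def by simp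
  have "mtrace (gact M (g [^] s)) = mtrace (gact M g)" if M: "is_gmod G M" for M :: "('a, 'f) gmod"
  proof -
    have "a ^ s = a" if a: "a \<in># eigenvalues M g" for a
    proof -
      have "a ^ ord g = 1" by (rule eigenvalue_power_ord[OF M g a]) (use g in simp)
      then have "(a ^ m) ^ q = 1"
        using m(1)[folded q_def] by (simp add: power_mult[symmetric] mult.commute)
      moreover have "((a ^ m - 1) + 1) ^ q = (a ^ m - 1) ^ q + 1 ^ q"
        by (rule freshmans_dream'[of q "multiplicity p (ord g)"])
          (use prime_p char_residue_field in \<open>simp_all add: q_def\<close>)
      ultimately have "(a ^ m - 1) ^ q = 0" by simp
      then have "a ^ m = 1" by simp
      then show ?thesis unfolding s_def xy by (simp add: power_add power_mult)
    qed
    then have "image_mset (\<lambda>a. a ^ s) (eigenvalues M g) = image_mset (\<lambda>a. a) (eigenvalues M g)"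
      by (intro image_mset_cong)
    then have "eigenvalues M (g [^] s) = eigenvalues M g"
      unfolding ac_mat_pow[OF M g] proots_char_poly_pow_mat[OF ac_mat_carrier[OF M g]] by simp
    then have "to_ac (mtrace (gact M (g [^] s))) = to_ac (mtrace (gact M g))"
      using sum_eigenvalues[OF M] g by (metis nat_pow_closed)
    then show ?thesis by simp
  qed
  with reg that show ?thesis by blast
qed

text \<open>The reduction of a Brauer character is the trace on \<open>p\<close>-regular elements, and these determine all
  traces.\<close>

theorem simple_gmod_iso_of_equal_bchar:
  assumes V: "simple_gmod G V" and W: "simple_gmod G W" and eq: "bchar V = bchar W"
  shows "gmod_iso W V"
proof (rule simple_gmod_iso_of_equal_traces[OF splitting V W])
  fix g assume g: "g \<in> carrier G"
  obtain s :: nat where s: "g [^] s \<in> p_regular G p (carrier G)"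
    "\<And>M :: ('a, 'f) gmod. is_gmod G M \<Longrightarrow> mtrace (gact M (g [^] s)) = mtrace (gact M g)"
    by (rule mtrace_p_regular_part[OF g]) blast
  have "to_ac (mtrace (gact V (g [^] s))) = to_ac (mtrace (gact W (g [^] s)))"
    using rbar_bchar[OF simple_gmodD(1)[OF V] s(1)] rbar_bchar[OF simple_gmodD(1)[OF W] s(1)] eq by simp
  then show "mtrace (gact V g) = mtrace (gact W g)"
    using s(2) simple_gmodD(1)[OF V] simple_gmodD(1)[OF W] by simp
qed

end

section \<open>Projective covers\<close>

context finite_group_modules
begin

lemma gmod_epiD:
  assumes "T \<in> gmod_epi G M N"
  shows "T \<in> gmod_hom G M N" "mat_image T (carrier_vec (gdim M)) = carrier_vec (gdim N)"
  using assms unfolding gmod_epi_def by auto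

lemma projective_gmodD:
  assumes "projective_gmod G P"
  shows "is_gmod G P"
    and "is_gmod G Y \<Longrightarrow> is_gmod G Z \<Longrightarrow> S \<in> gmod_epi G Y Z \<Longrightarrow> T \<in> gmod_hom G P Z \<Longrightarrow>
      \<exists>R\<in>gmod_hom G P Y. S * R = T"
  using assms unfolding projective_gmod_def by blast+

text \<open>\<open>Q\<close> is the group algebra as a module over itself and \<open>e\<close> is its unit element. The conclusions
  say that \<open>Q\<close> is free on \<open>e\<close>.\<close>

lemma regular_gmod:
  obtains Q :: "('a, 'f::field) gmod" and e where "is_gmod G Q" "e \<in> carrier_vec (gdim Q)"
    "\<And>Y y. is_gmod G Y \<Longrightarrow> y \<in> carrier_vec (gdim Y) \<Longrightarrow> \<exists>R\<in>gmod_hom G Q Y. R *\<^sub>v e = y"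
    "\<And>Y R R'. is_gmod G Y \<Longrightarrow> R \<in> gmod_hom G Q Y \<Longrightarrow> R' \<in> gmod_hom G Q Y \<Longrightarrow>
       R *\<^sub>v e = R' *\<^sub>v e \<Longrightarrow> R = R'"
proof -
  define n where "n = card (carrier G)"
  obtain b where b: "bij_betw b {..<n} (carrier G)"
    using ex_bij_betw_nat_finite[OF finite_carrier] by (auto simp: n_def atLeast0LessThan)
  define b' where "b' = inv_into {..<n} b"
  have bc: "b i \<in> carrier G" if "i < n" for i
    using b that by (auto simp: bij_betw_def)
  have b'b: "b' (b i) = i" if "i < n" for i
    using bij_betw_inv_into_left[OF b] that by (simp add: b'_def)
  have bb': "b (b' g) = g" and b'n: "b' g < n" if "g \<in> carrier G" for g
    using bij_betw_inv_into_right[OF b that] bij_betwE[OF bij_betw_inv_into[OF b]] that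
    by (auto simp: b'_def)
  define \<pi> where "\<pi> g i = b' (g \<otimes> b i)" for g i
  obtain Q :: "('a, 'f) gmod" where Q: "is_gmod G Q" "gdim Q = n"
    and act: "\<And>g i. g \<in> carrier G \<Longrightarrow> i < n \<Longrightarrow> gact Q g *\<^sub>v unit_vec n i = unit_vec n (\<pi> g i)"
    by (rule permutation_gmod[of n \<pi>]) (auto simp: \<pi>_def bc b'n b'b bb' m_assoc)
  define e :: "'f vec" where "e = unit_vec n (b' \<one>)"
  have e: "e \<in> carrier_vec n" unfolding e_def by simp
  have ge: "gact Q (b i) *\<^sub>v e = unit_vec n i" if "i < n" for i
    unfolding e_def using act[OF bc[OF that] b'n[OF one_closed]] that
    by (simp add: \<pi>_def bb' bc b'b)
  have ext: "A = B" if "A \<in> carrier_mat m n" "B \<in> carrier_mat m n"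
    "\<And>i. i < n \<Longrightarrow> A *\<^sub>v unit_vec n i = B *\<^sub>v unit_vec n i" for A B :: "'f mat" and m
    by (rule mat_col_eqI) (use that mult_mat_unit_vec[OF that(1)] mult_mat_unit_vec[OF that(2)] in auto)
  have "\<exists>R\<in>gmod_hom G Q Y. R *\<^sub>v e = y"
    if Y: "is_gmod G Y" and y: "y \<in> carrier_vec (gdim Y)" for Y :: "('a, 'f) gmod" and y
  proof -
    define R where "R = mat (gdim Y) n (\<lambda>(r, i). vec_index (gact Y (b i) *\<^sub>v y) r)"
    have R: "R \<in> carrier_mat (gdim Y) n" unfolding R_def by simp
    have col: "R *\<^sub>v unit_vec n i = gact Y (b i) *\<^sub>v y" if i: "i < n" for i
      unfolding mult_mat_unit_vec[OF R i] using i gactD(1)[OF Y bc[OF i]]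
      by (intro eq_vecI) (auto simp: R_def simp del: index_mult_mat_vec)
    have "R * gact Q g = gact Y g * R" if g: "g \<in> carrier G" for g
    proof (rule ext)
      note c = gactD(1)[OF Q(1) g, unfolded Q(2)] gactD(1)[OF Y g]
      show "R * gact Q g \<in> carrier_mat (gdim Y) n" "gact Y g * R \<in> carrier_mat (gdim Y) n"
        using R c by auto
      fix i assume i: "i < n"
      have "R * gact Q g *\<^sub>v unit_vec n i = R *\<^sub>v unit_vec n (\<pi> g i)"
        unfolding assoc_mult_mat_vec[OF R c(1) unit_vec_carrier] act[OF g i] ..
      also have "\<dots> = gact Y (g \<otimes> b i) *\<^sub>v y"
        using col[of "\<pi> g i"] b'n[of "g \<otimes> b i"] bb'[of "g \<otimes> b i"] g bc[OF i] by (simp add: \<pi>_def)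
      also have "\<dots> = gact Y g *\<^sub>v (R *\<^sub>v unit_vec n i)"
        unfolding col[OF i] by (rule gact_mult_vec[OF Y g bc[OF i] y])
      also have "\<dots> = gact Y g * R *\<^sub>v unit_vec n i"
        by (rule assoc_mult_mat_vec[OF c(2) R unit_vec_carrier, symmetric])
      finally show "R * gact Q g *\<^sub>v unit_vec n i = gact Y g * R *\<^sub>v unit_vec n i" .
    qed
    then have "R \<in> gmod_hom G Q Y"
      unfolding gmod_hom_def using R Q(2) by simp
    moreover have "R *\<^sub>v e = y"
      unfolding e_def col[OF b'n[OF one_closed]] bb'[OF one_closed] gactD(3)[OF Y] using y by simp
    ultimately show ?thesis by blast
  qed
  moreover have "R = R'"
    if Y: "is_gmod G Y" and R: "R \<in> gmod_hom G Q Y" and R': "R' \<in> gmod_hom G Q Y"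
      and eq: "R *\<^sub>v e = R' *\<^sub>v e" for Y :: "('a, 'f) gmod" and R R'
  proof (rule ext)
    show "R \<in> carrier_mat (gdim Y) n" "R' \<in> carrier_mat (gdim Y) n"
      using gmod_homD(1)[OF R] gmod_homD(1)[OF R'] Q(2) by auto
    fix i assume i: "i < n"
    show "R *\<^sub>v unit_vec n i = R' *\<^sub>v unit_vec n i"
      using gmod_hom_mult_vec[OF Q(1) Y R bc[OF i], of e] gmod_hom_mult_vec[OF Q(1) Y R' bc[OF i], of e]
        eq e Q(2) ge[OF i] by simp
  qed
  ultimately show ?thesis
    using that[of Q e] Q e by simp
qed

lemma exists_projective_epi:
  fixes V :: "('a, 'f::field) gmod"
  assumes V: "simple_gmod G V"
  obtains Q T where "projective_gmod G Q" "T \<in> gmod_epi G Q V"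
proof -
  note V' = simple_gmodD[OF V]
  obtain Q :: "('a, 'f) gmod" and e where Q: "is_gmod G Q" "e \<in> carrier_vec (gdim Q)"
    and ex: "\<And>Y y. is_gmod G Y \<Longrightarrow> y \<in> carrier_vec (gdim Y) \<Longrightarrow> \<exists>R\<in>gmod_hom G Q Y. R *\<^sub>v e = y"
    and unique: "\<And>Y R R'. is_gmod G Y \<Longrightarrow> R \<in> gmod_hom G Q Y \<Longrightarrow> R' \<in> gmod_hom G Q Y \<Longrightarrow>
       R *\<^sub>v e = R' *\<^sub>v e \<Longrightarrow> R = R'"
    by (rule regular_gmod) blast
  have "projective_gmod G Q"
    unfolding projective_gmod_def
  proof (intro conjI allI impI ballI)
    fix Y Z :: "('a, 'f) gmod" and S T
    assume Y: "is_gmod G Y" and Z: "is_gmod G Z" and S: "S \<in> gmod_epi G Y Z" and T: "T \<in> gmod_hom G Q Z"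
    note S' = gmod_epiD[OF S]
    have "T *\<^sub>v e \<in> carrier_vec (gdim Z)"
      by (rule mult_mat_vec_carrier[OF gmod_homD(1)[OF T] Q(2)])
    then obtain y where y: "y \<in> carrier_vec (gdim Y)" "S *\<^sub>v y = T *\<^sub>v e"
      unfolding S'(2)[symmetric] by (metis imageE)
    obtain R where R: "R \<in> gmod_hom G Q Y" "R *\<^sub>v e = y" using ex[OF Y y(1)] by blast
    have "S * R = T"
    proof (rule unique[OF Z gmod_hom_mult[OF Q(1) Y Z S'(1) R(1)] T])
      show "S * R *\<^sub>v e = T *\<^sub>v e"
        unfolding assoc_mult_mat_vec[OF gmod_homD(1)[OF S'(1)] gmod_homD(1)[OF R(1)] Q(2)] R(2) y(2) ..
    qed
    with R(1) show "\<exists>R\<in>gmod_hom G Q Y. S * R = T" by blast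
  qed (rule Q(1))
  moreover obtain T where T: "T \<in> gmod_hom G Q V" "T *\<^sub>v e = unit_vec (gdim V) 0"
    using ex[OF V'(1), of "unit_vec (gdim V) 0"] by auto
  have "unit_vec (gdim V) 0 \<in> mat_image T (carrier_vec (gdim Q))"
    using T(2) Q(2) by (metis image_eqI)
  then have "mat_image T (carrier_vec (gdim Q)) \<noteq> {0\<^sub>v (gdim V)}"
    using unit_vec_nonzero[OF V'(2), where 'a = 'f] by (metis singletonD)
  then have "mat_image T (carrier_vec (gdim Q)) = carrier_vec (gdim V)"
    by (rule V'(3)[OF gmod_sub_image[OF Q(1) V'(1) T(1) gmod_sub_carrier[OF Q(1)]]])
  then have "T \<in> gmod_epi G Q V"
    using T(1) unfolding gmod_epi_def by simp
  ultimately show ?thesis using that by blast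
qed

lemma projective_gmod_retract:
  fixes P U :: "('a, 'f::field) gmod"
  assumes P: "projective_gmod G P" and U: "is_gmod G U"
    and I: "I \<in> gmod_hom G U P" and K: "K \<in> gmod_hom G P U" and KI: "K * I = 1\<^sub>m (gdim U)"
  shows "projective_gmod G U"
  unfolding projective_gmod_def
proof (intro conjI allI impI ballI)
  fix Y Z :: "('a, 'f) gmod" and S T
  assume Y: "is_gmod G Y" and Z: "is_gmod G Z" and S: "S \<in> gmod_epi G Y Z" and T: "T \<in> gmod_hom G U Z"
  note P' = projective_gmodD(1)[OF P]
  obtain R where R: "R \<in> gmod_hom G P Y" "S * R = T * K"
    using projective_gmodD(2)[OF P Y Z S gmod_hom_mult[OF P' U Z T K]] by blast
  note c = gmod_homD(1)[OF gmod_epiD(1)[OF S]] gmod_homD(1)[OF R(1)] gmod_homD(1)[OF I]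
    gmod_homD(1)[OF T] gmod_homD(1)[OF K]
  have "S * (R * I) = S * R * I" by (rule assoc_mult_mat[OF c(1-3), symmetric])
  also have "\<dots> = T * (K * I)" unfolding R(2) by (rule assoc_mult_mat[OF c(4,5,3)])
  also have "\<dots> = T" unfolding KI using c(4) by simp
  finally show "\<exists>R\<in>gmod_hom G U Y. S * R = T"
    using gmod_hom_mult[OF U P' Y R(1) I] by blast
qed (rule U)

text \<open>Let \<open>T\<close> map a projective module \<open>Q\<close> onto \<open>V\<close>, and let \<open>N\<close> be a submodule of \<open>Q\<close> of least
  dimension with \<open>T(N) = V\<close>. The restriction of \<open>T\<close> to \<open>N\<close> is an essential epimorphism. A lift \<open>R\<close> of
  \<open>T\<close> from \<open>Q\<close> to \<open>N\<close> is, by minimality, bijective on \<open>N\<close>. So \<open>N\<close> is a direct summand of \<open>Q\<close>, and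
  therefore it is projective.\<close>

lemma projective_cover_exists:
  fixes V :: "('a, 'f::field) gmod"
  assumes V: "simple_gmod G V"
  shows "\<exists>P. is_projective_cover G P V"
proof -
  note V' = simple_gmodD[OF V]
  obtain Q T where Q: "projective_gmod G Q" and T: "T \<in> gmod_epi G Q V"
    by (rule exists_projective_epi[OF V])
  note Q' = projective_gmodD(1)[OF Q] and T' = gmod_epiD[OF T]
  define good where "good k \<longleftrightarrow> (\<exists>N J. gdim N = k \<and> is_gmod G N \<and> J \<in> gmod_hom G N Q \<and>
    injective_mat J \<and> T * J \<in> gmod_epi G N V)" for k
  have "good (gdim Q)"
    unfolding good_def
  proof (intro exI conjI)
    show "injective_mat (1\<^sub>m (gdim Q) :: 'f mat)"
      by (rule left_inverse_injective_mat[of _ "gdim Q" "gdim Q" "1\<^sub>m (gdim Q)"]) auto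
    show "T * 1\<^sub>m (gdim Q) \<in> gmod_epi G Q V" using T gmod_homD(1)[OF T'(1)] by simp
  qed (use Q' gmod_hom_one[OF Q'] in simp_all)
  define k where "k = (LEAST k. good k)"
  have "good k" unfolding k_def by (rule LeastI[of good, OF \<open>good (gdim Q)\<close>])
  then obtain N J where N: "gdim N = k" "is_gmod G N" and J: "J \<in> gmod_hom G N Q" "injective_mat J"
    and TJ: "T * J \<in> gmod_epi G N V"
    unfolding good_def by blast
  note TJ' = gmod_epiD[OF TJ]
  note c = gmod_homD(1)[OF T'(1)] gmod_homD(1)[OF J(1)] gmod_homD(1)[OF TJ'(1)]
  \<comment> \<open>By minimality of the dimension of \<open>N\<close>, no proper submodule of \<open>N\<close> maps onto \<open>V\<close>.\<close>
  have ess: "U = carrier_vec (gdim N)"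
    if U: "gmod_sub G N U" and im: "mat_image (T * J) U = carrier_vec (gdim V)" for U
  proof -
    obtain L I where L: "is_gmod G L" "I \<in> gmod_hom G L N" "injective_mat I"
      "mat_image I (carrier_vec (gdim L)) = U"
      by (rule gmod_sub_as_gmod[OF N(2) U])
    note Ic = gmod_homD(1)[OF L(2)]
    have eq: "T * (J * I) = T * J * I" by (rule assoc_mult_mat[OF c(1,2) Ic, symmetric])
    have "mat_image (T * J * I) (carrier_vec (gdim L)) = carrier_vec (gdim V)"
      unfolding mat_image_mult[OF c(3) Ic subset_refl] L(4) im ..
    then have "T * (J * I) \<in> gmod_epi G L V"
      unfolding eq gmod_epi_def using gmod_hom_mult[OF L(1) N(2) V'(1) TJ'(1) L(2)] by simp
    then have "good (gdim L)"
      unfolding good_def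
      using L(1) gmod_hom_mult[OF L(1) N(2) Q' J(1) L(2)] injective_mat_mult[OF J(2) L(3) c(2) Ic]
      by blast
    then have "k \<le> gdim L" unfolding k_def by (rule Least_le)
    with injective_mat_dim_le[OF L(3) Ic] N(1) have "gdim L = gdim N" by simp
    then show ?thesis
      using injective_square_mat_surjective[OF L(3)] Ic L(4) by simp
  qed
  obtain R where R: "R \<in> gmod_hom G Q N" "T * J * R = T"
    using projective_gmodD(2)[OF Q N(2) V'(1) TJ T'(1)] by blast
  note Rc = gmod_homD(1)[OF R(1)]
  define A where "A = R * J"
  have A: "A \<in> gmod_hom G N N" unfolding A_def by (rule gmod_hom_mult[OF N(2) Q' N(2) R(1) J(1)])
  note Ac = gmod_homD(1)[OF A]
  have "T * J * A = T * J"
    unfolding A_def assoc_mult_mat[OF c(3) Rc c(2), symmetric] R(2) ..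
  then have "mat_image (T * J) (mat_image A (carrier_vec (gdim N))) = carrier_vec (gdim V)"
    using mat_image_mult[OF c(3) Ac subset_refl] TJ'(2) by simp
  then have "mat_image A (carrier_vec (gdim N)) = carrier_vec (gdim N)"
    by (rule ess[OF gmod_sub_image[OF N(2) N(2) A gmod_sub_carrier[OF N(2)]]])
  then obtain B where B: "B \<in> carrier_mat (gdim N) (gdim N)" "A * B = 1\<^sub>m (gdim N)" "B * A = 1\<^sub>m (gdim N)"
    using surjective_square_mat_inverse[OF Ac] by blast
  have "B * R \<in> gmod_hom G Q N"
    by (rule gmod_hom_mult[OF Q' N(2) N(2) gmod_hom_inverse[OF N(2) N(2) A B(1) B(3) B(2)] R(1)])
  moreover have "B * R * J = 1\<^sub>m (gdim N)"
    unfolding assoc_mult_mat[OF B(1) Rc c(2)] using B(3) by (simp add: A_def)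
  ultimately have "projective_gmod G N"
    by (rule projective_gmod_retract[OF Q N(2) J(1)])
  moreover have "T * J \<in> essential_epi G N V"
    unfolding essential_epi_def using TJ ess by blast
  ultimately show ?thesis
    unfolding is_projective_cover_def by blast
qed

lemma projective_cover_of_iso:
  assumes P: "is_projective_cover G P V" and V: "is_gmod G V" and W: "is_gmod G W" and iso: "gmod_iso V W"
  shows "is_projective_cover G P W"
proof -
  obtain T where T: "T \<in> essential_epi G P V" and P': "projective_gmod G P"
    using P unfolding is_projective_cover_def by auto
  then have Te: "T \<in> gmod_epi G P V" unfolding essential_epi_def by auto
  note T' = gmod_epiD[OF Te] and Pm = projective_gmodD(1)[OF P']
  obtain A B where A: "A \<in> gmod_hom G V W" and B: "B \<in> gmod_hom G W V"
    and AB: "B * A = 1\<^sub>m (gdim V)" "A * B = 1\<^sub>m (gdim W)"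
    using iso unfolding gmod_iso_def by auto
  note c = gmod_homD(1)[OF T'(1)] gmod_homD(1)[OF A] gmod_homD(1)[OF B]
  have "mat_image (A * T) (carrier_vec (gdim P)) = carrier_vec (gdim W)"
    unfolding mat_image_mult[OF c(2,1) subset_refl] T'(2)
    by (rule right_inverse_surjective_mat[OF c(2,3) AB(2)])
  then have "A * T \<in> gmod_epi G P W"
    unfolding gmod_epi_def using gmod_hom_mult[OF Pm V W A T'(1)] by simp
  moreover have "U = carrier_vec (gdim P)"
    if U: "gmod_sub G P U" and im: "mat_image (A * T) U = carrier_vec (gdim W)" for U
  proof -
    have Uc: "U \<subseteq> carrier_vec (gdim P)" using U unfolding gmod_sub_iff by blast
    have "mat_image B (mat_image (A * T) U) = mat_image (B * (A * T)) U"
      by (rule mat_image_mult[OF c(3) mult_carrier_mat[OF c(2,1)] Uc, symmetric])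
    also have "B * (A * T) = T"
      unfolding assoc_mult_mat[OF c(3,2,1), symmetric] AB(1) using c(1) by simp
    finally have "mat_image T U = mat_image B (carrier_vec (gdim W))" using im by simp
    also have "\<dots> = carrier_vec (gdim V)"
      by (rule right_inverse_surjective_mat[OF c(3,2) AB(1)])
    finally show ?thesis
      using T U unfolding essential_epi_def by simp
  qed
  ultimately have "A * T \<in> essential_epi G P W"
    unfolding essential_epi_def by simp
  with P' show ?thesis unfolding is_projective_cover_def by blast
qed

text \<open>A lift of one cover to the other is surjective, because its image maps onto \<open>V\<close> and the other
  cover is essential. This holds in both directions, so the dimensions agree and the lift is bijective.\<close>

lemma projective_cover_unique:
  assumes P: "is_projective_cover G P V" and Q: "is_projective_cover G Q V" and V: "is_gmod G V"
  shows "gmod_iso P Q"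
proof -
  have onto: "\<exists>R\<in>gmod_hom G M N. mat_image R (carrier_vec (gdim M)) = carrier_vec (gdim N)"
    if M: "is_projective_cover G M V" and N: "is_projective_cover G N V" for M N
  proof -
    obtain T where T: "T \<in> essential_epi G M V" and M': "projective_gmod G M"
      using M unfolding is_projective_cover_def by auto
    obtain S where S: "S \<in> essential_epi G N V" and N': "projective_gmod G N"
      using N unfolding is_projective_cover_def by auto
    have Te: "T \<in> gmod_epi G M V" and Se: "S \<in> gmod_epi G N V"
      using S T unfolding essential_epi_def by auto
    note Mm = projective_gmodD(1)[OF M'] and Nm = projective_gmodD(1)[OF N']
    obtain R where R: "R \<in> gmod_hom G M N" "S * R = T"
      using projective_gmodD(2)[OF M' Nm V Se gmod_epiD(1)[OF Te]] by blast
    have "mat_image S (mat_image R (carrier_vec (gdim M))) = carrier_vec (gdim V)"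
      unfolding mat_image_mult[OF gmod_homD(1)[OF gmod_epiD(1)[OF Se]] gmod_homD(1)[OF R(1)] subset_refl,
          symmetric] R(2)
      by (rule gmod_epiD(2)[OF Te])
    then have "mat_image R (carrier_vec (gdim M)) = carrier_vec (gdim N)"
      using S gmod_sub_image[OF Mm Nm R(1) gmod_sub_carrier[OF Mm]] unfolding essential_epi_def by simp
    with R(1) show ?thesis by blast
  qed
  have "projective_gmod G P" "projective_gmod G Q"
    using P Q unfolding is_projective_cover_def by simp_all
  note Pm = this[THEN projective_gmodD(1)]
  obtain R where R: "R \<in> gmod_hom G P Q" "mat_image R (carrier_vec (gdim P)) = carrier_vec (gdim Q)"
    using onto[OF P Q] by blast
  obtain R' where R': "R' \<in> gmod_hom G Q P" "mat_image R' (carrier_vec (gdim Q)) = carrier_vec (gdim P)"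
    using onto[OF Q P] by blast
  note c = gmod_homD(1)[OF R(1)]
  have dims: "gdim P = gdim Q"
    using surjective_mat_dim_le[OF c R(2)] surjective_mat_dim_le[OF gmod_homD(1)[OF R'(1)] R'(2)] by simp
  note c' = c[unfolded dims]
  obtain B where "B \<in> carrier_mat (gdim Q) (gdim Q)" "B * R = 1\<^sub>m (gdim Q)"
    by (rule surjective_square_mat_inverse[OF c' R(2)[unfolded dims]])
  then have "injective_mat R"
    by (rule left_inverse_injective_mat[OF c'])
  then show ?thesis
    by (rule bijective_hom_gmod_iso[OF Pm R(1) _ dims])
qed

lemma gmod_hom_twist_twist_inverse:
  assumes "linear_char \<chi>"
  shows "gmod_hom G M (twist \<chi> (twist (\<lambda>g. inverse (\<chi> g)) N)) = gmod_hom G M N"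
  unfolding gmod_hom_def using linear_char_nonzero[OF assms]
  by (auto simp: smult_smult_mat one_smult_mat)

lemma gmod_epi_twist:
  assumes "linear_char \<chi>" "is_gmod G M" "is_gmod G N"
  shows "gmod_epi G (twist \<chi> M) (twist \<chi> N) = gmod_epi G M N"
  unfolding gmod_epi_def gmod_hom_twist[OF assms] by simp

lemma projective_gmod_twist:
  fixes P :: "('a, 'f::field) gmod"
  assumes \<chi>: "linear_char \<chi>" and P: "projective_gmod G P"
  shows "projective_gmod G (twist \<chi> P)"
  unfolding projective_gmod_def
proof (intro conjI allI impI ballI)
  note Pm = projective_gmodD(1)[OF P]
  show "is_gmod G (twist \<chi> P)" by (rule is_gmod_twist[OF \<chi> Pm])
  fix Y Z :: "('a, 'f) gmod" and S T
  assume Y: "is_gmod G Y" and Z: "is_gmod G Z" and S: "S \<in> gmod_epi G Y Z"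
    and T: "T \<in> gmod_hom G (twist \<chi> P) Z"
  let ?\<psi> = "\<lambda>g. inverse (\<chi> g)"
  note \<psi> = linear_char_inverse[OF \<chi>]
  note Y' = is_gmod_twist[OF \<psi> Y] and Z' = is_gmod_twist[OF \<psi> Z]
  have "T \<in> gmod_hom G P (twist ?\<psi> Z)"
    using T gmod_hom_twist[OF \<chi> Pm Z'] gmod_hom_twist_twist_inverse[OF \<chi>] by blast
  then obtain R where R: "R \<in> gmod_hom G P (twist ?\<psi> Y)" "S * R = T"
    using projective_gmodD(2)[OF P Y' Z'] S gmod_epi_twist[OF \<psi> Y Z] by blast
  then have "R \<in> gmod_hom G (twist \<chi> P) Y"
    using gmod_hom_twist[OF \<chi> Pm Y'] gmod_hom_twist_twist_inverse[OF \<chi>] by blast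
  with R(2) show "\<exists>R\<in>gmod_hom G (twist \<chi> P) Y. S * R = T" by blast
qed

lemma projective_cover_twist:
  assumes \<chi>: "linear_char \<chi>" and P: "is_projective_cover G P V" and V: "is_gmod G V"
  shows "is_projective_cover G (twist \<chi> P) (twist \<chi> V)"
proof -
  have P': "projective_gmod G P" using P unfolding is_projective_cover_def by auto
  note Pm = projective_gmodD(1)[OF P']
  have "essential_epi G (twist \<chi> P) (twist \<chi> V) = essential_epi G P V"
    unfolding essential_epi_def gmod_epi_twist[OF \<chi> Pm V] gmod_sub_twist[OF \<chi> Pm] by simp
  then show ?thesis
    using P projective_gmod_twist[OF \<chi> P'] unfolding is_projective_cover_def by simp
qed

end

context brauer_setup
begin

lemma V_of:
  assumes "\<phi> \<in> IBr G p rbar"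
  shows "simple_gmod G (V_of G p rbar \<phi> :: ('a, 'f) gmod)" "bchar (V_of G p rbar \<phi>) = \<phi>"
proof -
  have "\<exists>V :: ('a, 'f) gmod. simple_gmod G V \<and> bchar V = \<phi>"
    using assms unfolding IBr_def by auto
  from someI_ex[OF this] show "simple_gmod G (V_of G p rbar \<phi> :: ('a, 'f) gmod)"
    "bchar (V_of G p rbar \<phi>) = \<phi>"
    unfolding V_of_def by auto
qed

lemma P_of:
  assumes "\<phi> \<in> IBr G p rbar"
  shows "is_projective_cover G (P_of G p rbar \<phi>) (V_of G p rbar \<phi> :: ('a, 'f) gmod)"
  unfolding P_of_def by (rule someI_ex[OF projective_cover_exists[OF V_of(1)[OF assms]]])

text \<open>\<open>\<chi> \<otimes> V\<^sub>\<phi>\<close> has the same Brauer character as \<open>V\<^sub>\<phi>\<close>, so the two modules are isomorphic, and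
  \<open>\<chi> \<otimes> P\<^sub>\<phi>\<close> and \<open>P\<^sub>\<phi>\<close> are projective covers of the same module.\<close>

lemma Phi_of_twist_invariant:
  assumes \<phi>: "\<phi> \<in> IBr G p rbar" and \<chi>: "linear_char \<chi>"
    and fixed: "bchar (twist \<chi> (V_of G p rbar \<phi>)) = \<phi>" and g: "g \<in> p_regular G p (carrier G)"
  shows "root_lift p rbar (to_ac (\<chi> g)) * Phi_of G p rbar \<phi> g = Phi_of G p rbar \<phi> g"
proof -
  let ?V = "V_of G p rbar \<phi> :: ('a, 'f) gmod" and ?P = "P_of G p rbar \<phi> :: ('a, 'f) gmod"
  note V = V_of[OF \<phi>] and P = P_of[OF \<phi>]
  note Vm = simple_gmodD(1)[OF V(1)]
  have Pm: "is_gmod G ?P"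
    using P unfolding is_projective_cover_def by (intro projective_gmodD(1)) simp
  note tV = simple_gmod_twist[OF \<chi> V(1)] and tP = is_gmod_twist[OF \<chi> Pm]
  have "gmod_iso (twist \<chi> ?V) ?V"
    by (rule simple_gmod_iso_of_equal_bchar[OF V(1) tV]) (simp add: V(2) fixed)
  then have "is_projective_cover G (twist \<chi> ?P) ?V"
    by (rule projective_cover_of_iso[OF projective_cover_twist[OF \<chi> P Vm] simple_gmodD(1)[OF tV] Vm])
  then have "bchar (twist \<chi> ?P) = bchar ?P"
    by (intro bchar_iso[OF tP Pm] projective_cover_unique[OF _ P Vm])
  then show ?thesis
    unfolding Phi_of_def using bchar_twist[OF \<chi> Pm g] by simp
qed

end

section \<open>Linear characters of abelian quotients\<close>

context finite_group_modules
begin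

lemma subgroup_containing_derived_is_normal:
  assumes H: "subgroup H G" and D: "derived G (carrier G) \<subseteq> H"
  shows "H \<lhd> G" "g \<in> carrier G \<Longrightarrow> h \<in> carrier G \<Longrightarrow> H #> (g \<otimes> h) = H #> (h \<otimes> g)"
proof -
  have comm: "g \<otimes> h \<otimes> inv g \<otimes> inv h \<in> H" if "g \<in> carrier G" "h \<in> carrier G" for g h
    using that D unfolding derived_def by (blast intro: generate.incl)
  show "H \<lhd> G"
    unfolding normal_inv_iff
  proof (intro conjI ballI H)
    fix g h assume g: "g \<in> carrier G" and h: "h \<in> H"
    have hc: "h \<in> carrier G" using subgroup.mem_carrier[OF H h] .
    have "(g \<otimes> h \<otimes> inv g \<otimes> inv h) \<otimes> h \<in> H"
      by (rule subgroup.m_closed[OF H comm[OF g hc] h])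
    then show "g \<otimes> h \<otimes> inv g \<in> H"
      using g hc by (simp add: m_assoc)
  qed
  show "H #> (g \<otimes> h) = H #> (h \<otimes> g)" if g: "g \<in> carrier G" and h: "h \<in> carrier G"
  proof -
    have "g \<otimes> h = (g \<otimes> h \<otimes> inv g \<otimes> inv h) \<otimes> (h \<otimes> g)"
      using g h by (simp add: m_assoc inv_solve_left' flip: m_assoc[of "inv h" h g] m_assoc[of "inv g" g])
    then have "g \<otimes> h \<in> H #> (h \<otimes> g)"
      using comm[OF g h] unfolding r_coset_def by blast
    then show ?thesis
      using repr_independence[OF _ _ H, of "g \<otimes> h" "h \<otimes> g"] g h by simp
  qed
qed

text \<open>\<open>M\<close> is the permutation module on \<open>G/H\<close>. Its endomorphism \<open>T = 1 - y\<close> is not zero because \<open>y\<close> moves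
  the coset \<open>H\<close>. A simple submodule \<open>N\<close> of the image of \<open>T\<close> has commuting operators, so all of them
  are endomorphisms of \<open>N\<close> and hence scalars \<open>\<chi>(g)\<close>. If \<open>\<chi>(y)\<close> were \<open>1\<close>, a nonzero vector
  \<open>w = u - y u\<close> of \<open>N\<close> would be fixed by \<open>y\<close>. Then \<open>y\<^sup>k u = u - k w\<close>, but \<open>y\<^sup>k\<close> is in \<open>H\<close> and acts
  trivially, so that \<open>k w = 0\<close>.\<close>

lemma exists_linear_char_separating:
  assumes split: "splitting_field G TYPE('f::field)"
    and H: "H \<lhd> G" and comm: "\<And>g h. g \<in> carrier G \<Longrightarrow> h \<in> carrier G \<Longrightarrow> H #> (g \<otimes> h) = H #> (h \<otimes> g)"
    and y: "y \<in> carrier G" "y \<notin> H" and k: "y [^] (k::nat) \<in> H" "of_nat k \<noteq> (0 :: 'f::field)"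
  obtains \<chi> :: "'a \<Rightarrow> 'f::field" where "linear_char \<chi>" "\<And>h. h \<in> H \<Longrightarrow> \<chi> h = 1" "\<chi> y \<noteq> 1"
proof -
  interpret H: normal H G by (rule H)
  interpret Q: group "G Mod H" by (rule H.factorgroup_is_group)
  have Qc: "carrier (G Mod H) = rcosets H" by (simp add: FactGroup_def)
  have Qm: "A <#> B = A \<otimes>\<^bsub>G Mod H\<^esub> B" for A B by simp
  have "finite (rcosets H)" by (simp add: finite_carrier RCOSETS_def)
  define n where "n = card (rcosets H)"
  obtain b where b: "bij_betw b {..<n} (rcosets H)"
    using ex_bij_betw_nat_finite[OF \<open>finite (rcosets H)\<close>] by (auto simp: n_def atLeast0LessThan)
  define b' where "b' = inv_into {..<n} b"
  have bc: "b i \<in> rcosets H" if "i < n" for i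
    using b that by (auto simp: bij_betw_def)
  have b'b: "b' (b i) = i" if "i < n" for i
    using bij_betw_inv_into_left[OF b] that by (simp add: b'_def)
  have bb': "b (b' A) = A" and b'n: "b' A < n" if "A \<in> rcosets H" for A
    using bij_betw_inv_into_right[OF b that] bij_betwE[OF bij_betw_inv_into[OF b]] that
    by (auto simp: b'_def)
  have rc: "H #> g \<in> rcosets H" if "g \<in> carrier G" for g
    using that H.subset by (rule rcosetsI[rotated])
  have Qclosed: "A <#> B \<in> rcosets H" if "A \<in> rcosets H" "B \<in> rcosets H" for A B
    by (rule H.setmult_closed[OF that])
  have HH: "H \<in> rcosets H" using H.subgroup_in_rcosets by blast
  have one_l: "H <#> A = A" if "A \<in> rcosets H" for A
    by (rule H.rcosets_mult_eq[OF that])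
  have one_r: "A <#> H = A" if "A \<in> rcosets H" for A
    using Q.r_one[of A] that unfolding Qc by simp
  have hom: "H #> (g \<otimes> h) = (H #> g) <#> (H #> h)" if "g \<in> carrier G" "h \<in> carrier G" for g h
    using H.rcos_sum[OF that] by simp
  have triv: "H #> g = H" if "g \<in> H" for g
    using coset_join2[OF _ H.subgroup_axioms that] that H.subset by blast
  define \<pi> where "\<pi> g i = b' ((H #> g) <#> b i)" for g i
  have \<pi>_less: "\<pi> g i < n" if "g \<in> carrier G" "i < n" for g i
    unfolding \<pi>_def by (rule b'n[OF Qclosed[OF rc[OF that(1)] bc[OF that(2)]]])
  have \<pi>_one: "\<pi> \<one> i = i" if "i < n" for i
    unfolding \<pi>_def using triv[OF H.one_closed] one_l[OF bc[OF that]] b'b[OF that] by simp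
  have \<pi>_mult: "\<pi> (g \<otimes> h) i = \<pi> g (\<pi> h i)"
    if g: "g \<in> carrier G" and h: "h \<in> carrier G" and i: "i < n" for g h i
    unfolding \<pi>_def bb'[OF Qclosed[OF rc[OF h] bc[OF i]]] hom[OF g h]
    using H.rcosets_assoc[OF rc[OF g] rc[OF h] bc[OF i]] by simp
  obtain M :: "('a, 'f) gmod" where M: "is_gmod G M" "gdim M = n"
    and act: "\<And>g i. g \<in> carrier G \<Longrightarrow> i < n \<Longrightarrow> gact M g *\<^sub>v unit_vec n i = unit_vec n (\<pi> g i)"
    by (rule permutation_gmod[of n \<pi>, OF \<pi>_less \<pi>_one \<pi>_mult]) blast+
  have Meq: "gact M g = gact M h" if g: "g \<in> carrier G" and h: "h \<in> carrier G" and eq: "H #> g = H #> h" for g h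
  proof (rule mat_col_eqI)
    note c = gactD(1)[OF M(1) g, unfolded M(2)] gactD(1)[OF M(1) h, unfolded M(2)]
    fix j assume "j < dim_col (gact M h)"
    then have j: "j < n" using c by simp
    show "col (gact M g) j = col (gact M h) j"
      unfolding mult_mat_unit_vec[OF c(1) j, symmetric] mult_mat_unit_vec[OF c(2) j, symmetric]
        act[OF g j] act[OF h j] \<pi>_def eq ..
  qed (use gactD(1)[OF M(1) g] gactD(1)[OF M(1) h] in auto)
  have Mtriv: "gact M h = 1\<^sub>m n" if "h \<in> H" for h
    using Meq[OF H.mem_carrier[OF that] one_closed] triv[OF that] triv[OF H.one_closed]
      gactD(3)[OF M(1)] M(2) by simp
  have Mcomm: "gact M g * gact M h = gact M h * gact M g" if "g \<in> carrier G" "h \<in> carrier G" for g h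
    using Meq[OF _ _ comm[OF that]] gactD(2)[OF M(1)] that by (metis m_closed)
  define A where "A = gact M y"
  have A: "A \<in> carrier_mat n n" unfolding A_def using gactD(1)[OF M(1) y(1)] M(2) by simp
  define T where "T = 1\<^sub>m n - A"
  have Tc: "T \<in> carrier_mat n n" unfolding T_def by (rule minus_carrier_mat[OF A])
  have Tv: "T *\<^sub>v u = u - A *\<^sub>v u" if "u \<in> carrier_vec n" for u
    unfolding T_def using that A minus_mult_distrib_mat_vec[OF one_carrier_mat A that] by simp
  have T: "T \<in> gmod_hom G M M"
  proof -
    have "T * gact M g = gact M g * T" if g: "g \<in> carrier G" for g
    proof -
      have c: "gact M g \<in> carrier_mat n n" using gactD(1)[OF M(1) g] M(2) by simp
      show ?thesis
        unfolding T_def using minus_mult_distrib_mat[OF one_carrier_mat A c]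
          mult_minus_distrib_mat[OF c one_carrier_mat A] Mcomm[OF y(1) g] c by (simp add: A_def)
    qed
    then show ?thesis unfolding gmod_hom_def using Tc M(2) by simp
  qed
  define W where "W = mat_image T (carrier_vec n)"
  have W: "gmod_sub G M W"
    unfolding W_def using gmod_sub_image[OF M(1) M(1) T gmod_sub_carrier[OF M(1)]] M(2) by simp
  have "W \<noteq> {0\<^sub>v (gdim M)}"
  proof
    assume W0: "W = {0\<^sub>v (gdim M)}"
    let ?e = "unit_vec n (b' H) :: 'f vec"
    have e: "?e \<in> carrier_vec n" by simp
    have "T *\<^sub>v ?e \<in> W" unfolding W_def using e by (rule imageI)
    then have "?e - A *\<^sub>v ?e = 0\<^sub>v n" using W0 M(2) Tv[OF e] by simp
    moreover have "A *\<^sub>v ?e = unit_vec n (b' (H #> y))"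
      unfolding A_def act[OF y(1) b'n[OF HH]] \<pi>_def bb'[OF HH] one_r[OF rc[OF y(1)]] ..
    ultimately have "(?e - unit_vec n (b' (H #> y))) = 0\<^sub>v n" by simp
    then have "vec_index (?e - unit_vec n (b' (H #> y))) (b' H) = 0"
      using b'n[OF HH] by simp
    then have "b' H = b' (H #> y)"
      using b'n[OF HH] b'n[OF rc[OF y(1)]] by (auto split: if_splits)
    then have "H = H #> y" using bb'[OF HH] bb'[OF rc[OF y(1)]] by metis
    then have "y \<in> H" using rcos_self[OF y(1) H.subgroup_axioms] by simp
    with y(2) show False ..
  qed
  then obtain N J where N: "simple_gmod G N" and J: "J \<in> gmod_hom G N M" "injective_mat J"
    "mat_image J (carrier_vec (gdim N)) \<subseteq> W"
    by (rule nonzero_gmod_sub_contains_simple[OF M(1) W])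
  note N' = simple_gmodD[OF N] and J' = gmod_homD[OF J(1)]
  have "gact N g \<in> gmod_hom G N N" if g: "g \<in> carrier G" for g
  proof -
    have "gact N g * gact N h = gact N h * gact N g" if h: "h \<in> carrier G" for h
    proof (rule injective_mat_cancel_left[OF J(2) J'(1)])
      have "J * gact N (g \<otimes> h) = J * gact N (h \<otimes> g)"
        using J'(2)[of "g \<otimes> h"] J'(2)[of "h \<otimes> g"] Meq[OF _ _ comm[OF g h]] g h by simp
      then show "J * (gact N g * gact N h) = J * (gact N h * gact N g)"
        using gactD(2)[OF N'(1)] g h by simp
    qed (use gactD(1)[OF N'(1) g] gactD(1)[OF N'(1) h] in \<open>auto intro: mult_carrier_mat\<close>)
    then show ?thesis
      unfolding gmod_hom_def using gactD(1)[OF N'(1) g] by simp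
  qed
  then have "\<forall>g\<in>carrier G. \<exists>c. gact N g = c \<cdot>\<^sub>m 1\<^sub>m (gdim N)"
    using split N unfolding splitting_field_def by blast
  then obtain \<chi> where \<chi>: "\<And>g. g \<in> carrier G \<Longrightarrow> gact N g = \<chi> g \<cdot>\<^sub>m 1\<^sub>m (gdim N)"
    by metis
  have \<chi>entry: "gact N g $$ (0, 0) = \<chi> g" if "g \<in> carrier G" for g
    unfolding \<chi>[OF that] using N'(2) by simp
  have "\<chi> (g \<otimes> h) = \<chi> g * \<chi> h" if g: "g \<in> carrier G" and h: "h \<in> carrier G" for g h
  proof -
    have "gact N (g \<otimes> h) = (\<chi> g \<cdot>\<^sub>m 1\<^sub>m (gdim N)) * (\<chi> h \<cdot>\<^sub>m 1\<^sub>m (gdim N))"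
      unfolding gactD(2)[OF N'(1) g h] \<chi>[OF g] \<chi>[OF h] ..
    also have "\<dots> = (\<chi> g * \<chi> h) \<cdot>\<^sub>m 1\<^sub>m (gdim N)"
      by (simp add: mult_smult_assoc_mat[of _ "gdim N" "gdim N" _ "gdim N"] smult_smult_mat)
    finally show ?thesis
      using \<chi>entry[of "g \<otimes> h"] g h N'(2) by simp
  qed
  moreover have \<chi>H: "\<chi> h = 1" if "h \<in> H" for h
  proof -
    have hc: "h \<in> carrier G" using that by (rule H.mem_carrier)
    have "gact N h = 1\<^sub>m (gdim N)"
    proof (rule injective_mat_cancel_left[OF J(2) J'(1)])
      show "J * gact N h = J * 1\<^sub>m (gdim N)"
        unfolding J'(2)[OF hc] Mtriv[OF that] using J'(1) M(2) by simp
    qed (use gactD(1)[OF N'(1) hc] in auto)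
    then show ?thesis using \<chi>entry[OF hc] N'(2) by simp
  qed
  ultimately have lin: "linear_char \<chi>"
    unfolding linear_char_def by (simp add: H.one_closed)
  have "\<chi> y \<noteq> 1"
  proof
    assume \<chi>y: "\<chi> y = 1"
    define w where "w = J *\<^sub>v unit_vec (gdim N) 0"
    have w: "w \<in> carrier_vec n"
      unfolding w_def using mult_mat_vec_carrier[OF J'(1) unit_vec_carrier] M(2) by simp
    have "gact N y = 1\<^sub>m (gdim N)" using \<chi>[OF y(1)] \<chi>y by (simp add: one_smult_mat)
    then have Aw: "A *\<^sub>v w = w"
      using gmod_hom_mult_vec[OF N'(1) M(1) J(1) y(1), of "unit_vec (gdim N) 0"]
      by (simp add: A_def w_def)
    have "w \<in> W" using J(3) unfolding w_def by (auto simp: image_subset_iff)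
    then obtain u where u: "u \<in> carrier_vec n" "w = u - A *\<^sub>v u"
      unfolding W_def using Tv by auto
    have Au: "A *\<^sub>v u = u - w"
      unfolding u(2) using u(1) mult_mat_vec_carrier[OF A u(1)] by (intro eq_vecI) (auto simp del: index_mult_mat_vec)
    have "gact M (y [^] i) *\<^sub>v u = u - of_nat i \<cdot>\<^sub>v w" for i :: nat
    proof (induction i)
      case 0
      have "u = u - 0 \<cdot>\<^sub>v w" using u(1) w by (intro eq_vecI) auto
      then show ?case using gactD(3)[OF M(1)] M(2) u(1) by simp
    next
      case (Suc i)
      have iw: "of_nat i \<cdot>\<^sub>v w \<in> carrier_vec n" using w by simp
      have "gact M (y [^] Suc i) *\<^sub>v u = A *\<^sub>v (gact M (y [^] i) *\<^sub>v u)"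
        unfolding A_def nat_pow_Suc2[OF y(1)]
        by (rule gact_mult_vec[OF M(1) y(1)]) (use y u M(2) in auto)
      also have "\<dots> = A *\<^sub>v u - of_nat i \<cdot>\<^sub>v w"
        unfolding Suc mult_mat_vec_diff[OF A u(1) iw] mult_mat_vec[OF A w] Aw ..
      also have "\<dots> = u - of_nat (Suc i) \<cdot>\<^sub>v w"
        unfolding Au using u(1) w by (intro eq_vecI) (auto simp: algebra_simps)
      finally show ?case .
    qed
    then have uk: "u - of_nat k \<cdot>\<^sub>v w = u"
      using Mtriv[OF k(1)] u(1) by (metis one_mult_mat_vec)
    have "vec_index w i = 0" if i: "i < n" for i
    proof -
      have "vec_index (u - of_nat k \<cdot>\<^sub>v w) i = vec_index u i" unfolding uk ..
      then show ?thesis using i k(2) u(1) w by simp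
    qed
    then have "J *\<^sub>v unit_vec (gdim N) 0 = J *\<^sub>v 0\<^sub>v (gdim N)"
      unfolding mult_mat_vec_zero[OF J'(1)] w_def[symmetric] using w M(2) by (intro eq_vecI) auto
    from injective_matD[OF J(2) J'(1) _ _ this] have "unit_vec (gdim N) 0 = (0\<^sub>v (gdim N) :: 'f vec)"
      by simp
    then show False using unit_vec_nonzero[OF N'(2), where 'a = 'f] by simp
  qed
  with lin \<chi>H that show ?thesis by blast
qed

end

section \<open>Orbits of linear characters on Brauer characters\<close>

text \<open>The length of an orbit is the least period of its elements. The orbits are split off one at a
  time.\<close>

lemma dvd_card_of_dvd_periods:
  assumes "finite S" "\<sigma> ` S = S" "\<And>s k. s \<in> S \<Longrightarrow> (\<sigma> ^^ k) s = s \<Longrightarrow> m dvd k"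
  shows "m dvd card S"
  using assms
proof (induction S rule: finite_psubset_induct)
  case (psubset S)
  show ?case
  proof (cases "S = {}")
    case False
    then obtain s where s: "s \<in> S" by auto
    have inj: "inj_on \<sigma> S"
      using psubset.hyps psubset.prems(1) by (intro eq_card_imp_inj_on) auto
    then have bij: "bij_betw (\<sigma> ^^ i) S S" for i
      using psubset.prems(1) by (intro bij_betw_funpow) (simp add: bij_betw_def)
    have inS: "(\<sigma> ^^ i) s \<in> S" for i
      using bij_betwE[OF bij] s by blast
    have period: "(\<sigma> ^^ (j - i)) s = s" if "i < j" "(\<sigma> ^^ i) s = (\<sigma> ^^ j) s" for i j
    proof -
      have "(\<sigma> ^^ j) s = (\<sigma> ^^ i) ((\<sigma> ^^ (j - i)) s)"
        using that(1) by (metis add_diff_inverse_nat funpow_add less_imp_not_less o_apply)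
      then show ?thesis
        using bij_betw_imp_inj_on[OF bij[of i]] that(2) inS s by (metis inj_onD)
    qed
    have "\<not> inj (\<lambda>i. (\<sigma> ^^ i) s)"
      using psubset.hyps inS finite_subset[of "range (\<lambda>i. (\<sigma> ^^ i) s)" S]
      by (metis finite_imageD image_subsetI infinite_UNIV_nat)
    then obtain i j where "i < j" "(\<sigma> ^^ i) s = (\<sigma> ^^ j) s"
      unfolding inj_def by (metis linorder_neq_iff)
    with period have ex: "\<exists>k. 0 < k \<and> (\<sigma> ^^ k) s = s"
      by (metis zero_less_diff)
    define n where "n = (LEAST k. 0 < k \<and> (\<sigma> ^^ k) s = s)"
    have n: "0 < n" "(\<sigma> ^^ n) s = s"
      using LeastI_ex[OF ex] unfolding n_def by auto
    have least: "\<not> (0 < k \<and> (\<sigma> ^^ k) s = s)" if "k < n" for k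
      using not_less_Least that unfolding n_def by blast
    define B where "B = (\<lambda>i. (\<sigma> ^^ i) s) ` {..<n}"
    have injB: "inj_on (\<lambda>i. (\<sigma> ^^ i) s) {..<n}"
    proof (rule linorder_inj_onI)
      fix i j assume ij: "i < j" "i \<in> {..<n}" "j \<in> {..<n}"
      show "(\<sigma> ^^ i) s \<noteq> (\<sigma> ^^ j) s"
        using period[OF ij(1)] least[of "j - i"] ij by auto
    qed auto
    have cardB: "card B = n" unfolding B_def by (simp add: card_image[OF injB])
    have BS: "B \<subseteq> S" unfolding B_def using inS by auto
    have "\<sigma> ((\<sigma> ^^ i) s) \<in> B" if "i < n" for i
    proof (cases "Suc i = n")
      case True
      then have "\<sigma> ((\<sigma> ^^ i) s) = (\<sigma> ^^ 0) s" using n(2) by auto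
      then show ?thesis unfolding B_def using n(1) by (intro image_eqI[of _ _ 0]) auto
    next
      case False
      with that show ?thesis unfolding B_def by (intro image_eqI[of _ _ "Suc i"]) auto
    qed
    then have "\<sigma> ` B \<subseteq> B" unfolding B_def by auto
    then have \<sigma>B: "\<sigma> ` B = B"
      using inj_on_subset[OF inj BS] finite_subset[OF BS psubset.hyps] by (intro endo_inj_surj)
    have "\<sigma> ` (S - B) = S - B"
      using inj_on_image_set_diff[OF inj, of S B] BS psubset.prems(1) \<sigma>B by simp
    moreover have "s \<in> B" unfolding B_def using n(1) by (intro image_eqI[of _ _ 0]) auto
    then have "S - B \<subset> S" using s by auto
    ultimately have "m dvd card (S - B)"
      using psubset.IH psubset.prems(2) by blast
    moreover have "m dvd card B"
      unfolding cardB using psubset.prems(2)[OF s n(2)] .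
    moreover have "card S = card B + card (S - B)"
      using card_Diff_subset[OF finite_subset[OF BS psubset.hyps] BS] card_mono[OF psubset.hyps BS] by simp
    ultimately show ?thesis by simp
  qed simp
qed

text \<open>The multiplicative order of \<open>c\<close> divides \<open>n\<close> but not \<open>n div q\<close>, so it contains the full power of
  \<open>q\<close> in \<open>n\<close>. The proof works with \<open>d = gcd k n\<close>, another exponent that annihilates \<open>c\<close>.\<close>

lemma prime_power_dvd_of_power_eq_1:
  fixes c :: "'f::field"
  assumes q: "prime q" "q dvd n" and o: "n > 0" "c ^ n = 1" "c ^ (n div q) \<noteq> 1" and k: "c ^ k = 1"
  shows "q ^ multiplicity q n dvd k"
proof (rule ccontr)
  let ?a = "multiplicity q n"
  assume not: "\<not> q ^ ?a dvd k"
  define d where "d = gcd k n"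
  have "c ^ d = 1"
  proof (cases "k = 0")
    case False
    then obtain x y where xy: "k * x = n * y + d"
      using bezout_nat[of k n] unfolding d_def by blast
    have "c ^ (k * x) = c ^ (n * y) * c ^ d" unfolding xy by (rule power_add)
    then show ?thesis using k o by (simp add: power_mult)
  qed (use not in simp)
  obtain e where e: "n = d * e" unfolding d_def by (metis dvdE gcd_dvd2)
  have "q dvd e"
  proof (rule ccontr)
    assume "\<not> q dvd e"
    then have "coprime (q ^ ?a) e" using q(1) by (simp add: prime_imp_coprime)
    moreover have "q ^ ?a dvd d * e" using multiplicity_dvd[of q n] e by simp
    ultimately have "q ^ ?a dvd d" by (simp add: coprime_dvd_mult_left_iff)
    then show False using not unfolding d_def by (metis dvd_trans gcd_dvd1)
  qed
  then obtain e' where "e = q * e'" by (rule dvdE)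
  then have "n div q = d * e'" using e q(1) by (simp add: prime_gt_0_nat)
  then show False using o(3) \<open>c ^ d = 1\<close> by (simp add: power_mult)
qed

context brauer_setup
begin

lemma twist_twist: "twist \<chi> (twist \<psi> M) = twist (\<lambda>g. \<chi> g * \<psi> g) M"
  by (simp add: twist_def smult_smult_mat)

lemma root_lift_linear_char:
  assumes "linear_char \<chi>" "g \<in> p_regular G p (carrier G)"
  shows "root_lift p rbar (to_ac (\<chi> g)) ^ ord g = 1" "rbar (root_lift p rbar (to_ac (\<chi> g))) = to_ac (\<chi> g)"
proof -
  note g = p_regularD[OF assms(2)]
  have "\<chi> g ^ ord g = 1"
    using linear_char_pow[OF assms(1) g(1), of "ord g"] g assms(1) by (simp add: linear_char_def)
  then have "to_ac (\<chi> g) ^ ord g = 1" by (metis to_ac_1 to_ac_power)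
  from root_lift[OF g(2,3) this]
  show "root_lift p rbar (to_ac (\<chi> g)) ^ ord g = 1" "rbar (root_lift p rbar (to_ac (\<chi> g))) = to_ac (\<chi> g)" .
qed

text \<open>The map \<open>\<sigma>\<close> below is \<open>\<phi> \<mapsto> \<chi> \<otimes> \<phi>\<close> on Brauer characters. If \<open>\<sigma>\<^sup>k\<close> fixes \<open>\<phi>\<close>, then the lift of
  \<open>\<chi>(x)\<^sup>k\<close> fixes the two numbers \<open>\<phi>(x)\<close> and \<open>\<Phi>\<^sub>\<phi>(x)\<close> under multiplication. As one of them is not
  zero, \<open>\<chi>(x)\<^sup>k = 1\<close> and \<open>m\<close> divides \<open>k\<close>.\<close>

lemma dvd_card_IBr_of_nonvanishing:
  fixes \<chi> :: "'a \<Rightarrow> 'f"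
  assumes \<chi>: "linear_char \<chi>" and x: "x \<in> p_regular G p (carrier G)"
    and order: "\<And>k. \<chi> x ^ k = 1 \<Longrightarrow> m dvd k"
    and nonvanishing: "\<And>\<phi>. \<phi> \<in> IBr G p rbar \<Longrightarrow> \<phi> x \<noteq> 0 \<or> Phi_of G p rbar \<phi> x \<noteq> 0"
  shows "m dvd card (IBr G p rbar)"
proof (cases "finite (IBr G p rbar)")
  case True
  let ?r = "\<lambda>g. root_lift p rbar (to_ac (\<chi> g))"
  define \<sigma> where "\<sigma> \<phi> = (\<lambda>g\<in>p_regular G p (carrier G). ?r g * \<phi> g)" for \<phi>
  have \<sigma>_bchar: "\<sigma> (bchar V) = bchar (twist \<chi> V)" if "is_gmod G V" for V
    unfolding \<sigma>_def
  proof
    fix g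
    show "(\<lambda>g\<in>p_regular G p (carrier G). ?r g * bchar V g) g = bchar (twist \<chi> V) g"
      using bchar_twist[OF \<chi> that, of g] by (cases "g \<in> p_regular G p (carrier G)") (auto simp: brauer_char_def)
  qed
  have into: "\<sigma> ` IBr G p rbar \<subseteq> IBr G p rbar"
  proof clarify
    fix \<phi> assume "\<phi> \<in> IBr G p rbar"
    note V = V_of[OF this]
    have "\<sigma> \<phi> = bchar (twist \<chi> (V_of G p rbar \<phi>))"
      using \<sigma>_bchar[OF simple_gmodD(1)[OF V(1)]] V(2) by simp
    then show "\<sigma> \<phi> \<in> IBr G p rbar"
      unfolding IBr_def using simple_gmod_twist[OF \<chi> V(1)] by blast
  qed
  have "inj_on \<sigma> (IBr G p rbar)"
  proof (rule inj_onI, rule ext)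
    fix \<phi> \<psi> g assume \<phi>: "\<phi> \<in> IBr G p rbar" and \<psi>: "\<psi> \<in> IBr G p rbar" and eq: "\<sigma> \<phi> = \<sigma> \<psi>"
    show "\<phi> g = \<psi> g"
    proof (cases "g \<in> p_regular G p (carrier G)")
      case g: True
      have "?r g \<noteq> 0"
        using root_lift_linear_char(1)[OF \<chi> g] p_regularD(2)[OF g] by (auto simp: power_0_left)
      then show ?thesis using fun_cong[OF eq, of g] g by (simp add: \<sigma>_def)
    next
      case False
      then show ?thesis
        using fun_cong[OF V_of(2)[OF \<phi>], of g] fun_cong[OF V_of(2)[OF \<psi>], of g]
        by (simp add: brauer_char_def)
    qed
  qed
  then have surj: "\<sigma> ` IBr G p rbar = IBr G p rbar"
    by (rule endo_inj_surj[OF True into])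
  show ?thesis
  proof (rule dvd_card_of_dvd_periods[OF True surj])
    fix \<phi> k assume \<phi>: "\<phi> \<in> IBr G p rbar" and fixed: "(\<sigma> ^^ k) \<phi> = \<phi>"
    let ?V = "V_of G p rbar \<phi> :: ('a, 'f) gmod" and ?\<chi>k = "\<lambda>g. \<chi> g ^ k"
    note V = V_of[OF \<phi>] and \<chi>k = linear_char_power[OF \<chi>, of k]
    note Vm = simple_gmodD(1)[OF V(1)]
    have "(\<sigma> ^^ i) \<phi> = bchar (twist (\<lambda>g. \<chi> g ^ i) ?V)" for i
    proof (induction i)
      case 0
      have "twist (\<lambda>g. \<chi> g ^ 0) ?V = ?V"
        by (simp add: twist_def one_smult_mat)
      then show ?case using V(2) by simp
    next
      case (Suc i)
      then show ?case
        using \<sigma>_bchar[OF is_gmod_twist[OF linear_char_power[OF \<chi>] Vm]] by (simp add: twist_twist)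
    qed
    then have fix\<chi>: "bchar (twist ?\<chi>k ?V) = \<phi>" using fixed by simp
    let ?s = "root_lift p rbar (to_ac (\<chi> x ^ k))"
    have "?s * \<phi> x = \<phi> x"
      using bchar_twist[OF \<chi>k Vm x] fix\<chi> V(2) by simp
    moreover have "?s * Phi_of G p rbar \<phi> x = Phi_of G p rbar \<phi> x"
      by (rule Phi_of_twist_invariant[OF \<phi> \<chi>k fix\<chi> x])
    ultimately have "?s = 1"
      using nonvanishing[OF \<phi>] by (metis mult_cancel_right1 mult.commute)
    then have "to_ac (\<chi> x ^ k) = (1 :: 'f alg_closure)"
      using root_lift_linear_char(2)[OF \<chi>k x] by simp
    then have "\<chi> x ^ k = 1" by (metis to_ac_1 to_ac_eq_iff)
    then show "m dvd k" by (rule order)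
  qed
qed simp

text \<open>One prime \<open>q\<close> at a time. For the order \<open>n\<close> of the coset of \<open>x\<close>, the element \<open>y\<close> with exponent
  \<open>n div q\<close> is not in \<open>H\<close>, and a linear character with \<open>\<chi>(y) \<noteq> 1\<close> gives \<open>\<chi>(x)\<close> an order with the
  full \<open>q\<close>-part of \<open>n\<close>. Here \<open>q \<noteq> p\<close>, because \<open>n\<close> divides the order of the \<open>p\<close>-regular element
  \<open>x\<close>.\<close>

lemma order_in_quotient_dvd_card_IBr:
  assumes H: "subgroup H G" "derived G (carrier G) \<subseteq> H"
    and x: "x \<in> p_regular G p (carrier G)"
    and nonvanishing: "\<And>\<phi>. \<phi> \<in> IBr G p rbar \<Longrightarrow> \<phi> x \<noteq> 0 \<or> Phi_of G p rbar \<phi> x \<noteq> 0"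
  shows "group.ord (G Mod H) (H #> x) dvd card (IBr G p rbar)"
proof (cases "card (IBr G p rbar) = 0")
  case False
  note HN = subgroup_containing_derived_is_normal(1)[OF H]
  interpret H: normal H G by (rule HN)
  interpret Q: group "G Mod H" by (rule H.factorgroup_is_group)
  note x' = p_regularD[OF x]
  define n where "n = Q.ord (H #> x)"
  have xQ: "H #> x \<in> carrier (G Mod H)"
    using x'(1) by (auto simp: carrier_FactGroup)
  have finQ: "finite (carrier (G Mod H))"
    using finite_carrier by (simp add: carrier_FactGroup)
  have o0: "n > 0" unfolding n_def using Q.ord_ge_1[OF finQ xQ] by simp
  have pow_in_H: "x [^] k \<in> H \<longleftrightarrow> n dvd k" for k :: nat
  proof -
    have "x [^] k \<in> H \<longleftrightarrow> H #> (x [^] k) = H"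
      using coset_join1[OF _ nat_pow_closed[OF x'(1)] H.subgroup_axioms]
        coset_join2[OF nat_pow_closed[OF x'(1)] H.subgroup_axioms] by blast
    also have "\<dots> \<longleftrightarrow> (H #> x) [^]\<^bsub>G Mod H\<^esub> k = \<one>\<^bsub>G Mod H\<^esub>"
      using H.FactGroup_pow[OF x'(1), of k] by simp
    also have "\<dots> \<longleftrightarrow> n dvd k"
      unfolding n_def by (rule Q.pow_eq_id[OF xQ])
    finally show ?thesis .
  qed
  have "n dvd ord x" using pow_in_H[of "ord x"] x'(1) H.one_closed by simp
  have "multiplicity q n \<le> multiplicity q (card (IBr G p rbar))" if q: "prime q" for q
  proof (cases "q dvd n")
    case True
    define y where "y = x [^] (n div q)"
    have oq: "n = (n div q) * q" using True by simp
    have "0 < n div q" using oq o0 by (metis gr0I mult_0)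
    moreover have "n div q < n" by (rule div_less_dividend[OF prime_gt_1_nat[OF q] o0])
    ultimately have "\<not> n dvd n div q" by (rule nat_dvd_not_less)
    then have y: "y \<in> carrier G" "y \<notin> H"
      unfolding y_def pow_in_H using x'(1) by simp_all
    have "y [^] q \<in> H"
      unfolding y_def nat_pow_pow[OF x'(1)] pow_in_H using oq by simp
    moreover have "\<not> p dvd q"
      using x'(3) True \<open>n dvd ord x\<close> q prime_p
      by (metis coprime_common_divisor dvd_refl dvd_trans not_prime_unit primes_dvd_imp_eq)
    then have "of_nat q \<noteq> (0 :: 'f)"
      using of_nat_eq_0_iff_char_dvd[where 'a = 'f] char_residue_field by simp
    ultimately obtain \<chi> :: "'a \<Rightarrow> 'f" where \<chi>: "linear_char \<chi>" "\<And>h. h \<in> H \<Longrightarrow> \<chi> h = 1" "\<chi> y \<noteq> 1"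
      using exists_linear_char_separating[OF splitting HN subgroup_containing_derived_is_normal(2)[OF H] y]
      by metis
    have "\<chi> x ^ n = 1"
      using \<chi>(2)[of "x [^] n"] pow_in_H[of n] linear_char_pow[OF \<chi>(1) x'(1), of n] by simp
    moreover have "\<chi> x ^ (n div q) \<noteq> 1"
      using \<chi>(3) linear_char_pow[OF \<chi>(1) x'(1)] unfolding y_def by simp
    ultimately have "\<And>k. \<chi> x ^ k = 1 \<Longrightarrow> q ^ multiplicity q n dvd k"
      by (rule prime_power_dvd_of_power_eq_1[OF q True o0])
    then have "q ^ multiplicity q n dvd card (IBr G p rbar)"
      by (rule dvd_card_IBr_of_nonvanishing[OF \<chi>(1) x _ nonvanishing])
    then show ?thesis
      using False q by (intro multiplicity_geI) (auto simp: prime_gt_1_nat)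
  qed (simp add: not_dvd_imp_multiplicity_0)
  then have "n dvd card (IBr G p rbar)"
    using o0 False by (intro multiplicity_le_imp_dvd) auto
  then show ?thesis by (simp add: n_def)
qed simp

end

theorem corollary1p4:
  fixes G :: "('g, 'b) monoid_scheme"
    and v :: "'k::field_char_0 \<Rightarrow> int"
    and red :: "'k \<Rightarrow> 'f::field"
    and rbar :: "'k alg_closure \<Rightarrow> 'f alg_closure"
    and p l :: nat and H :: "'g set" and x :: 'g
  assumes "group G" and "finite (carrier G)" and "prime p"
    and "splitting_p_modular_system G v p red"
    and "extends_reduction v red rbar"
    and "H = derived G (carrier G) <#>\<^bsub>G\<^esub> O_upper_p' G p"
    and "l = card (IBr G p rbar)"
    and "x \<in> p_regular G p (carrier G) - p_regular G p H"
  shows "(\<not> group.ord (G Mod H) (x <#\<^bsub>G\<^esub> H) dvd l \<longrightarrow>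
            (\<exists>\<phi>\<in>IBr G p rbar. \<phi> x = 0 \<and> Phi_of G p rbar \<phi> x = 0)) \<and>
         (gcd (group.ord (G Mod H) (x <#\<^bsub>G\<^esub> H)) l = 1 \<longrightarrow>
            (\<exists>\<phi>\<in>IBr G p rbar. \<phi> x = 0 \<and> Phi_of G p rbar \<phi> x = 0))"
proof -
  interpret S: splitting_p_modular_system G v p red by (rule assms(4))
  interpret group G by (rule assms(1))
  interpret brauer_setup G v p red rbar
    by unfold_locales (fact assms(2,5) S.splitting_F)+
  have Op: "subgroup (O_upper_p' G p) G"
    unfolding O_upper_p'_def by (intro generate_is_subgroup) auto
  have D: "derived G (carrier G) \<lhd> G"
    by (rule derived_self_is_normal)
  then have D': "subgroup (derived G (carrier G)) G" by (rule normal_imp_subgroup)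
  have H: "subgroup H G"
    unfolding assms(6) by (rule mult_norm_subgroup[OF D Op])
  have "derived G (carrier G) \<subseteq> H"
  proof
    fix d assume d: "d \<in> derived G (carrier G)"
    have "d \<otimes>\<^bsub>G\<^esub> \<one>\<^bsub>G\<^esub> = d" using subgroup.mem_carrier[OF D' d] by (rule r_one)
    then show "d \<in> H"
      unfolding assms(6) set_mult_def using d subgroup.one_closed[OF Op] by force
  qed
  note DH = this
  interpret H: normal H G by (rule subgroup_containing_derived_is_normal(1)[OF H DH])
  interpret Q: group "G Mod H" by (rule H.factorgroup_is_group)
  have x: "x \<in> p_regular G p (carrier G)" "x \<in> carrier G" "x \<notin> H"
    using assms(8) unfolding p_regular_def by auto
  have coset: "x <#\<^bsub>G\<^esub> H = H #>\<^bsub>G\<^esub> x"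
    using H.coset_eq x(2) by simp
  have xQ: "H #>\<^bsub>G\<^esub> x \<in> carrier (G Mod H)"
    using x(2) by (auto simp: carrier_FactGroup)
  have vanishing: "\<exists>\<phi>\<in>IBr G p rbar. \<phi> x = 0 \<and> Phi_of G p rbar \<phi> x = 0"
    if ndvd: "\<not> group.ord (G Mod H) (x <#\<^bsub>G\<^esub> H) dvd l"
  proof (rule ccontr)
    assume "\<not> ?thesis"
    then have "\<phi> x \<noteq> 0 \<or> Phi_of G p rbar \<phi> x \<noteq> 0" if "\<phi> \<in> IBr G p rbar" for \<phi>
      using that by blast
    from order_in_quotient_dvd_card_IBr[OF H DH x(1) this] show False
      using ndvd unfolding coset assms(7) by simp
  qed
  have ndvd_of_coprime: "\<not> group.ord (G Mod H) (x <#\<^bsub>G\<^esub> H) dvd l"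
    if "gcd (group.ord (G Mod H) (x <#\<^bsub>G\<^esub> H)) l = 1"
  proof
    assume "group.ord (G Mod H) (x <#\<^bsub>G\<^esub> H) dvd l"
    with that have "Q.ord (H #>\<^bsub>G\<^esub> x) = 1" unfolding coset by (simp add: gcd_nat.absorb1)
    then have "H #>\<^bsub>G\<^esub> x = H" using Q.ord_eq_1[OF xQ] by simp
    then show False using rcos_self[OF x(2) H.subgroup_axioms] x(3) by simp
  qed
  show ?thesis
  proof (intro conjI impI)
    assume "\<not> group.ord (G Mod H) (x <#\<^bsub>G\<^esub> H) dvd l"
    then show "\<exists>\<phi>\<in>IBr G p rbar. \<phi> x = 0 \<and> Phi_of G p rbar \<phi> x = 0"
      by (rule vanishing)
  next
    assume "gcd (group.ord (G Mod H) (x <#\<^bsub>G\<^esub> H)) l = 1"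
    then show "\<exists>\<phi>\<in>IBr G p rbar. \<phi> x = 0 \<and> Phi_of G p rbar \<phi> x = 0"
      by (rule vanishing[OF ndvd_of_coprime])
  qed
qed

end
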